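(* Let $\Delta\in\{4,6,8\}$, and let $\nu^*_\Delta\in(0,\Delta/4)$ be the number such that $H_\Delta(\nu^*_\Delta/2)=0$, where $H_\Delta$ is the function defined in the context. In particular, $\nu^*_4=0.4894\dots$, $\nu^*_6=1.1205\dots$, $\nu^*_8=1.8130\dots$. Then, for any constant $\nu<\nu^*_\Delta$, a random graph $G\sim\mathcal{P}(n,\Delta)$ satisfies $\iota(G)>\nu$ asymptotically almost surely, i.e. $\Pr_{G\sim\mathcal{P}(n,\Delta)}[\iota(G)>\nu]\to 1$ as $n\to\infty$ (over even $n$, with $\Delta$ and $\nu$ fixed).
   Context: Notation: $[K]=\{1,\dots,K\}$ and $[K]_0=\{0,1,\dots,K\}$. Throughout, $n$ is an even positive integer. Pairing model $\mathcal{P}(n,\Delta)$: choose a uniformly random perfect matching of the set $[n]\times[\Delta]$; then for each $i\in[n]$ merge the $\Delta$ elements $(i,1),\dots,(i,\Delta)$ into the single vertex $i$. The result is a random $\Delta$-regular graph $G$ on the vertex set $[n]$, possibly with loops and parallel edges; edges are counted with multiplicity. Expansion: for a graph $G=(V,E)$ and $\emptyset\ne S\subsetneq V$, let $\overline{S}=V\setminus S$, let $E(S,\overline{S})$ be the (multi)set of edges with one endpoint in $S$ and the other in $\overline{S}$, and let $$\iota_G(S)=\frac{|E(S,\overline{S})|}{\min\{|S|,|\overline{S}|\}},\qquad \iota(G)=\min_{\emptyset\neq S\subsetneq V}\iota_G(S).$$ The function $\Phi^*$: for $T\in\mathbb{N}$, reals $a,c>0$ and $\mathbf{b}=(b_0,\dots,b_T)$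 with all $b_i>0$, let $$\Phi^*(a,c,\mathbf{b})=\max\Big\{\sum_{i=0}^{T}y_i\ln(b_i/y_i)\ :\ y_i\ge 0\ (0\le i\le T),\ \sum_{i=0}^{T}y_i=a,\ \sum_{i=0}^{T}i\,y_i=c\Big\},$$ where a summand with $y_i=0$ is read as $0$. The function $H_\Delta$: for even $\Delta$, let $\mathbf{b}=(b_0,\dots,b_{\Delta/2})$ (so $T=\Delta/2$) with $b_i=\binom{\Delta}{i}$ for $i\neq\Delta/2$ and $b_{\Delta/2}=\frac12\binom{\Delta}{\Delta/2}$, and define $$H_\Delta(\gamma)=-\frac{\Delta}{2}\ln\Delta+\gamma\ln\gamma+\Big(\frac{\Delta}{2}-\gamma\Big)\ln\Big(\frac{\Delta}{2}-\gamma\Big)+2\,\Phi^*\Big(\frac12,\gamma,\mathbf{b}\Big).$$ *)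

theory Defs
  imports "HOL-Probability.Probability"
begin

text \<open>
  A multigraph is a vertex set together with a multiset of edges. An edge is the set of its
  endpoints, so a loop is a singleton and parallel edges are repeated elements of the multiset.
\<close>

type_synonym 'a multigraph = "'a set \<times> 'a set multiset"

definition verts :: "'a multigraph \<Rightarrow> 'a set" where
  "verts G = fst G"

definition edges :: "'a multigraph \<Rightarrow> 'a set multiset" where
  "edges G = snd G"

definition cut_edges :: "'a multigraph \<Rightarrow> 'a set \<Rightarrow> 'a set multiset" where
  "cut_edges G S = filter_mset (\<lambda>e. \<exists>u\<in>S. \<exists>v\<in>verts G - S. e = {u, v}) (edges G)"

definition set_expansion :: "'a multigraph \<Rightarrow> 'a set \<Rightarrow> real" where
  "set_expansion G S =
     real (size (cut_edges G S)) / real (min (card S) (card (verts G - S)))"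

text \<open>The minimum is meaningful for finite graphs with at least two vertices.\<close>

definition expansion :: "'a multigraph \<Rightarrow> real" where
  "expansion G = Min {set_expansion G S | S. S \<noteq> {} \<and> S \<subset> verts G}"

definition perfect_matchings :: "'a set \<Rightarrow> 'a set set set" where
  "perfect_matchings A = {M. partition_on A M \<and> (\<forall>e\<in>M. card e = 2)}"

text \<open>
  Merging the points \<open>(i, 1), \<dots>, (i, \<Delta>)\<close> into the vertex \<open>i\<close> sends the matching
  edge \<open>{(i, k), (j, l)}\<close> to \<open>{i, j}\<close>; multiplicities are kept.
\<close>

definition merge_matching :: "nat \<Rightarrow> (nat \<times> nat) set set \<Rightarrow> nat multigraph" where
  "merge_matching n M = ({1..n}, image_mset (\<lambda>e. fst ` e) (mset_set M))"

definition pairing_model :: "nat \<Rightarrow> nat \<Rightarrow> nat multigraph pmf" where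
  "pairing_model n \<Delta> =
     map_pmf (merge_matching n) (pmf_of_set (perfect_matchings ({1..n} \<times> {1..\<Delta>})))"

text \<open>
  \<open>Greatest\<close> expresses an attained maximum. The convention that a summand with
  \<open>y i = 0\<close> is \<open>0\<close> holds automatically, since such a summand is a product with
  \<open>0\<close>.
\<close>

definition Phi_star :: "nat \<Rightarrow> real \<Rightarrow> real \<Rightarrow> (nat \<Rightarrow> real) \<Rightarrow> real" where
  "Phi_star T a c b =
     (GREATEST z. z \<in> {(\<Sum>i\<le>T. y i * ln (b i / y i)) | y.
        (\<forall>i\<le>T. y i \<ge> 0) \<and> (\<Sum>i\<le>T. y i) = a \<and> (\<Sum>i\<le>T. real i * y i) = c})"

definition half_binom :: "nat \<Rightarrow> nat \<Rightarrow> real" where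
  "half_binom \<Delta> i =
     (if i = \<Delta> div 2 then real (\<Delta> choose i) / 2 else real (\<Delta> choose i))"

definition H :: "nat \<Rightarrow> real \<Rightarrow> real" where
  "H \<Delta> \<gamma> =
     - (real \<Delta> / 2) * ln (real \<Delta>) + \<gamma> * ln \<gamma>
     + (real \<Delta> / 2 - \<gamma>) * ln (real \<Delta> / 2 - \<gamma>)
     + 2 * Phi_star (\<Delta> div 2) (1 / 2) \<gamma> (half_binom \<Delta>)"

definition nu_star :: "nat \<Rightarrow> real" where
  "nu_star \<Delta> = (THE \<nu>. 0 < \<nu> \<and> \<nu> < real \<Delta> / 4 \<and> H \<Delta> (\<nu> / 2) = 0)"

end

theory Submission
  imports Defs "HOL-Analysis.Harmonic_Numbers" "HOL-Real_Asymp.Real_Asymp"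
begin

text \<open>
  The proof is a first moment argument over sets \<open>S\<close> of minimum expansion. Such a set is locally
  optimal: no vertex has more than half of its edges crossing. Breaking ties by the sum of the labels
  of \<open>S\<close> yields a threshold \<open>\<theta>\<close> such that, up to boundedly many exceptions, a vertex with exactly half
  of its edges crossing lies in \<open>S\<close> only if its label is at most \<open>\<theta>\<close> and outside \<open>S\<close> only if it is
  larger. Such a vertex can therefore be on one side only, and in the generating function
  \<open>(2 P(x))^n\<close> of all admissible configurations the weight of crossing degree \<open>\<Delta>/2\<close> is halved. The
  tilt \<open>x\<close> is fixed at the value that is optimal for \<open>\<nu>*\<close> and \<open>|S| = n/2\<close>, independently of \<open>S\<close>. The
  resulting exponent is a convex function of \<open>(|S|/n, cut/n)\<close>, so its sign only has to be checked at the
  corners of a quadrilateral. Sets with \<open>|S| \<le> 2n/5\<close> or with cuts well below \<open>\<nu>* |S|\<close> are excluded by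
  the cruder count that ignores local optimality.

  For the root of \<open>H\<close>, the maximum \<open>\<Phi>*\<close> is evaluated by duality, which parametrises \<open>\<gamma> = \<mu>(x)/2\<close> and
  turns \<open>H(\<gamma>)\<close> into an explicit function \<open>K(x)\<close>; its derivative is positive as long as \<open>\<mu>(x) < \<Delta>/4\<close>.
\<close>

section \<open>Perfect matchings and partners\<close>

text \<open>Local optimality needs expansion below 2. As \<Delta> is even, a vertex with too many
  crossing edges has an excess of at least two, so moving it lowers the cut by two while the size
  changes by one; this lowers the ratio as long as the cut is less than twice the set. All three
  values of \<nu>* are below 2.

  Tie-breaking costs only polynomial factors, for the choice of \<theta> and of the list of
  exceptions, and these vanish against exponentially small bounds. For sets of bounded size the
  bounds decay only like a power of n. The crude count must therefore lose factors polynomial in |S|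
  and never in n, which dictates the form of the Stirling estimates.

  Every tilt x gives a valid upper bound, and for fixed x the term ln(2 P(x)) - 2 c ln x is affine
  in the cut density c. Convexity then comes from the pairing term alone, whereas optimising x for
  each pair would take a minimum of convex functions and could destroy it. At |S| = n/2 with cut
  \<nu>* n/2 the exponent is exactly 0, so no slack is left there.\<close>

fun pm_count :: "nat \<Rightarrow> nat" where
  "pm_count 0 = 1"
| "pm_count (Suc 0) = 0"
| "pm_count (Suc (Suc n)) = Suc n * pm_count n"

lemma perfect_matchingsI:
  assumes "\<Union>M = A" "\<And>e. e \<in> M \<Longrightarrow> card e = 2"
    and "\<And>e f. e \<in> M \<Longrightarrow> f \<in> M \<Longrightarrow> e \<inter> f \<noteq> {} \<Longrightarrow> e = f"
  shows "M \<in> perfect_matchings A"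
proof -
  have "{} \<notin> M" using assms(2) by fastforce
  moreover have "disjoint M" using assms(3) unfolding disjoint_def by blast
  ultimately show ?thesis
    using assms(1,2) unfolding perfect_matchings_def partition_on_def by simp
qed

lemma perfect_matchingsD:
  assumes "M \<in> perfect_matchings A"
  shows "\<Union>M = A" "\<And>e. e \<in> M \<Longrightarrow> card e = 2"
    and "\<And>e f. e \<in> M \<Longrightarrow> f \<in> M \<Longrightarrow> e \<inter> f \<noteq> {} \<Longrightarrow> e = f"
  using assms unfolding perfect_matchings_def partition_on_def disjoint_def by auto

lemma finite_perfect_matchings: "finite A \<Longrightarrow> finite (perfect_matchings A)"
  by (rule finite_subset[of _ "Pow (Pow A)"]) (auto dest: perfect_matchingsD(1))

lemma perfect_matchings_remove:
  assumes "M \<in> perfect_matchings A" "e \<in> M"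
  shows "M - {e} \<in> perfect_matchings (A - e)"
proof (rule perfect_matchingsI)
  show "\<Union>(M - {e}) = A - e"
    using perfect_matchingsD[OF assms(1)] assms(2) by blast
qed (use perfect_matchingsD[OF assms(1)] in auto)

lemma perfect_matchings_add:
  assumes "M \<in> perfect_matchings A" "card e = 2" "e \<inter> A = {}"
  shows "insert e M \<in> perfect_matchings (A \<union> e)"
proof (rule perfect_matchingsI)
  show "\<Union>(insert e M) = A \<union> e"
    using perfect_matchingsD(1)[OF assms(1)] by auto
  fix f g assume "f \<in> insert e M" "g \<in> insert e M" "f \<inter> g \<noteq> {}"
  then show "f = g" using perfect_matchingsD(1,3)[OF assms(1)] assms(3) by blast
qed (use perfect_matchingsD[OF assms(1)] assms in auto)

lemma perfect_matchings_unfold: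
  assumes "a \<in> A"
  shows "perfect_matchings A = (\<Union>b\<in>A - {a}. insert {a,b} ` perfect_matchings (A - {a,b}))"
proof (intro equalityI subsetI)
  fix M assume M: "M \<in> perfect_matchings A"
  obtain e where e: "e \<in> M" "a \<in> e" using perfect_matchingsD(1)[OF M] assms by blast
  obtain b where b: "e = {a,b}" "b \<noteq> a"
    using perfect_matchingsD(2)[OF M e(1)] e(2) by (auto simp: card_2_iff)
  have "M - {e} \<in> perfect_matchings (A - {a,b})"
    using perfect_matchings_remove[OF M e(1)] b by simp
  moreover have "M = insert {a,b} (M - {e})" using e b by auto
  moreover have "b \<in> A" using perfect_matchingsD(1)[OF M] e b by blast
  ultimately show "M \<in> (\<Union>b\<in>A - {a}. insert {a,b} ` perfect_matchings (A - {a,b}))"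
    using b by blast
next
  fix M assume "M \<in> (\<Union>b\<in>A - {a}. insert {a,b} ` perfect_matchings (A - {a,b}))"
  then obtain b M' where b: "b \<in> A - {a}" "M = insert {a,b} M'"
    "M' \<in> perfect_matchings (A - {a,b})" by blast
  have "(A - {a,b}) \<union> {a,b} = A" using b assms by auto
  then show "M \<in> perfect_matchings A"
    using perfect_matchings_add[OF b(3), of "{a,b}"] b by (auto simp: card_2_iff)
qed

text \<open>Classify by the partner b of a fixed point a: there are \<open>card A - 1\<close>
  disjoint classes of equal size. So \<open>pm_count k\<close> is the double factorial (k - 1)!! for
  even k and 0 for odd k.\<close>

lemma card_perfect_matchings:
  "finite A \<Longrightarrow> card (perfect_matchings A) = pm_count (card A)"
proof (induction "card A" arbitrary: A rule: less_induct)
  case less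
  show ?case
  proof (cases "A = {}")
    case True
    have "perfect_matchings ({} :: 'a set) = {{}}"
      unfolding perfect_matchings_def by (auto simp: partition_on_empty)
    then show ?thesis using True by simp
  next
    case False
    then obtain a where a: "a \<in> A" by blast
    define B where "B b = insert {a,b} ` perfect_matchings (A - {a,b})" for b
    have cB: "card (B b) = pm_count (card A - 2)" if b: "b \<in> A - {a}" for b
    proof -
      have c: "card (A - {a,b}) = card A - 2"
        using a b less.prems by (subst card_Diff_subset) auto
      have pos: "card A > 0" using a less.prems card_gt_0_iff by blast
      have "inj_on (insert {a,b}) (perfect_matchings (A - {a,b}))"
      proof (rule inj_onI)
        fix x y assume xy: "x \<in> perfect_matchings (A - {a,b})" "y \<in> perfect_matchings (A - {a,b})"
          "insert {a,b} x = insert {a,b} y"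
        have "{a,b} \<notin> x" "{a,b} \<notin> y"
          using perfect_matchingsD(1)[OF xy(1)] perfect_matchingsD(1)[OF xy(2)] by blast+
        then show "x = y" using xy(3) insert_ident by metis
      qed
      then have "card (B b) = card (perfect_matchings (A - {a,b}))"
        unfolding B_def by (rule card_image)
      also have "\<dots> = pm_count (card A - 2)"
        using less.hyps[of "A - {a,b}"] c pos less.prems by simp
      finally show ?thesis .
    qed
    have disj: "B b \<inter> B b' = {}" if "b \<in> A - {a}" "b' \<in> A - {a}" "b \<noteq> b'" for b b'
    proof -
      have False if "M \<in> B b" "M \<in> B b'" for M
      proof -
        have "M \<in> perfect_matchings A"
          unfolding perfect_matchings_unfold[OF a] using that \<open>b \<in> A - {a}\<close> B_def by blast
        moreover have "{a,c} \<in> M" if "M \<in> B c" for c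
          using that unfolding B_def by (elim imageE) simp
        then have "{a,b} \<in> M" "{a,b'} \<in> M" using that by simp_all
        ultimately have "{a,b} = {a,b'}" using perfect_matchingsD(3)[of M A "{a,b}" "{a,b'}"] by auto
        then show False using \<open>b \<noteq> b'\<close> by (auto simp: doubleton_eq_iff)
      qed
      then show ?thesis by blast
    qed
    have "card (perfect_matchings A) = card (\<Union>b\<in>A - {a}. B b)"
      unfolding perfect_matchings_unfold[OF a] B_def by simp
    also have "\<dots> = (\<Sum>b\<in>A - {a}. card (B b))"
      using less.prems disj
      by (intro card_UN_disjoint) (auto simp: B_def finite_perfect_matchings)
    also have "\<dots> = (card A - 1) * pm_count (card A - 2)"
      using cB a less.prems by simp
    also have "\<dots> = pm_count (card A)"
    proof (cases "card A" rule: pm_count.cases)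
      case 1
      then show ?thesis using a less.prems by auto
    qed auto
    finally show ?thesis .
  qed
qed

section \<open>Partners and crossing points\<close>

definition partner :: "'a set set \<Rightarrow> 'a \<Rightarrow> 'a" where
  "partner M p = (THE q. q \<noteq> p \<and> {p,q} \<in> M)"

lemma partner:
  assumes M: "M \<in> perfect_matchings A" and p: "p \<in> A"
  shows "partner M p \<noteq> p" "{p, partner M p} \<in> M" "partner M p \<in> A"
    "partner M (partner M p) = p"
proof -
  have ex1: "\<exists>!q. q \<noteq> p \<and> {p,q} \<in> M" if p: "p \<in> A" for p
  proof -
    obtain e where e: "e \<in> M" "p \<in> e" using perfect_matchingsD(1)[OF M] p by blast
    obtain b where b: "e = {p,b}" "b \<noteq> p"
      using perfect_matchingsD(2)[OF M e(1)] e(2) by (auto simp: card_2_iff)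
    show ?thesis
    proof (rule ex1I[of _ b])
      fix q assume q: "q \<noteq> p \<and> {p,q} \<in> M"
      then have "{p,q} = {p,b}" using perfect_matchingsD(3)[OF M, of "{p,q}" "{p,b}"] e b by auto
      then show "q = b" using q by (auto simp: doubleton_eq_iff)
    qed (use e b in auto)
  qed
  have 1: "partner M p \<noteq> p \<and> {p, partner M p} \<in> M"
    unfolding partner_def by (rule theI'[OF ex1[OF p]])
  then show "partner M p \<noteq> p" "{p, partner M p} \<in> M" by auto
  show 2: "partner M p \<in> A" using 1 perfect_matchingsD(1)[OF M] by blast
  show "partner M (partner M p) = p"
    unfolding partner_def[of M "partner M p"]
    by (rule the1_equality[OF ex1[OF 2]]) (use 1 in \<open>auto simp: insert_commute\<close>)
qed

lemma edge_eq_partner: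
  assumes M: "M \<in> perfect_matchings A" and "e \<in> M" "p \<in> e"
  shows "e = {p, partner M p}"
proof -
  have "p \<in> A" using perfect_matchingsD(1)[OF M] assms by blast
  then show ?thesis using perfect_matchingsD(3)[OF M assms(2) partner(2)[OF M]] assms(3) by blast
qed

lemma inj_on_partner:
  assumes M: "M \<in> perfect_matchings U" and "W \<subseteq> U"
  shows "inj_on (partner M) W"
  by (rule inj_onI) (metis assms partner(4) subsetD)

lemma card_crossing_swap:
  assumes M: "M \<in> perfect_matchings U" and "W \<subseteq> U" "Z \<subseteq> U"
  shows "card {p\<in>W. partner M p \<in> Z} = card {p\<in>Z. partner M p \<in> W}"
proof (rule bij_betw_same_card[of "partner M"])
  show "bij_betw (partner M) {p \<in> W. partner M p \<in> Z} {p \<in> Z. partner M p \<in> W}"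
    by (rule bij_betwI[of _ _ _ "partner M"]) (use assms partner[OF M] in auto)
qed

text \<open>The factor 2 arises because a point of Z matched into W does not cross after merging,
  and its partner in W stops crossing. Only an inequality holds: pairs inside Z, which become loops
  when Z is a single vertex, do not cross either.\<close>

lemma card_crossing_union_le:
  assumes M: "M \<in> perfect_matchings U" and U: "finite U" and "W \<subseteq> U" "Z \<subseteq> U" "W \<inter> Z = {}"
  shows "card {p\<in>W \<union> Z. partner M p \<notin> W \<union> Z} + 2 * card {p\<in>Z. partner M p \<in> W}
    \<le> card {p\<in>W. partner M p \<notin> W} + card Z"
proof -
  have fin: "finite W" "finite Z"
    using finite_subset[OF \<open>W \<subseteq> U\<close> U] finite_subset[OF \<open>Z \<subseteq> U\<close> U] by auto
  have "{p\<in>W \<union> Z. partner M p \<notin> W \<union> Z} = {p\<in>W. partner M p \<notin> W \<union> Z} \<union> {p\<in>Z. partner M p \<notin> W \<union> Z}"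
    by blast
  then have "card {p\<in>W \<union> Z. partner M p \<notin> W \<union> Z}
      \<le> card {p\<in>W. partner M p \<notin> W \<union> Z} + card {p\<in>Z. partner M p \<notin> W \<union> Z}"
    by (simp only: card_Un_le)
  moreover have "card {p\<in>W. partner M p \<notin> W \<union> Z} + card {p\<in>W. partner M p \<in> Z}
      = card {p\<in>W. partner M p \<notin> W}"
  proof -
    have "{p\<in>W. partner M p \<notin> W} = {p\<in>W. partner M p \<notin> W \<union> Z} \<union> {p\<in>W. partner M p \<in> Z}"
      using \<open>W \<inter> Z = {}\<close> by blast
    then show ?thesis using fin by (simp add: card_Un_disjoint disjoint_iff)
  qed
  moreover have "card {p\<in>Z. partner M p \<notin> W \<union> Z} + card {p\<in>Z. partner M p \<in> W} \<le> card Z"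
  proof -
    have "card {p\<in>Z. partner M p \<notin> W \<union> Z} + card {p\<in>Z. partner M p \<in> W}
        = card ({p\<in>Z. partner M p \<notin> W \<union> Z} \<union> {p\<in>Z. partner M p \<in> W})"
      using fin by (subst card_Un_disjoint) auto
    also have "\<dots> \<le> card Z" using fin by (intro card_mono) auto
    finally show ?thesis .
  qed
  ultimately show ?thesis using card_crossing_swap[OF M \<open>W \<subseteq> U\<close> \<open>Z \<subseteq> U\<close>] by linarith
qed

section \<open>Counting matchings with prescribed crossing points\<close>

lemma perfect_matchings_restrict:
  assumes M: "M \<in> perfect_matchings U" and "W \<subseteq> U" and "\<And>p. p \<in> W \<Longrightarrow> partner M p \<in> W"
  shows "{e \<in> M. e \<subseteq> W} \<in> perfect_matchings W"
proof (rule perfect_matchingsI)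
  show "\<Union>{e \<in> M. e \<subseteq> W} = W"
  proof (intro equalityI subsetI)
    fix p assume "p \<in> W"
    then have "{p, partner M p} \<in> M" "{p, partner M p} \<subseteq> W"
      using assms partner[OF M] by auto
    then show "p \<in> \<Union>{e \<in> M. e \<subseteq> W}" by blast
  qed blast
qed (use perfect_matchingsD[OF M] in auto)

lemma card_inj_funcset_same:
  assumes "finite A" "finite B" "card A = card B"
  shows "card {f \<in> A \<rightarrow>\<^sub>E B. inj_on f A} = fact (card A)"
proof -
  have "card {f \<in> A \<rightarrow>\<^sub>E B. inj_on f A} = prod ((-) (card B)) {0..<card A}"
    using card_inj_on_subset_funcset[of A B A] assms by simp
  also have "\<dots> = fact (card A)" using assms by (simp add: fact_prod_rev)
  finally show ?thesis .
qed

text \<open>Such a matching is determined by three pieces: the bijection from A to B given by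
  \<open>partner\<close>, and the matchings induced on the noncrossing points of W and of U - W.
  Injectivity of this decomposition gives the bound.\<close>

lemma card_matchings_crossing_le:
  assumes U: "finite U" and W: "W \<subseteq> U" and A: "A \<subseteq> W" and B: "B \<subseteq> U - W" and c: "card A = card B"
  shows "card {M \<in> perfect_matchings U.
      {p\<in>W. partner M p \<notin> W} = A \<and> {p\<in>U - W. partner M p \<in> W} = B}
    \<le> fact (card A) * pm_count (card W - card A) * pm_count (card (U - W) - card B)"
proof -
  define X where "X = {M \<in> perfect_matchings U.
      {p\<in>W. partner M p \<notin> W} = A \<and> {p\<in>U - W. partner M p \<in> W} = B}"
  define F where "F = {f \<in> A \<rightarrow>\<^sub>E B. inj_on f A}"
  define \<phi> where "\<phi> M = (restrict (partner M) A, {e\<in>M. e \<subseteq> W - A}, {e\<in>M. e \<subseteq> (U - W) - B})" for M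
  have fin: "finite A" "finite B" "finite W" using U W A B by (auto intro: finite_subset)
  have into: "\<phi> M \<in> F \<times> perfect_matchings (W - A) \<times> perfect_matchings ((U - W) - B)" if "M \<in> X" for M
  proof -
    have M: "M \<in> perfect_matchings U" and MA: "{p\<in>W. partner M p \<notin> W} = A"
      and MB: "{p\<in>U - W. partner M p \<in> W} = B" using that unfolding X_def by auto
    note P = partner[OF M]
    have "restrict (partner M) A \<in> F"
    proof -
      have "A \<subseteq> U" using A W by auto
      moreover have "partner M p \<in> B" if "p \<in> A" for p
        using that MA MB P[of p] W by auto
      ultimately show ?thesis
        unfolding F_def using inj_on_partner[OF M, of A]
        by (simp add: inj_on_restrict_eq restrict_PiE_iff)
    qed
    moreover have "{e\<in>M. e \<subseteq> W - A} \<in> perfect_matchings (W - A)"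
    proof (rule perfect_matchings_restrict[OF M])
      fix p assume p: "p \<in> W - A"
      then have "p \<in> U" using W by auto
      then show "partner M p \<in> W - A" using p P[OF \<open>p \<in> U\<close>] MA by auto
    qed (use W in auto)
    moreover have "{e\<in>M. e \<subseteq> (U - W) - B} \<in> perfect_matchings ((U - W) - B)"
    proof (rule perfect_matchings_restrict[OF M])
      fix p assume p: "p \<in> (U - W) - B"
      then have "p \<in> U" using W by auto
      then show "partner M p \<in> (U - W) - B" using p P[OF \<open>p \<in> U\<close>] MB by auto
    qed auto
    ultimately show ?thesis unfolding \<phi>_def by simp
  qed
  have decomp: "M = {e\<in>M. e \<subseteq> W - A} \<union> {e\<in>M. e \<subseteq> (U - W) - B} \<union> (\<lambda>p. {p, restrict (partner M) A p}) ` A"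
    if "M \<in> X" for M
  proof -
    have M: "M \<in> perfect_matchings U" and MA: "{p\<in>W. partner M p \<notin> W} = A"
      and MB: "{p\<in>U - W. partner M p \<in> W} = B" using that unfolding X_def by auto
    note P = partner[OF M]
    show ?thesis
    proof (intro equalityI subsetI)
      fix e assume e: "e \<in> M"
      then obtain p where p: "p \<in> e" using perfect_matchingsD(2)[OF M e] by fastforce
      have pU: "p \<in> U" using perfect_matchingsD(1)[OF M] e p by blast
      have ee: "e = {p, partner M p}" using edge_eq_partner[OF M e p] .
      note Pp = P[OF pU]
      consider "p \<in> A" | "p \<in> B" | "p \<in> W - A" | "p \<in> U - W - B" using pU by blast
      then show "e \<in> {e\<in>M. e \<subseteq> W - A} \<union> {e\<in>M. e \<subseteq> (U - W) - B} \<union> (\<lambda>p. {p, restrict (partner M) A p}) ` A"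
      proof cases
        case 1
        then show ?thesis using ee by auto
      next
        case 2
        then have "partner M p \<in> A" using MA MB Pp by auto
        moreover have "e = {partner M p, partner M (partner M p)}" using ee Pp by auto
        ultimately show ?thesis by auto
      next
        case 3
        then have "partner M p \<in> W - A" using MA Pp by auto
        then show ?thesis using 3 ee e by auto
      next
        case 4
        then have "partner M p \<in> U - W - B" using MB Pp by auto
        then show ?thesis using 4 ee e by auto
      qed
    next
      fix e assume "e \<in> {e\<in>M. e \<subseteq> W - A} \<union> {e\<in>M. e \<subseteq> (U - W) - B} \<union> (\<lambda>p. {p, restrict (partner M) A p}) ` A"
      then show "e \<in> M" using P(2) A W by auto
    qed
  qed
  have inj: "inj_on \<phi> X"
  proof (rule inj_onI)
    fix M N assume "M \<in> X" "N \<in> X" "\<phi> M = \<phi> N"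
    then have eq: "restrict (partner M) A = restrict (partner N) A"
      "{e\<in>M. e \<subseteq> W - A} = {e\<in>N. e \<subseteq> W - A}"
      "{e\<in>M. e \<subseteq> (U - W) - B} = {e\<in>N. e \<subseteq> (U - W) - B}"
      unfolding \<phi>_def by auto
    have "M = {e\<in>M. e \<subseteq> W - A} \<union> {e\<in>M. e \<subseteq> (U - W) - B} \<union> (\<lambda>p. {p, restrict (partner M) A p}) ` A"
      by (rule decomp[OF \<open>M \<in> X\<close>])
    also have "\<dots> = {e\<in>N. e \<subseteq> W - A} \<union> {e\<in>N. e \<subseteq> (U - W) - B} \<union> (\<lambda>p. {p, restrict (partner N) A p}) ` A"
      unfolding eq ..
    also have "\<dots> = N" by (rule decomp[OF \<open>N \<in> X\<close>, symmetric])
    finally show "M = N" .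
  qed
  have "finite (F \<times> perfect_matchings (W - A) \<times> perfect_matchings ((U - W) - B))"
  proof -
    have "finite F" unfolding F_def
      by (rule finite_subset[of _ "A \<rightarrow>\<^sub>E B"]) (use fin in \<open>auto intro: finite_PiE\<close>)
    then show ?thesis using fin U by (intro finite_cartesian_product finite_perfect_matchings) auto
  qed
  then have "card X \<le> card (F \<times> perfect_matchings (W - A) \<times> perfect_matchings ((U - W) - B))"
    using card_inj_on_le[OF inj] into by (metis image_subsetI)
  also have "\<dots> = fact (card A) * pm_count (card W - card A) * pm_count (card (U - W) - card B)"
    using fin U A B c unfolding F_def
    by (simp add: card_cartesian_product card_inj_funcset_same card_perfect_matchings card_Diff_subset)
  finally show ?thesis unfolding X_def .
qed

section \<open>Sets of minimum expansion\<close>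

text \<open>Points are counted instead of edges: a crossing edge has exactly one of its two points
  over S, and parallel edges use different points, so multiplicities are respected.\<close>

definition cut_size :: "nat \<Rightarrow> (nat \<times> nat) set set \<Rightarrow> nat set \<Rightarrow> nat" where
  "cut_size \<Delta> M S = card {p \<in> S \<times> {1..\<Delta>}. partner M p \<notin> S \<times> {1..\<Delta>}}"

definition cross_deg :: "nat \<Rightarrow> (nat \<times> nat) set set \<Rightarrow> nat set \<Rightarrow> nat \<Rightarrow> nat" where
  "cross_deg \<Delta> M S v = card {k \<in> {1..\<Delta>}. (fst (partner M (v,k)) \<in> S) \<noteq> (v \<in> S)}"

text \<open>If lowering c by 2 and s by 1 does not lower the ratio c/s, then that ratio is at least
  2. The division-free form also covers s = 1.\<close>

lemma shifted_ratio_nat: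
  fixes c s :: nat
  assumes "c * (s - 1) \<le> (c - 2) * s" "2 \<le> c" "1 \<le> s"
  shows "2 * s \<le> c"
proof -
  obtain a where "c = a + 2" using assms(2) by (metis le_add_diff_inverse2)
  moreover obtain b where "s = b + 1" using assms(3) by (metis le_add_diff_inverse2)
  ultimately show ?thesis using assms(1) by (simp add: algebra_simps)
qed

context
  fixes n \<Delta> :: nat and M :: "(nat \<times> nat) set set"
  assumes M: "M \<in> perfect_matchings ({1..n} \<times> {1..\<Delta>})"
begin

lemma partner_pts:
  assumes "v \<in> {1..n}" "k \<in> {1..\<Delta>}"
  shows "fst (partner M (v,k)) \<in> {1..n}" "snd (partner M (v,k)) \<in> {1..\<Delta>}"
    "partner M (partner M (v,k)) = (v,k)"
  using partner[OF M, of "(v,k)"] assms by (auto simp: mem_Times_iff)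

lemma partner_pts_iff:
  assumes "v \<in> {1..n}" "k \<in> {1..\<Delta>}"
  shows "partner M (v,k) \<in> S \<times> {1..\<Delta>} \<longleftrightarrow> fst (partner M (v,k)) \<in> S"
  using partner_pts[OF assms] by (auto simp: mem_Times_iff)

lemma finite_matching: "finite M"
  by (rule finite_subset[of _ "Pow ({1..n} \<times> {1..\<Delta>})"]) (use perfect_matchingsD(1)[OF M] in auto)

lemma size_cut_edges_merge:
  assumes S: "S \<subseteq> {1..n}"
  shows "size (cut_edges (merge_matching n M) S) = cut_size \<Delta> M S"
proof -
  define C where "C = {e \<in> M. \<exists>u\<in>S. \<exists>v\<in>{1..n} - S. fst ` e = {u,v}}"
  define D where "D = {p \<in> S \<times> {1..\<Delta>}. partner M p \<notin> S \<times> {1..\<Delta>}}"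
  have DU: "p \<in> {1..n} \<times> {1..\<Delta>}" if "p \<in> D" for p using that S unfolding D_def by auto
  have "size (cut_edges (merge_matching n M) S) = card C"
    unfolding cut_edges_def merge_matching_def verts_def edges_def C_def
    using finite_matching by (simp add: filter_mset_image_mset)
  also have "bij_betw (\<lambda>p. {p, partner M p}) D C"
  proof (rule bij_betw_imageI)
    show "inj_on (\<lambda>p. {p, partner M p}) D"
      by (rule inj_onI) (auto simp: doubleton_eq_iff D_def)
    show "(\<lambda>p. {p, partner M p}) ` D = C"
    proof (intro equalityI subsetI)
      fix e assume "e \<in> (\<lambda>p. {p, partner M p}) ` D"
      then obtain p where p: "p \<in> D" "e = {p, partner M p}" by blast
      have "e \<in> M" using partner(2)[OF M DU[OF p(1)]] p by simp
      moreover have "fst p \<in> S" using p unfolding D_def by auto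
      moreover have "fst (partner M p) \<in> {1..n} - S"
        using partner(3)[OF M DU[OF p(1)]] p(1) unfolding D_def by (auto simp: mem_Times_iff)
      moreover have "fst ` e = {fst p, fst (partner M p)}" using p(2) by simp
      ultimately show "e \<in> C" unfolding C_def by blast
    next
      fix e assume "e \<in> C"
      then obtain u v where e: "e \<in> M" "u \<in> S" "v \<in> {1..n} - S" "fst ` e = {u,v}"
        unfolding C_def by blast
      obtain p where p: "p \<in> e" "fst p = u" using e(4) by (metis imageE insertI1)
      obtain q where q: "q \<in> e" "fst q = v" using e(4) by (metis imageE insertCI)
      have ep: "e = {p, partner M p}" by (rule edge_eq_partner[OF M e(1) p(1)])
      have pU: "p \<in> {1..n} \<times> {1..\<Delta>}" using perfect_matchingsD(1)[OF M] e(1) p(1) by blast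
      have "q = partner M p" using ep q p e(2,3) by auto
      then have "p \<in> D" unfolding D_def using p q e pU by (auto simp: mem_Times_iff)
      then show "e \<in> (\<lambda>p. {p, partner M p}) ` D" using ep by blast
    qed
  qed
  then have "card C = card D" by (simp add: bij_betw_same_card)
  finally show ?thesis unfolding cut_size_def D_def .
qed

lemma set_expansion_merge:
  assumes S: "S \<subseteq> {1..n}"
  shows "set_expansion (merge_matching n M) S = real (cut_size \<Delta> M S) / real (min (card S) (n - card S))"
  unfolding set_expansion_def size_cut_edges_merge[OF S]
  using S by (simp add: verts_def merge_matching_def card_Diff_subset finite_subset)

lemma cut_size_compl:
  assumes S: "S \<subseteq> {1..n}"
  shows "cut_size \<Delta> M ({1..n} - S) = cut_size \<Delta> M S"
proof -
  define U where "U = {1..n} \<times> {1..\<Delta>}"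
  have side: "q \<notin> T \<times> {1..\<Delta>} \<longleftrightarrow> q \<in> ({1..n} - T) \<times> {1..\<Delta>}" if "q \<in> U" for q T
    using that unfolding U_def by (cases q) simp
  have cut: "{p \<in> T \<times> {1..\<Delta>}. partner M p \<notin> T \<times> {1..\<Delta>}}
      = {p \<in> T \<times> {1..\<Delta>}. partner M p \<in> ({1..n} - T) \<times> {1..\<Delta>}}" if "T \<subseteq> {1..n}" for T
  proof (rule Collect_cong, rule conj_cong[OF refl])
    fix p assume "p \<in> T \<times> {1..\<Delta>}"
    then have "p \<in> {1..n} \<times> {1..\<Delta>}" using that by auto
    then show "partner M p \<notin> T \<times> {1..\<Delta>} \<longleftrightarrow> partner M p \<in> ({1..n} - T) \<times> {1..\<Delta>}"
      by (intro side) (simp only: U_def partner(3)[OF M])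
  qed
  have "cut_size \<Delta> M S = card {p \<in> S \<times> {1..\<Delta>}. partner M p \<in> ({1..n} - S) \<times> {1..\<Delta>}}"
    unfolding cut_size_def cut[OF S] by (rule refl)
  also have "\<dots> = card {p \<in> ({1..n} - S) \<times> {1..\<Delta>}. partner M p \<in> S \<times> {1..\<Delta>}}"
    by (rule card_crossing_swap[OF M]) (use S in auto)
  also have "\<dots> = cut_size \<Delta> M ({1..n} - S)"
    unfolding cut_size_def using cut[of "{1..n} - S"] S by (simp add: double_diff)
  finally show ?thesis ..
qed

lemma cross_deg_compl:
  assumes "S \<subseteq> {1..n}" "v \<in> {1..n}"
  shows "cross_deg \<Delta> M ({1..n} - S) v = cross_deg \<Delta> M S v"
  unfolding cross_deg_def
proof (intro arg_cong[of _ _ card] Collect_cong conj_cong refl)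
  fix k assume "k \<in> {1..\<Delta>}"
  then show "((fst (partner M (v,k)) \<in> {1..n} - S) \<noteq> (v \<in> {1..n} - S)) = ((fst (partner M (v,k)) \<in> S) \<noteq> (v \<in> S))"
    using partner_pts(1)[OF assms(2)] assms(2) by blast
qed

lemma cross_deg_alt:
  assumes "S \<subseteq> {1..n}" "v \<in> {1..n} - S"
  shows "card {p \<in> {v} \<times> {1..\<Delta>}. partner M p \<in> S \<times> {1..\<Delta>}} = cross_deg \<Delta> M S v"
proof -
  have "{p \<in> {v} \<times> {1..\<Delta>}. partner M p \<in> S \<times> {1..\<Delta>}} = Pair v ` {k \<in> {1..\<Delta>}. fst (partner M (v,k)) \<in> S}"
    using assms partner_pts_iff by auto
  moreover have "inj_on (Pair v) {k \<in> {1..\<Delta>}. fst (partner M (v,k)) \<in> S}" by (auto simp: inj_on_def)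
  ultimately show ?thesis unfolding cross_deg_def using assms(2) by (simp add: card_image)
qed

lemma cut_size_insert:
  assumes S: "S \<subseteq> {1..n}" and v: "v \<in> {1..n} - S"
  shows "cut_size \<Delta> M (insert v S) + 2 * cross_deg \<Delta> M S v \<le> cut_size \<Delta> M S + \<Delta>"
proof -
  have "insert v S \<times> {1..\<Delta>} = S \<times> {1..\<Delta>} \<union> {v} \<times> {1..\<Delta>}" by auto
  moreover have "S \<times> {1..\<Delta>} \<subseteq> {1..n} \<times> {1..\<Delta>}" "{v} \<times> {1..\<Delta>} \<subseteq> {1..n} \<times> {1..\<Delta>}"
    "S \<times> {1..\<Delta>} \<inter> {v} \<times> {1..\<Delta>} = {}"
    using S v by auto
  moreover have "card ({v} \<times> {1..\<Delta>}) = \<Delta>" by (simp add: card_cartesian_product)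
  moreover have "finite ({1..n} \<times> {1..\<Delta>})" by simp
  ultimately show ?thesis
    using card_crossing_union_le[OF M, of "S \<times> {1..\<Delta>}" "{v} \<times> {1..\<Delta>}"] cross_deg_alt[OF S v]
    unfolding cut_size_def by metis
qed

text \<open>Removing v from S is adding v to the complement, and complementation changes neither
  cuts nor crossing degrees.\<close>

lemma cut_size_remove:
  assumes S: "S \<subseteq> {1..n}" and v: "v \<in> S"
  shows "cut_size \<Delta> M (S - {v}) + 2 * cross_deg \<Delta> M S v \<le> cut_size \<Delta> M S + \<Delta>"
proof -
  have "insert v ({1..n} - S) = {1..n} - (S - {v})" using S v by auto
  moreover have "v \<in> {1..n}" "S - {v} \<subseteq> {1..n}" "v \<in> {1..n} - ({1..n} - S)" "{1..n} - S \<subseteq> {1..n}"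
    using S v by auto
  ultimately show ?thesis
    using cut_size_insert[of "{1..n} - S" v] cut_size_compl[OF S] cut_size_compl[of "S - {v}"]
      cross_deg_compl[OF S, of v] by simp
qed

lemma cross_deg_le_cut_size:
  assumes S: "S \<subseteq> {1..n}" and v: "v \<in> {1..n} - S"
  shows "cross_deg \<Delta> M S v \<le> cut_size \<Delta> M S"
proof -
  have "cross_deg \<Delta> M S v = card {p \<in> S \<times> {1..\<Delta>}. partner M p \<in> {v} \<times> {1..\<Delta>}}"
    unfolding cross_deg_alt[OF S v, symmetric]
    by (rule card_crossing_swap[OF M]) (use S v in auto)
  also have "\<dots> \<le> cut_size \<Delta> M S"
    unfolding cut_size_def using v S by (intro card_mono) (auto intro: finite_subset)
  finally show ?thesis .
qed

text \<open>Among the sets of minimum expansion take one whose label sum is minimal. If \<open>|S| < n/2\<close>, no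
  outside vertex can have half of its edges crossing, since adding it to \<open>S\<close> would lower the expansion.
  If \<open>|S| = n/2\<close>, exchanging nonadjacent vertices \<open>u \<in> S\<close> and \<open>v \<notin> S\<close> with half of their edges
  crossing does not increase the cut, so \<open>u < v\<close>; the map \<open>g\<close> lists the neighbours of the largest such \<open>u\<close>.\<close>

lemma low_expansion_imp_tie_broken_cut:
  assumes n: "even n" "n \<ge> 4" and \<Delta>: "even \<Delta>" "\<Delta> > 0" and nu: "\<nu> < 2"
    and low: "\<not> expansion (merge_matching n M) > \<nu>"
  shows "\<exists>S \<theta> g. S \<subseteq> {1..n} \<and> S \<noteq> {} \<and> 2 * card S \<le> n \<and> real (cut_size \<Delta> M S) \<le> \<nu> * card S \<and>
    \<theta> \<le> n \<and> g \<in> {1..\<Delta>} \<rightarrow>\<^sub>E {1..n} \<and>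
    (\<forall>v\<in>{1..n}. 2 * cross_deg \<Delta> M S v \<le> \<Delta> \<and>
      (2 * cross_deg \<Delta> M S v = \<Delta> \<longrightarrow> (if v \<in> S then v \<le> \<theta> else \<theta> < v \<or> v \<in> g ` {1..\<Delta>})))"
proof -
  define r where "r S = real (cut_size \<Delta> M S) / real (min (card S) (n - card S))" for S
  define F where "F = {S. S \<noteq> {} \<and> S \<subset> {1..n}}"
  have finF: "finite F" unfolding F_def by (rule finite_subset[of _ "Pow {1..n}"]) auto
  have "{1} \<noteq> {1..n}"
  proof
    assume "{1} = {1..n}"
    then have "card {1..n} = card {1::nat}" by (rule arg_cong[OF sym])
    then show False using n by simp
  qed
  then have "{1} \<in> F" using n unfolding F_def by (simp add: psubset_eq)
  then have neF: "F \<noteq> {}" by blast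
  have exp: "expansion (merge_matching n M) = Min (r ` F)"
  proof -
    have "{set_expansion (merge_matching n M) S |S. S \<noteq> {} \<and> S \<subset> verts (merge_matching n M)}
        = (\<lambda>S. set_expansion (merge_matching n M) S) ` F"
      unfolding F_def by (auto simp: verts_def merge_matching_def)
    also have "\<dots> = r ` F"
      by (rule image_cong) (auto simp: F_def r_def set_expansion_merge)
    finally show ?thesis unfolding expansion_def by simp
  qed
  define \<rho> where "\<rho> = Min (r ` F)"
  have \<rho>: "\<rho> \<le> \<nu>" "\<rho> \<in> r ` F" "\<And>T. T \<in> F \<Longrightarrow> \<rho> \<le> r T"
    using low finF neF unfolding \<rho>_def exp not_less by (simp, intro Min_in, simp_all)
  define G where "G = {S\<in>F. r S = \<rho> \<and> 2 * card S \<le> n}"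
  have finG: "finite G" using finF unfolding G_def by auto
  have cardF: "card S \<ge> 1" "card S < n" "finite S" "S \<subseteq> {1..n}" if "S \<in> F" for S
  proof -
    show 1: "S \<subseteq> {1..n}" using that F_def by auto
    show 2: "finite S" by (rule finite_subset[OF 1]) simp
    show "card S \<ge> 1" using that 2 F_def by (simp add: Suc_le_eq card_gt_0_iff)
    show "card S < n" using psubset_card_mono[of "{1..n}" S] that F_def by simp
  qed
  obtain S0 where S0: "S0 \<in> F" "r S0 = \<rho>" using \<rho>(2) by auto
  have "G \<noteq> {}"
  proof (cases "2 * card S0 \<le> n")
    case True
    then show ?thesis using S0 unfolding G_def by auto
  next
    case False
    note c0 = cardF[OF S0(1)]
    have cc: "card ({1..n} - S0) = n - card S0" using c0 by (simp add: card_Diff_subset)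
    have "{1..n} - S0 \<in> F" using S0(1) unfolding F_def by auto
    moreover have "r ({1..n} - S0) = r S0"
      unfolding r_def cut_size_compl[OF c0(4)] cc using c0 by (simp add: min.commute)
    ultimately have "{1..n} - S0 \<in> G" unfolding G_def using S0 cc False by auto
    then show ?thesis by blast
  qed
  then obtain S where S: "S \<in> G" "\<And>T. T \<in> G \<Longrightarrow> \<Sum>S \<le> \<Sum>T"
    using arg_min_if_finite[OF finG, of "\<lambda>T. \<Sum>T"] by (meson not_le)
  define s where "s = card S"
  define c where "c = cut_size \<Delta> M S"
  have SF: "S \<in> F" and rS: "r S = \<rho>" and s2: "2 * s \<le> n" using S unfolding G_def s_def by auto
  note cS = cardF[OF SF]
  have s1: "s \<ge> 1" using cS s_def by simp
  have rS': "\<rho> = real c / real s" using rS s2 unfolding r_def s_def c_def by (simp add: min_absorb1)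
  have cnu: "real c \<le> \<nu> * real s" using \<rho>(1) s1 unfolding rS' by (simp add: field_simps)
  have "\<nu> * real s < 2 * real s" using nu s1 by simp
  then have "real c < 2 * real s" using cnu by linarith
  then have c2: "c < 2 * s" by linarith
  have opt: "c * min (card T) (n - card T) \<le> cut_size \<Delta> M T * s" if "T \<in> F" for T
  proof -
    define m where "m = min (card T) (n - card T)"
    have m: "m > 0" using cardF[OF that] unfolding m_def by auto
    have "real c / real s \<le> real (cut_size \<Delta> M T) / real m"
      using \<rho>(3)[OF that] unfolding rS' r_def m_def .
    then have "real c * real m \<le> real (cut_size \<Delta> M T) * real s"
      using m s1 by (simp add: field_simps)
    then show ?thesis unfolding m_def[symmetric] by (metis of_nat_le_iff of_nat_mult)
  qed
  \<comment> \<open>By parity a violation is an excess of at least 2, so removing v lowers the cut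
    by 2. Because \<open>c < 2 * s\<close>, which comes from \<open>\<nu> < 2\<close>, the smaller
    set would have a smaller ratio.\<close>
  have in_le: "2 * cross_deg \<Delta> M S v \<le> \<Delta>" if v: "v \<in> S" for v
  proof (rule ccontr)
    assume "\<not> ?thesis"
    then have d: "2 * cross_deg \<Delta> M S v \<ge> \<Delta> + 2" using \<Delta>(1) by presburger
    have le: "cut_size \<Delta> M (S - {v}) + 2 \<le> c"
      using cut_size_remove[OF cS(4) v] d unfolding c_def by linarith
    have "s \<noteq> 1" using le c2 by auto
    have cd: "card (S - {v}) = s - 1" using v cS s_def by simp
    then have "S - {v} \<noteq> {}" using \<open>s \<noteq> 1\<close> s1 by (metis card.empty diff_is_0_eq le_antisym)
    then have "S - {v} \<in> F" using cS SF unfolding F_def by auto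
    from opt[OF this] have "c * (s - 1) \<le> cut_size \<Delta> M (S - {v}) * s"
      unfolding cd using s2 s1 by (simp add: min_def split: if_splits)
    also have "\<dots> \<le> (c - 2) * s" using le by (intro mult_right_mono) auto
    finally have "c * (s - 1) \<le> (c - 2) * s" .
    then have "2 * s \<le> c" by (rule shifted_ratio_nat) (use le s1 in auto)
    then show False using c2 by simp
  qed
  have ins_F: "insert v S \<in> F" "card (insert v S) = s + 1" if v: "v \<in> {1..n} - S" for v
  proof -
    show 1: "card (insert v S) = s + 1" using v cS s_def by simp
    have "insert v S \<noteq> {1..n}" using 1 s2 n by auto
    then show "insert v S \<in> F" unfolding F_def using v cS by auto
  qed
  have out_le: "2 * cross_deg \<Delta> M S v \<le> \<Delta>" if v: "v \<in> {1..n} - S" for v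
  proof (rule ccontr)
    assume "\<not> ?thesis"
    then have d: "2 * cross_deg \<Delta> M S v \<ge> \<Delta> + 2" using \<Delta>(1) by presburger
    have le: "cut_size \<Delta> M (insert v S) + 2 \<le> c"
      using cut_size_insert[OF cS(4) v] d unfolding c_def by linarith
    \<comment> \<open>The smaller side can shrink on insertion, but only to s - 1, namely when 2 s =
      n. The arithmetic of the removal case therefore applies again.\<close>
    have "c * (s - 1) \<le> c * min (s + 1) (n - (s + 1))"
      using s2 by (intro mult_left_mono) auto
    also have "\<dots> \<le> cut_size \<Delta> M (insert v S) * s"
      using opt[OF ins_F(1)[OF v]] unfolding ins_F(2)[OF v] .
    also have "\<dots> \<le> (c - 2) * s" using le by (intro mult_right_mono) auto
    finally have "c * (s - 1) \<le> (c - 2) * s" .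
    then have "2 * s \<le> c" by (rule shifted_ratio_nat) (use le s1 in auto)
    then show False using c2 by simp
  qed
  have all_le: "2 * cross_deg \<Delta> M S v \<le> \<Delta>" if "v \<in> {1..n}" for v
    using in_le out_le that by blast
  have "\<exists>\<theta> g. \<theta> \<le> n \<and> g \<in> {1..\<Delta>} \<rightarrow>\<^sub>E {1..n} \<and> (\<forall>v\<in>{1..n}. 2 * cross_deg \<Delta> M S v = \<Delta> \<longrightarrow>
      (if v \<in> S then v \<le> \<theta> else \<theta> < v \<or> v \<in> g ` {1..\<Delta>}))"
  proof (cases "2 * s = n \<and> (\<exists>u\<in>S. 2 * cross_deg \<Delta> M S u = \<Delta>)")
    case False
    \<comment> \<open>A dummy list of exceptions. In these cases one side has no vertex with exactly
      half of its edges crossing: the inside for \<theta> = 0, the outside for \<theta> = n.\<close>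
    have g: "restrict (\<lambda>_. 1) {1..\<Delta>} \<in> {1..\<Delta>} \<rightarrow>\<^sub>E {1..n}" using n by auto
    show ?thesis
    proof (cases "2 * s = n")
      case True
      then show ?thesis using False g
        by (intro exI[of _ 0] exI[of _ "restrict (\<lambda>_. 1) {1..\<Delta>}"]) auto
    next
      case nF: False
      have "2 * cross_deg \<Delta> M S v \<noteq> \<Delta>" if v: "v \<in> {1..n} - S" for v
      proof
        assume d: "2 * cross_deg \<Delta> M S v = \<Delta>"
        have "2 * s + 2 \<le> n" using nF s2 n(1) by presburger
        then have "min (s + 1) (n - (s + 1)) = s + 1" by auto
        then have "c * (s + 1) \<le> cut_size \<Delta> M (insert v S) * s"
          using opt[OF ins_F(1)[OF v]] unfolding ins_F(2)[OF v] by simp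
        also have "\<dots> \<le> c * s"
          using cut_size_insert[OF cS(4) v] d unfolding c_def by (intro mult_right_mono) auto
        finally have "c = 0" by simp
        then show False using cross_deg_le_cut_size[OF cS(4) v] d \<Delta>(2) unfolding c_def by simp
      qed
      then show ?thesis using g
        by (intro exI[of _ n] exI[of _ "restrict (\<lambda>_. 1) {1..\<Delta>}"]) auto
    qed
  next
    case True
    define D where "D = {u\<in>S. 2 * cross_deg \<Delta> M S u = \<Delta>}"
    have D: "finite D" "D \<noteq> {}" using True cS unfolding D_def by auto
    define u where "u = Max D"
    have uD: "u \<in> D" "\<And>w. w \<in> D \<Longrightarrow> w \<le> u" using D unfolding u_def by auto
    then have u: "u \<in> S" "2 * cross_deg \<Delta> M S u = \<Delta>" "u \<in> {1..n}" unfolding D_def using cS by auto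
    define g where "g = restrict (\<lambda>k. fst (partner M (u,k))) {1..\<Delta>}"
    have g: "g \<in> {1..\<Delta>} \<rightarrow>\<^sub>E {1..n}" unfolding g_def using partner_pts(1)[OF u(3)] by auto
    have "u < v \<or> v \<in> g ` {1..\<Delta>}"
      if v: "v \<in> {1..n} - S" and d: "2 * cross_deg \<Delta> M S v = \<Delta>" for v
    proof (rule ccontr)
      assume "\<not> ?thesis"
      then have vu: "v < u" and vg: "v \<notin> g ` {1..\<Delta>}" using u v by (auto simp: not_less le_less)
      define T where "T = insert v (S - {u})"
      \<comment> \<open>As v is not listed by g, it is not adjacent to u. Removing u then leaves the
        crossing degree of v unchanged, so the estimates for the two moves can be chained.\<close>
      have "fst (partner M (v,k)) \<noteq> u" if k: "k \<in> {1..\<Delta>}" for k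
      proof
        assume a: "fst (partner M (v,k)) = u"
        define j where "j = snd (partner M (v,k))"
        have vn: "v \<in> {1..n}" using v by auto
        have pj: "partner M (v,k) = (u,j)" using a j_def by (metis prod.collapse)
        have j: "j \<in> {1..\<Delta>}" using partner_pts(2)[OF vn k] j_def by simp
        have "partner M (u,j) = (v,k)" using partner_pts(3)[OF vn k] pj by simp
        then have "g j = v" unfolding g_def using j by simp
        then show False using vg j by blast
      qed
      then have "cross_deg \<Delta> M (S - {u}) v = cross_deg \<Delta> M S v"
        unfolding cross_deg_def using v by (intro arg_cong[of _ _ card]) auto
      then have "cut_size \<Delta> M T \<le> cut_size \<Delta> M (S - {u})"
        using cut_size_insert[of "S - {u}" v] d v cS unfolding T_def by auto
      also have "\<dots> \<le> c" using cut_size_remove[OF cS(4) u(1)] u(2) unfolding c_def by simp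
      finally have cT: "cut_size \<Delta> M T \<le> c" .
      have cardT: "card T = s" unfolding T_def using u v cS s1 s_def by simp
      have "T \<noteq> {1..n}" using cardT s2 n by auto
      then have TF: "T \<in> F" unfolding F_def T_def using cS v by auto
      have "r T \<le> \<rho>"
        unfolding r_def rS' cardT using cT s2 by (simp add: min_def divide_right_mono)
      then have "r T = \<rho>" using \<rho>(3)[OF TF] by simp
      then have "T \<in> G" unfolding G_def using TF cardT s2 by simp
      then have "\<Sum>S \<le> \<Sum>T" by (rule S(2))
      moreover have "\<Sum>S = u + \<Sum>(S - {u})" using u cS by (simp add: sum.remove)
      moreover have "\<Sum>T = v + \<Sum>(S - {u})" unfolding T_def using v cS by (subst sum.insert) auto
      ultimately show False using vu by simp
    qed
    then show ?thesis using g uD(2) u unfolding D_def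
      by (intro exI[of _ u] exI[of _ g]) auto
  qed
  then obtain \<theta> g where tg: "\<theta> \<le> n" "g \<in> {1..\<Delta>} \<rightarrow>\<^sub>E {1..n}"
    "\<forall>v\<in>{1..n}. 2 * cross_deg \<Delta> M S v = \<Delta> \<longrightarrow> (if v \<in> S then v \<le> \<theta> else \<theta> < v \<or> v \<in> g ` {1..\<Delta>})"
    by (elim exE conjE)
  have "S \<noteq> {}" using SF unfolding F_def by simp
  moreover have "\<forall>v\<in>{1..n}. 2 * cross_deg \<Delta> M S v \<le> \<Delta> \<and>
      (2 * cross_deg \<Delta> M S v = \<Delta> \<longrightarrow> (if v \<in> S then v \<le> \<theta> else \<theta> < v \<or> v \<in> g ` {1..\<Delta>}))"
    using all_le tg(3) by simp
  ultimately show ?thesis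
    using cS(4) s2 cnu tg(1,2) unfolding s_def c_def
    by (intro exI[of _ S] exI[of _ \<theta>] exI[of _ g] conjI) assumption+
qed

end

section \<open>Stirling-type estimates without polynomial loss\<close>

definition xlnx :: "real \<Rightarrow> real" where "xlnx t = t * ln t"

lemma xlnx_0 [simp]: "xlnx 0 = 0" and xlnx_1 [simp]: "xlnx 1 = 0"
  by (simp_all add: xlnx_def)

lemma xlnx_mult: "a > 0 \<Longrightarrow> b \<ge> 0 \<Longrightarrow> xlnx (a * b) = a * xlnx b + b * xlnx a"
  by (cases "b = 0") (auto simp: xlnx_def ln_mult algebra_simps)

lemma xlnx_tangent:
  assumes "z > 0" "u \<ge> 0"
  shows "xlnx z + (ln z + 1) * (u - z) \<le> xlnx u"
proof (cases "u = 0")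
  case True
  then show ?thesis using assms by (simp add: xlnx_def algebra_simps)
next
  case False
  then have u: "u > 0" using assms by simp
  have "ln (z / u) \<le> z / u - 1" using ln_le_minus_one[of "z / u"] assms u by simp
  then have "u * (ln z - ln u) \<le> u * (z / u - 1)"
    using u assms by (intro mult_left_mono) (auto simp: ln_div)
  then show ?thesis using u by (simp add: xlnx_def algebra_simps)
qed

lemma convex_on_xlnx: "convex_on {0..} xlnx"
proof (rule convex_onI)
  fix t x y :: real assume t: "0 < t" "t < 1" and x: "x \<in> {0..}" and y: "y \<in> {0..}"
  define z where "z = (1 - t) * x + t * y"
  show "xlnx ((1 - t) *\<^sub>R x + t *\<^sub>R y) \<le> (1 - t) * xlnx x + t * xlnx y"
  proof (cases "z = 0")
    case True
    then have "x = 0" "y = 0" using t x y unfolding z_def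
      by (auto simp: add_nonneg_eq_0_iff)
    then show ?thesis by simp
  next
    case False
    then have z: "z > 0" using t x y unfolding z_def by (simp add: order_less_le)
    have "(1 - t) * (xlnx z + (ln z + 1) * (x - z)) + t * (xlnx z + (ln z + 1) * (y - z))
        \<le> (1 - t) * xlnx x + t * xlnx y"
      using t x y xlnx_tangent[OF z] by (intro add_mono mult_left_mono) auto
    moreover have "(1 - t) * (xlnx z + (ln z + 1) * (x - z)) + t * (xlnx z + (ln z + 1) * (y - z)) = xlnx z"
      unfolding z_def by (simp add: algebra_simps)
    ultimately show ?thesis by (simp add: z_def)
  qed
qed (rule convex_real_interval)

text \<open>For a fixed sum W, convexity makes the total smaller when the two parts are closer.
  Indeed k and W - k are convex combinations of u and W - u with the weights exchanged.\<close>

lemma xlnx_sum_antimono: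
  assumes "0 \<le> u" "u \<le> k" "2 * k \<le> W"
  shows "xlnx k + xlnx (W - k) \<le> xlnx u + xlnx (W - u)"
proof (cases "u = W - u")
  case True
  then have "k = u" using assms by linarith
  then show ?thesis by simp
next
  case False
  define t where "t = (k - u) / (W - 2 * u)"
  have W: "W - 2 * u > 0" using False assms by linarith
  have t: "0 \<le> t" "t \<le> 1" using assms W unfolding t_def by (auto simp: field_simps)
  have tk: "t * (W - 2 * u) = k - u" using W unfolding t_def by simp
  have k: "k = (1 - t) * u + t * (W - u)" using tk by (simp add: algebra_simps)
  have Wk: "W - k = (1 - t) * (W - u) + t * u" using tk by (simp add: algebra_simps)
  have "xlnx k \<le> (1 - t) * xlnx u + t * xlnx (W - u)"
    unfolding k using convex_onD[OF convex_on_xlnx t, of u "W - u"] assms by simp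
  moreover have "xlnx (W - k) \<le> (1 - t) * xlnx (W - u) + t * xlnx u"
    unfolding Wk using convex_onD[OF convex_on_xlnx t, of "W - u" u] assms by simp
  ultimately show ?thesis by (simp add: algebra_simps)
qed

text \<open>The first term of ln r = 2 artanh((r - 1)/(r + 1)) at r = (k + d)/k. The case d = 1
  serves factorials, d = 2 serves matching numbers.\<close>

lemma xlnx_diff_ge:
  fixes k d :: real assumes k: "k > 0" and d: "d > 0"
  shows "d * ln (k + d) + 2 * d * k / (2 * k + d) \<le> xlnx (k + d) - xlnx k"
proof -
  have "ln ((k + d) / k) \<ge> 2 * d / (2 * k + d)"
    using ln_approx_bounds[of "(k + d) / k" 1] k d by (simp add: field_simps)
  then have "k * (2 * d / (2 * k + d)) \<le> k * ln ((k + d) / k)" using k by (intro mult_left_mono) auto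
  also have "\<dots> = xlnx (k + d) - xlnx k - d * ln (k + d)"
    using k d by (simp add: ln_div xlnx_def algebra_simps)
  finally show ?thesis by (simp add: algebra_simps)
qed

text \<open>Midpoint form of the Hermite--Hadamard inequality for the concave function \<open>ln\<close>.\<close>

lemma xlnx_diff_le:
  fixes k :: real assumes k: "k \<ge> 0"
  shows "(xlnx (k + 2) - xlnx k) / 2 - 1 \<le> ln (k + 1)"
proof (cases "k = 0")
  case True
  have "ln (2::real) \<le> 1" using ln_le_minus_one[of 2] by simp
  then show ?thesis using True by (simp add: xlnx_def)
next
  case False
  then have k: "k > 0" using k by simp
  define w where "w = 1 / (k + 1)"
  have w: "0 < w" "w < 1" using k by (auto simp: w_def field_simps)
  \<comment> \<open>Rescaling the interval from k to k + 2 by its midpoint k + 1 turns it into the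
    interval from 1 - w to 1 + w, and the claim into \<open>g 0 \<le> g w\<close>. The derivative of
    g is - ln(1 - x^2), hence nonnegative.\<close>
  define g where "g x = 2 * x - (1 + x) * ln (1 + x) + (1 - x) * ln (1 - x)" for x :: real
  have "g 0 \<le> g w"
  proof (rule DERIV_nonneg_imp_nondecreasing[of 0 w g])
    fix x :: real assume x: "0 \<le> x" "x \<le> w"
    then have x1: "x < 1" using w by simp
    have "((\<lambda>x. (1 + x) * ln (1 + x)) has_real_derivative (ln (1 + x) + 1)) (at x)"
      using x x1 by (auto intro!: derivative_eq_intros)
    moreover have "((\<lambda>x. (1 - x) * ln (1 - x)) has_real_derivative (- ln (1 - x) - 1)) (at x)"
      using x x1 by (auto intro!: derivative_eq_intros)
    moreover have "((\<lambda>x. 2 * x) has_real_derivative 2) (at x)" by (auto intro!: derivative_eq_intros)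
    ultimately have "(g has_real_derivative (2 - (ln (1 + x) + 1) + (- ln (1 - x) - 1))) (at x)"
      unfolding g_def by (intro DERIV_add DERIV_diff)
    moreover have "ln (1 + x) + ln (1 - x) \<le> 0"
    proof -
      have "ln (1 + x) + ln (1 - x) = ln ((1 + x) * (1 - x))" using x x1 by (simp add: ln_mult)
      also have "\<dots> \<le> 0"
      proof -
        have "(1 + x) * (1 - x) = 1 - x * x" by (simp add: algebra_simps)
        moreover have "0 \<le> x * x" by simp
        moreover have "(1 + x) * (1 - x) > 0" using x x1 by simp
        ultimately show ?thesis by (metis diff_ge_0_iff_ge diff_diff_eq2 add_diff_cancel_left' ln_le_zero_iff)
      qed
      finally show ?thesis .
    qed
    ultimately show "\<exists>y. (g has_real_derivative y) (at x) \<and> 0 \<le> y"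
      by (intro exI[of _ "2 - (ln (1 + x) + 1) + (- ln (1 - x) - 1)"]) auto
  qed (use w in simp)
  then have gw: "(1 + w) * ln (1 + w) - (1 - w) * ln (1 - w) \<le> 2 * w" by (simp add: g_def)
  have a: "1 + w = (k + 2) / (k + 1)" "1 - w = k / (k + 1)" using k by (auto simp: w_def field_simps)
  have "(k + 2) / (k + 1) * (ln (k + 2) - ln (k + 1)) - k / (k + 1) * (ln k - ln (k + 1)) \<le> 2 / (k + 1)"
    using gw k unfolding a by (simp add: ln_div w_def)
  then have "(k + 1) * ((k + 2) / (k + 1) * (ln (k + 2) - ln (k + 1)) - k / (k + 1) * (ln k - ln (k + 1)))
      \<le> (k + 1) * (2 / (k + 1))" using k by (intro mult_left_mono) auto
  moreover have "(k + 1) * ((k + 2) / (k + 1) * (ln (k + 2) - ln (k + 1)) - k / (k + 1) * (ln k - ln (k + 1)))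
      = (k + 2) * (ln (k + 2) - ln (k + 1)) - k * (ln k - ln (k + 1))"
    using k by (simp add: right_diff_distrib)
  moreover have "(k + 1) * (2 / (k + 1)) = 2" using k by (simp add: divide_simps)
  ultimately have "(k + 2) * (ln (k + 2) - ln (k + 1)) - k * (ln k - ln (k + 1)) \<le> 2" by linarith
  then show ?thesis by (simp add: xlnx_def field_simps)
qed

text \<open>Stirling's upper bound with the square root relaxed to a linear factor. In the induction
  the growth (x + 2)/(x + 1) of that factor pays for the error 1 - 1/(2 x + 1) as soon as x is at
  least 1, hence the separate case c = 0.\<close>

lemma fact_le_exp_xlnx: "fact c \<le> exp 1 * (real c + 1) * exp (xlnx c - c)"
proof (induction c)
  case (Suc c)
  show ?case
  proof (cases "c = 0")
    case True
    then show ?thesis by (simp add: exp_minus field_simps)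
  next
    case False
    define x where "x = real c"
    have x: "x \<ge> 1" using False unfolding x_def by simp
    have "ln (x + 1) + 2 * x / (2 * x + 1) \<le> xlnx (x + 1) - xlnx x"
      using xlnx_diff_ge[of x 1] x by simp
    moreover have "1 - 1 / (2 * x + 1) = 2 * x / (2 * x + 1)" using x by (simp add: field_simps)
    ultimately have "ln (x + 1) - 1 / (2 * x + 1) \<le> xlnx (x + 1) - xlnx x - 1" by linarith
    then have "exp (ln (x + 1)) * exp (- (1 / (2 * x + 1))) \<le> exp (xlnx (x + 1) - xlnx x - 1)"
      by (simp add: exp_add[symmetric])
    moreover have "(x + 1) * (1 - 1 / (2 * x + 1)) \<le> exp (ln (x + 1)) * exp (- (1 / (2 * x + 1)))"
      using x exp_ge_add_one_self[of "- (1 / (2 * x + 1))"] by (intro mult_mono) auto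
    ultimately have 1: "(x + 1) * (1 - 1 / (2 * x + 1)) \<le> exp (xlnx (x + 1) - xlnx x - 1)" by linarith
    have "(x + 1) * (x + 1) \<le> (x + 2) * ((x + 1) * (1 - 1 / (2 * x + 1)))"
      using x mult_mono[of 1 x 1 x] by (simp add: field_simps)
    also have "\<dots> \<le> (x + 2) * exp (xlnx (x + 1) - xlnx x - 1)"
      using 1 x by (intro mult_left_mono) auto
    finally have 2: "(x + 1) * (x + 1) \<le> (x + 2) * exp (xlnx (x + 1) - xlnx x - 1)" .
    have "fact (Suc c) = (x + 1) * fact c" unfolding x_def by simp
    also have "\<dots> \<le> (x + 1) * (exp 1 * (x + 1) * exp (xlnx x - x))"
      using Suc.IH x unfolding x_def by (intro mult_left_mono) auto
    also have "\<dots> = ((x + 1) * (x + 1)) * (exp 1 * exp (xlnx x - x))" by simp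
    also have "\<dots> \<le> ((x + 2) * exp (xlnx (x + 1) - xlnx x - 1)) * (exp 1 * exp (xlnx x - x))"
      using 2 by (intro mult_right_mono) auto
    also have "\<dots> = exp 1 * (x + 2) * exp (xlnx (x + 1) - (x + 1))"
      by (simp add: exp_add[symmetric] mult.assoc mult.left_commute)
    finally show ?thesis unfolding x_def by (simp add: add.commute)
  qed
qed simp

text \<open>The same induction in steps of two; odd arguments are harmless because the count is then
  0.\<close>

lemma pm_count_le: "real (pm_count k) \<le> (real k + 1) * exp ((xlnx k - k) / 2)"
proof (induction k rule: pm_count.induct)
  case (3 k)
  show ?case
  proof (cases "k = 0")
    case True
    have "1 \<le> 3 * exp (ln 2 - 1 :: real)" using exp_ge_add_one_self[of "-1 + ln 2"] exp_le by (simp add: exp_diff)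
    moreover have "(2 * ln 2 - 2) / 2 = ln 2 - (1 :: real)" by simp
    ultimately show ?thesis using True by (simp add: xlnx_def diff_divide_distrib)
  next
    case False
    define x where "x = real k"
    have x: "x \<ge> 1" using False unfolding x_def by simp
    have "ln (x + 2) + x / (x + 1) \<le> (xlnx (x + 2) - xlnx x) / 2"
    proof -
      have "2 * ln (x + 2) + 2 * 2 * x / (2 * x + 2) \<le> xlnx (x + 2) - xlnx x"
        by (rule xlnx_diff_ge) (use x in auto)
      moreover have "2 * 2 * x / (2 * x + 2) = 2 * (x / (x + 1))" using x by (simp add: field_simps)
      moreover define q where "q = x / (x + 1)"
      ultimately have "2 * ln (x + 2) + 2 * q \<le> xlnx (x + 2) - xlnx x" by (simp only:)
      then show ?thesis unfolding q_def[symmetric] by simp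
    qed
    moreover have "1 - 1 / (x + 1) = x / (x + 1)" using x by (simp add: field_simps)
    ultimately have "ln (x + 2) - 1 / (x + 1) \<le> (xlnx (x + 2) - xlnx x) / 2 - 1" by linarith
    then have "exp (ln (x + 2)) * exp (- (1 / (x + 1))) \<le> exp ((xlnx (x + 2) - xlnx x) / 2 - 1)"
      by (simp add: exp_add[symmetric])
    moreover have "(x + 2) * (1 - 1 / (x + 1)) \<le> exp (ln (x + 2)) * exp (- (1 / (x + 1)))"
      using x exp_ge_add_one_self[of "- (1 / (x + 1))"] by (intro mult_mono) auto
    ultimately have 1: "(x + 2) * (1 - 1 / (x + 1)) \<le> exp ((xlnx (x + 2) - xlnx x) / 2 - 1)" by linarith
    have "(x + 1) * (x + 1) * (x + 1) \<le> (x + 3) * ((x + 2) * x)"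
    proof -
      have "x * x \<ge> 1" using x by (simp add: mult_ge1_I)
      then show ?thesis using x by (simp add: algebra_simps)
    qed
    then have "(x + 1) * (x + 1) \<le> (x + 3) * ((x + 2) * (1 - 1 / (x + 1)))"
      using x by (simp add: field_simps)
    also have "\<dots> \<le> (x + 3) * exp ((xlnx (x + 2) - xlnx x) / 2 - 1)"
      using 1 x by (intro mult_left_mono) auto
    finally have 2: "(x + 1) * (x + 1) \<le> (x + 3) * exp ((xlnx (x + 2) - xlnx x) / 2 - 1)" .
    have "real (pm_count (Suc (Suc k))) = (x + 1) * real (pm_count k)"
      unfolding x_def by (simp add: algebra_simps)
    also have "\<dots> \<le> (x + 1) * ((x + 1) * exp ((xlnx x - x) / 2))"
      using 3 x unfolding x_def by (intro mult_left_mono) auto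
    also have "\<dots> = ((x + 1) * (x + 1)) * exp ((xlnx x - x) / 2)" by simp
    also have "\<dots> \<le> ((x + 3) * exp ((xlnx (x + 2) - xlnx x) / 2 - 1)) * exp ((xlnx x - x) / 2)"
      using 2 by (intro mult_right_mono) auto
    also have "\<dots> = (x + 3) * exp ((xlnx (x + 2) - (x + 2)) / 2)"
      by (simp add: exp_add[symmetric] mult.assoc) (simp add: field_simps)
    finally show ?thesis unfolding x_def by (simp add: add.commute)
  qed
qed simp_all

lemma pm_count_pos: "pm_count (2 * m) > 0"
  by (induction m) auto

lemma pm_count_odd: "odd k \<Longrightarrow> pm_count k = 0"
  by (induction k rule: pm_count.induct) auto

text \<open>The ratio of \<open>pm_count (2 m)\<close> to its Stirling approximation is nondecreasing, so quotients
  can be estimated without polynomial losses.\<close>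

lemma pm_count_quotient_le:
  assumes "l \<le> N"
  shows "real (pm_count (2 * l)) * exp ((xlnx (2 * N) - 2 * N) / 2)
    \<le> real (pm_count (2 * N)) * exp ((xlnx (2 * l) - 2 * l) / 2)"
  using assms
proof (induction N rule: dec_induct)
  case (step N)
  define x where "x = 2 * real N"
  have x: "x \<ge> 0" unfolding x_def by simp
  have "exp ((xlnx (x + 2) - xlnx x) / 2 - 1) \<le> exp (ln (x + 1))"
    using xlnx_diff_le[OF x] by simp
  then have 1: "exp ((xlnx (x + 2) - xlnx x) / 2 - 1) \<le> x + 1" using x by simp
  have "exp ((xlnx (2 * Suc N) - 2 * Suc N) / 2)
      = exp ((xlnx x - x) / 2) * exp ((xlnx (x + 2) - xlnx x) / 2 - 1)"
    unfolding x_def by (simp add: exp_add[symmetric] field_simps)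
  then have "real (pm_count (2 * l)) * exp ((xlnx (2 * Suc N) - 2 * Suc N) / 2)
      = (real (pm_count (2 * l)) * exp ((xlnx x - x) / 2)) * exp ((xlnx (x + 2) - xlnx x) / 2 - 1)" by simp
  also have "\<dots> \<le> (real (pm_count (2 * N)) * exp ((xlnx (2 * l) - 2 * l) / 2)) * (x + 1)"
    by (rule mult_mono) (use step.IH 1 x in \<open>simp_all add: x_def\<close>)
  also have "\<dots> = real (pm_count (2 * Suc N)) * exp ((xlnx (2 * l) - 2 * l) / 2)"
    unfolding x_def by (simp add: algebra_simps)
  finally show ?case .
qed simp

lemma pm_count_ge: "exp ((xlnx (2 * N) - 2 * N) / 2) \<le> real (pm_count (2 * N))"
  using pm_count_quotient_le[of 0 N] by simp

text \<open>The polynomial loss of \<open>pm_count_le\<close> is accepted only for the factor with k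
  points; the factor with 2 N - k points is compared with \<open>pm_count (2 * N)\<close> by the
  lossless quotient estimate. With k at most \<Delta>|S|, the loss does not involve n.\<close>

lemma pm_count_product_le:
  assumes k: "k \<le> 2 * N"
  shows "real (pm_count k) * real (pm_count (2 * N - k))
    \<le> (real k + 1) * exp ((xlnx k + xlnx (2 * N - k) - xlnx (2 * N)) / 2) * real (pm_count (2 * N))"
proof (cases "even k")
  case False
  then show ?thesis by (simp add: pm_count_odd)
next
  case True
  then obtain j where j: "k = 2 * j" by blast
  define l where "l = N - j"
  have l: "2 * N - k = 2 * l" "l \<le> N" using j k unfolding l_def by auto
  have lr: "real (2 * l) = 2 * real N - real k" using l(1) k by linarith
  have "real (pm_count (2 * l)) \<le> real (pm_count (2 * N)) * exp ((xlnx (2 * l) - 2 * l) / 2) / exp ((xlnx (2 * N) - 2 * N) / 2)"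
    using pm_count_quotient_le[OF l(2)] by (simp add: field_simps)
  also have "\<dots> = real (pm_count (2 * N)) * exp ((xlnx (2 * l) - 2 * l) / 2 - (xlnx (2 * N) - 2 * N) / 2)"
    by (simp add: exp_diff)
  finally have "real (pm_count k) * real (pm_count (2 * l))
      \<le> ((real k + 1) * exp ((xlnx k - k) / 2)) * (real (pm_count (2 * N)) * exp ((xlnx (2 * l) - 2 * l) / 2 - (xlnx (2 * N) - 2 * N) / 2))"
    using pm_count_le[of k] by (intro mult_mono) auto
  also have "\<dots> = (real k + 1) * (exp ((xlnx k - k) / 2) * exp ((xlnx (2 * l) - 2 * l) / 2 - (xlnx (2 * N) - 2 * N) / 2)) * real (pm_count (2 * N))"
    by simp
  also have "exp ((xlnx k - k) / 2) * exp ((xlnx (2 * l) - 2 * l) / 2 - (xlnx (2 * N) - 2 * N) / 2)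
      = exp ((xlnx k + xlnx (2 * N - k) - xlnx (2 * N)) / 2)"
    unfolding exp_add[symmetric] l(1) using lr by (simp add: field_simps)
  finally show ?thesis unfolding l(1) by simp
qed

text \<open>Both sides count matchings: on the left, those of \<open>Q + c\<close> points in which no two of \<open>c\<close> marked
  points are matched to each other.\<close>

lemma binomial_pm_count_le:
  assumes "c \<le> Q"
  shows "(Q choose c) * fact c * pm_count (Q - c) \<le> pm_count (Q + c)"
proof -
  have "((j + c) choose c) * fact c * pm_count j \<le> pm_count (j + 2 * c)" for j
  proof (induction c)
    case (Suc c)
    have "((j + Suc c) choose Suc c) * fact (Suc c) = Suc c * (Suc (j + c) choose Suc c) * fact c"
      by (simp only: fact_Suc add_Suc_right mult_ac of_nat_id)
    also have "\<dots> = Suc (j + c) * ((j + c) choose c) * fact c"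
      using Suc_times_binomial[of c "j + c"] by simp
    finally have "((j + Suc c) choose Suc c) * fact (Suc c) * pm_count j
        = Suc (j + c) * (((j + c) choose c) * fact c * pm_count j)"
      by (simp add: algebra_simps)
    also have "\<dots> \<le> Suc (j + 2 * c) * pm_count (j + 2 * c)"
      using Suc.IH by (intro mult_mono) auto
    finally show ?case by simp
  qed simp
  from this[of "Q - c"] show ?thesis using assms by (simp add: mult_2)
qed

definition bin_entropy :: "real \<Rightarrow> real" where
  "bin_entropy p = - xlnx p - xlnx (1 - p)"

text \<open>A single term of the expansion of (p + (1 - p))^K is at most 1. Leaving p free gives an
  exponent that is affine in c, so one p serves a whole range of c.\<close>

lemma binomial_le_exp:
  assumes p: "0 < p" "p < 1" and "c \<le> K"
  shows "real (K choose c) \<le> exp (- real c * ln p - (real K - real c) * ln (1 - p))"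
proof -
  have "real (K choose c) * p ^ c * (1 - p) ^ (K - c) \<le> (\<Sum>i\<le>K. real (K choose i) * p ^ i * (1 - p) ^ (K - i))"
    using assms by (intro member_le_sum[where f = "\<lambda>i. real (K choose i) * p ^ i * (1 - p) ^ (K - i)"]) auto
  also have "\<dots> = 1" using binomial_ring[of p "1 - p" K] by simp
  finally have "real (K choose c) * (p ^ c * (1 - p) ^ (K - c)) \<le> 1" by (simp add: mult.assoc)
  moreover have "p ^ c * (1 - p) ^ (K - c) = exp (real c * ln p + (real K - real c) * ln (1 - p))"
    using p assms(3) by (simp add: exp_add ln_realpow[symmetric] exp_of_nat_mult of_nat_diff[symmetric] del: of_nat_diff)
  ultimately have "real (K choose c) \<le> inverse (exp (real c * ln p + (real K - real c) * ln (1 - p)))"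
    by (simp add: field_simps)
  also have "\<dots> = exp (- real c * ln p - (real K - real c) * ln (1 - p))" by (simp add: exp_minus[symmetric])
  finally show ?thesis .
qed

section \<open>Small sets and small cuts\<close>

text \<open>Sum over the crossing points A over S and B outside. The choice of B and the bijection
  are absorbed into the number of arbitrary matchings of all points except the noncrossing ones over
  S, by \<open>binomial_pm_count_le\<close>. What remains are two matching numbers whose arguments
  add up to \<Delta> n, the form that \<open>pm_count_product_le\<close> treats without loss in
  n.\<close>

lemma card_cut_size_eq_le:
  assumes S: "S \<subseteq> {1..n}"
  shows "card {M \<in> perfect_matchings ({1..n} \<times> {1..\<Delta>}). cut_size \<Delta> M S = c}
    \<le> ((\<Delta> * card S) choose c) * pm_count (\<Delta> * card S - c) * pm_count (\<Delta> * n - (\<Delta> * card S - c))"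
proof -
  define U W where "U = {1..n} \<times> {1..\<Delta>}" and "W = S \<times> {1..\<Delta>}"
  define s Q where "s = card S" and "Q = \<Delta> * (n - s)"
  have finS: "finite S" using S finite_subset by blast
  have sn: "s \<le> n" using card_mono[of "{1..n}" S] S unfolding s_def by simp
  have WU: "W \<subseteq> U" "finite U" "finite W" using S finS unfolding U_def W_def by auto
  have cW: "card W = \<Delta> * s" unfolding W_def s_def by (simp add: card_cartesian_product)
  have "U - W = ({1..n} - S) \<times> {1..\<Delta>}" unfolding U_def W_def by auto
  then have cU: "card (U - W) = Q"
    using S finS unfolding Q_def s_def by (simp add: card_cartesian_product card_Diff_subset)
  define X where "X A B = {M \<in> perfect_matchings U. {p\<in>W. partner M p \<notin> W} = A \<and> {p\<in>U - W. partner M p \<in> W} = B}" for A B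
  define I where "I = {A. A \<subseteq> W \<and> card A = c} \<times> {B. B \<subseteq> U - W \<and> card B = c}"
  have finI: "finite I" unfolding I_def using WU by simp
  have cI: "card I = ((\<Delta> * s) choose c) * (Q choose c)"
    unfolding I_def using WU cW cU by (simp add: card_cartesian_product n_subsets)
  have "{M \<in> perfect_matchings U. cut_size \<Delta> M S = c} \<subseteq> (\<Union>(A,B)\<in>I. X A B)"
  proof
    fix M assume "M \<in> {M \<in> perfect_matchings U. cut_size \<Delta> M S = c}"
    then have M: "M \<in> perfect_matchings U" and c: "cut_size \<Delta> M S = c" by auto
    define A B where "A = {p\<in>W. partner M p \<notin> W}" and "B = {p\<in>U - W. partner M p \<in> W}"
    have cA: "card A = c" using c unfolding A_def cut_size_def W_def .
    have "A = {p\<in>W. partner M p \<in> U - W}"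
      unfolding A_def using partner(3)[OF M] WU by blast
    then have "card A = card B"
      unfolding B_def using card_crossing_swap[OF M WU(1), of "U - W"] by simp
    then have "(A, B) \<in> I" unfolding I_def using cA by (auto simp: A_def B_def)
    moreover have "M \<in> X A B" unfolding X_def A_def B_def using M by simp
    ultimately show "M \<in> (\<Union>(A,B)\<in>I. X A B)" by blast
  qed
  then have "card {M \<in> perfect_matchings U. cut_size \<Delta> M S = c} \<le> card (\<Union>(A,B)\<in>I. X A B)"
    by (rule card_mono[rotated]) (use finI WU in \<open>auto simp: X_def intro!: finite_subset[OF _ finite_perfect_matchings]\<close>)
  also have "\<dots> \<le> (\<Sum>(A,B)\<in>I. card (X A B))"
    using card_UN_le[OF finI, of "\<lambda>(A,B). X A B"] by (simp add: case_prod_unfold)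
  also have "\<dots> \<le> (\<Sum>(A,B)\<in>I. fact c * pm_count (\<Delta> * s - c) * pm_count (Q - c))"
  proof (rule sum_mono, clarify)
    fix A B assume "(A, B) \<in> I"
    then have "A \<subseteq> W" "B \<subseteq> U - W" "card A = c" "card B = c" unfolding I_def by auto
    then show "card (X A B) \<le> fact c * pm_count (\<Delta> * s - c) * pm_count (Q - c)"
      using card_matchings_crossing_le[OF WU(2,1), of A B] unfolding X_def cW cU by simp
  qed
  also have "\<dots> = ((\<Delta> * s) choose c) * pm_count (\<Delta> * s - c) * ((Q choose c) * fact c * pm_count (Q - c))"
    using cI by (simp add: case_prod_unfold)
  also have "\<dots> \<le> ((\<Delta> * s) choose c) * pm_count (\<Delta> * s - c) * pm_count (\<Delta> * n - (\<Delta> * s - c))"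
  proof (cases "c \<le> \<Delta> * s \<and> c \<le> Q")
    case True
    have "\<Delta> * n = Q + \<Delta> * s" using sn unfolding Q_def by (simp add: add_mult_distrib2[symmetric])
    then have "\<Delta> * n - (\<Delta> * s - c) = Q + c" using True by auto
    then show ?thesis using binomial_pm_count_le[of c Q] True by (intro mult_left_mono) auto
  next
    case False
    then show ?thesis by (auto simp: binomial_eq_0 not_le)
  qed
  finally show ?thesis unfolding U_def s_def .
qed

text \<open>Here t is a lower bound for the proportion of points over S that are matched inside. One
  factor \<Delta>|S| + 1 counts the possible cut sizes and the other is the loss of
  \<open>pm_count_product_le\<close>. For t at least 1/2 the binomial bound increases with the cut
  size, so the largest admissible cut dominates.\<close>

lemma card_small_cut_le:
  fixes t :: real
  assumes S: "S \<subseteq> {1..n}" "S \<noteq> {}" "2 * card S \<le> n" and t: "1 / 2 \<le> t" "t < 1"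
    and ev: "even (\<Delta> * n)" and \<Delta>: "\<Delta> > 0"
  shows "real (card {M \<in> perfect_matchings ({1..n} \<times> {1..\<Delta>}). real (cut_size \<Delta> M S) \<le> (1 - t) * \<Delta> * card S})
    \<le> (real \<Delta> * real (card S) + 1)^2 * exp (\<Delta> * card S * bin_entropy t - \<Delta> * n / 2 * bin_entropy (t * card S / n))
      * pm_count (\<Delta> * n)"
proof -
  define s where "s = card S"
  have finS: "finite S" using S(1) finite_subset by blast
  have s: "s \<ge> 1" "2 * s \<le> n" using S(2,3) finS unfolding s_def by (simp_all add: Suc_le_eq card_gt_0_iff)
  have n: "n > 0" using s by simp
  define K where "K = \<Delta> * s"
  define W where "W = \<Delta> * n"
  have KW: "2 * K \<le> W" using s unfolding K_def W_def by simp
  obtain N where N: "W = 2 * N" using ev unfolding W_def by blast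
  define P where "P = perfect_matchings ({1..n} \<times> {1..\<Delta>})"
  have finP: "finite P" unfolding P_def by (simp add: finite_perfect_matchings)
  define J where "J = {c. c \<le> K \<and> real c \<le> (1 - t) * K}"
  have finJ: "finite J" unfolding J_def by (rule finite_subset[of _ "{..K}"]) auto
  define E where "E = exp (K * bin_entropy t - W / 2 * bin_entropy (t * s / n))"
  have term_le: "real ((K choose c) * pm_count (K - c) * pm_count (W - (K - c))) \<le> (K + 1) * E * pm_count W"
    if c: "c \<in> J" for c
  proof -
    define k where "k = K - c"
    have cK: "c \<le> K" and ct: "real c \<le> (1 - t) * K" using c unfolding J_def by auto
    have rk: "real k = K - c" using cK unfolding k_def by simp
    have kt: "t * K \<le> k" using ct unfolding rk by (simp add: algebra_simps)
    have kW: "2 * k \<le> W" "k \<le> 2 * N" using KW N unfolding k_def by auto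
    have bin: "real (K choose c) \<le> exp (K * bin_entropy t)"
    proof -
      have "real (K choose c) \<le> exp (- real c * ln (1 - t) - (real K - real c) * ln t)"
        using binomial_le_exp[of "1 - t" c K] t cK by simp
      also have "\<dots> \<le> exp (K * bin_entropy t)"
      proof -
        have "(ln t - ln (1 - t)) * real c \<le> (ln t - ln (1 - t)) * ((1 - t) * K)"
          using t ct by (intro mult_left_mono) auto
        then show ?thesis unfolding bin_entropy_def xlnx_def by (simp add: algebra_simps)
      qed
      finally show ?thesis .
    qed
    have "xlnx k + xlnx (real W - real k) \<le> xlnx (t * K) + xlnx (W - t * K)"
      using xlnx_sum_antimono[of "t * K" k W] kt kW t by simp
    also have "\<dots> = xlnx W - W * bin_entropy (t * s / n)"
    proof -
      have Wp: "real W > 0" using n \<Delta> unfolding W_def by simp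
      have a: "t * K = W * (t * s / n)" using n unfolding W_def K_def by simp
      have b: "W - t * K = W * (1 - t * s / n)" unfolding a by (simp add: algebra_simps)
      have "t * real s \<le> 1 * real n" using t s by (intro mult_mono) auto
      then have p: "0 \<le> t * s / n" "0 \<le> 1 - t * s / n" using t n by (auto simp: field_simps)
      show ?thesis unfolding a xlnx_mult[OF Wp p(1)]
        unfolding b[unfolded a] xlnx_mult[OF Wp p(2)] bin_entropy_def by (simp add: algebra_simps)
    qed
    finally have ex: "xlnx k + xlnx (real W - real k) - xlnx W \<le> - W * bin_entropy (t * s / n)" by simp
    have "real (pm_count k) * real (pm_count (W - k))
        \<le> (real k + 1) * exp ((xlnx k + xlnx (real W - real k) - xlnx W) / 2) * real (pm_count W)"
      using pm_count_product_le[OF kW(2)] kW(1) unfolding N[symmetric] by (simp add: of_nat_diff N)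
    also have "\<dots> \<le> (real K + 1) * exp (- W / 2 * bin_entropy (t * s / n)) * real (pm_count W)"
      using ex cK unfolding rk by (intro mult_mono) auto
    finally have pm: "real (pm_count k) * real (pm_count (W - k))
        \<le> (real K + 1) * exp (- W / 2 * bin_entropy (t * s / n)) * real (pm_count W)" .
    have "real ((K choose c) * pm_count k * pm_count (W - k)) = real (K choose c) * (real (pm_count k) * real (pm_count (W - k)))"
      by simp
    also have "\<dots> \<le> exp (K * bin_entropy t) * ((real K + 1) * exp (- W / 2 * bin_entropy (t * s / n)) * real (pm_count W))"
      by (rule mult_mono[OF bin pm]) auto
    also have "\<dots> = (K + 1) * (exp (K * bin_entropy t) * exp (- W / 2 * bin_entropy (t * s / n))) * pm_count W" by simp
    also have "\<dots> = (K + 1) * E * pm_count W" unfolding E_def exp_add[symmetric] by simp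
    finally show ?thesis unfolding k_def .
  qed
  have "{M \<in> P. real (cut_size \<Delta> M S) \<le> (1 - t) * \<Delta> * s} \<subseteq> (\<Union>c\<in>J. {M \<in> P. cut_size \<Delta> M S = c})"
  proof
    fix M assume M: "M \<in> {M \<in> P. real (cut_size \<Delta> M S) \<le> (1 - t) * \<Delta> * s}"
    have "cut_size \<Delta> M S \<le> card (S \<times> {1..\<Delta>})" unfolding cut_size_def using finS by (intro card_mono) auto
    then have "cut_size \<Delta> M S \<le> K" unfolding K_def s_def by (simp add: card_cartesian_product mult.commute)
    then show "M \<in> (\<Union>c\<in>J. {M \<in> P. cut_size \<Delta> M S = c})"
      using M unfolding J_def K_def by (simp add: mult.assoc)
  qed
  then have "card {M \<in> P. real (cut_size \<Delta> M S) \<le> (1 - t) * \<Delta> * s} \<le> card (\<Union>c\<in>J. {M \<in> P. cut_size \<Delta> M S = c})"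
    by (rule card_mono[rotated]) (use finJ finP in auto)
  also have "\<dots> \<le> (\<Sum>c\<in>J. card {M \<in> P. cut_size \<Delta> M S = c})" by (rule card_UN_le[OF finJ])
  also have "\<dots> \<le> (\<Sum>c\<in>J. (K choose c) * pm_count (K - c) * pm_count (W - (K - c)))"
    using card_cut_size_eq_le[OF S(1)] unfolding P_def K_def W_def s_def by (intro sum_mono) auto
  finally have "real (card {M \<in> P. real (cut_size \<Delta> M S) \<le> (1 - t) * \<Delta> * s})
      \<le> real (\<Sum>c\<in>J. (K choose c) * pm_count (K - c) * pm_count (W - (K - c)))"
    by (simp only: of_nat_le_iff)
  also have "\<dots> = (\<Sum>c\<in>J. real ((K choose c) * pm_count (K - c) * pm_count (W - (K - c))))"
    by (rule of_nat_sum)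
  also have "\<dots> \<le> (\<Sum>c\<in>J. (K + 1) * E * pm_count W)" by (rule sum_mono) (rule term_le)
  also have "\<dots> = real (card J) * ((K + 1) * E * pm_count W)" by simp
  also have "\<dots> \<le> (K + 1) * ((K + 1) * E * pm_count W)"
  proof -
    have "card J \<le> card {..K}" unfolding J_def by (intro card_mono) auto
    then show ?thesis unfolding E_def by (intro mult_right_mono) auto
  qed
  finally show ?thesis unfolding P_def K_def W_def E_def s_def by (simp add: power2_eq_square algebra_simps)
qed

text \<open>The exponent of the expected number of such sets of size a n, including the choice of S,
  for \<Delta> = 2 d. It is normalised per vertex of S and not per vertex of the graph, since the
  sum runs over all sizes from 1 on.\<close>

definition small_cut_rate :: "real \<Rightarrow> real \<Rightarrow> real \<Rightarrow> real" where
  "small_cut_rate d t a = (bin_entropy a - d * bin_entropy (t * a)) / a + 2 * d * bin_entropy t"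

lemma card_exists_small_cut_le:
  fixes t a :: real
  assumes a: "a \<le> 1 / 2" and t: "1 / 2 \<le> t" "t < 1" and ev: "even (\<Delta> * n)" and \<Delta>: "\<Delta> > 0" and n: "n > 0"
  shows "real (card {M \<in> perfect_matchings ({1..n} \<times> {1..\<Delta>}).
      \<exists>S. S \<subseteq> {1..n} \<and> S \<noteq> {} \<and> card S \<le> a * n \<and> real (cut_size \<Delta> M S) \<le> (1 - t) * \<Delta> * card S})
    \<le> (\<Sum>s::nat | s \<in> {1..n} \<and> real s \<le> a * n. (real \<Delta> * real s + 1)^2 * exp (s * small_cut_rate (\<Delta> / 2) t (s / n))) * pm_count (\<Delta> * n)"
proof -
  define P where "P = perfect_matchings ({1..n} \<times> {1..\<Delta>})"
  have finP: "finite P" unfolding P_def by (simp add: finite_perfect_matchings)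
  define I where "I = {s::nat. s \<in> {1..n} \<and> real s \<le> a * n}"
  have finI: "finite I" unfolding I_def by simp
  define Q where "Q S = {M \<in> P. real (cut_size \<Delta> M S) \<le> (1 - t) * \<Delta> * card S}" for S
  define F where "F s = {S. S \<subseteq> {1..n} \<and> card S = s}" for s
  have finF: "finite (F s)" for s unfolding F_def by (rule finite_subset[of _ "Pow {1..n}"]) auto
  have "card {M \<in> P. \<exists>S. S \<subseteq> {1..n} \<and> S \<noteq> {} \<and> card S \<le> a * n \<and> real (cut_size \<Delta> M S) \<le> (1 - t) * \<Delta> * card S}
      \<le> card (\<Union>s\<in>I. \<Union>S\<in>F s. Q S)"
  proof (rule card_mono)
    show "finite (\<Union>s\<in>I. \<Union>S\<in>F s. Q S)" using finI finF finP unfolding Q_def by auto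
    show "{M \<in> P. \<exists>S. S \<subseteq> {1..n} \<and> S \<noteq> {} \<and> card S \<le> a * n \<and> real (cut_size \<Delta> M S) \<le> (1 - t) * \<Delta> * card S}
        \<subseteq> (\<Union>s\<in>I. \<Union>S\<in>F s. Q S)"
    proof
      fix M assume "M \<in> {M \<in> P. \<exists>S. S \<subseteq> {1..n} \<and> S \<noteq> {} \<and> card S \<le> a * n \<and> real (cut_size \<Delta> M S) \<le> (1 - t) * \<Delta> * card S}"
      then obtain S where M: "M \<in> P" and S: "S \<subseteq> {1..n}" "S \<noteq> {}" "card S \<le> a * n" "real (cut_size \<Delta> M S) \<le> (1 - t) * \<Delta> * card S"
        by blast
      have "finite S" using S(1) finite_subset by blast
      then have "card S \<in> I" unfolding I_def using S(2,3) card_mono[OF _ S(1)] by (simp add: Suc_le_eq card_gt_0_iff)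
      moreover have "S \<in> F (card S)" unfolding F_def using S(1) by simp
      moreover have "M \<in> Q S" unfolding Q_def using M S(4) by simp
      ultimately show "M \<in> (\<Union>s\<in>I. \<Union>S\<in>F s. Q S)" by blast
    qed
  qed
  also have "\<dots> \<le> (\<Sum>s\<in>I. card (\<Union>S\<in>F s. Q S))" by (rule card_UN_le[OF finI])
  also have "\<dots> \<le> (\<Sum>s\<in>I. \<Sum>S\<in>F s. card (Q S))" by (intro sum_mono card_UN_le finF)
  finally have "real (card {M \<in> P. \<exists>S. S \<subseteq> {1..n} \<and> S \<noteq> {} \<and> card S \<le> a * n \<and> real (cut_size \<Delta> M S) \<le> (1 - t) * \<Delta> * card S})
      \<le> real (\<Sum>s\<in>I. \<Sum>S\<in>F s. card (Q S))" by (simp only: of_nat_le_iff)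
  also have "\<dots> = (\<Sum>s\<in>I. \<Sum>S\<in>F s. real (card (Q S)))" by simp
  also have "\<dots> \<le> (\<Sum>s\<in>I. (real \<Delta> * real s + 1)^2 * exp (s * small_cut_rate (\<Delta> / 2) t (s / n)) * pm_count (\<Delta> * n))"
  proof (rule sum_mono)
    fix s assume s: "s \<in> I"
    have s1: "s \<ge> 1" "real s \<le> a * n" using s unfolding I_def by auto
    have "a * n \<le> 1 / 2 * n" using a by (intro mult_right_mono) auto
    then have s2: "2 * s \<le> n" using s1(2) by linarith
    define \<alpha> where "\<alpha> = real s / n"
    have \<alpha>: "0 < \<alpha>" "\<alpha> < 1" using s1 s2 n unfolding \<alpha>_def by auto
    define E where "E = exp (\<Delta> * s * bin_entropy t - \<Delta> * n / 2 * bin_entropy (t * \<alpha>))"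
    have "(\<Sum>S\<in>F s. real (card (Q S))) \<le> (\<Sum>S\<in>F s. (real \<Delta> * real s + 1)^2 * E * pm_count (\<Delta> * n))"
    proof (rule sum_mono)
      fix S assume "S \<in> F s"
      then have S: "S \<subseteq> {1..n}" "card S = s" unfolding F_def by auto
      have "S \<noteq> {}" using S(2) s1 by auto
      from card_small_cut_le[OF S(1) this _ t ev \<Delta>] S(2) s2
      show "real (card (Q S)) \<le> (real \<Delta> * real s + 1)^2 * E * pm_count (\<Delta> * n)"
        unfolding Q_def P_def E_def \<alpha>_def by simp
    qed
    also have "\<dots> = real (n choose s) * ((real \<Delta> * real s + 1)^2 * E * pm_count (\<Delta> * n))"
      using n_subsets[of "{1..n}" s] unfolding F_def by simp
    also have "\<dots> \<le> exp (n * bin_entropy \<alpha>) * ((real \<Delta> * real s + 1)^2 * E * pm_count (\<Delta> * n))"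
    proof (intro mult_right_mono)
      have "real s = n * \<alpha>" unfolding \<alpha>_def using n by simp
      then have "- real s * ln \<alpha> - (real n - real s) * ln (1 - \<alpha>) = n * bin_entropy \<alpha>"
        unfolding bin_entropy_def xlnx_def by (simp add: algebra_simps)
      then show "real (n choose s) \<le> exp (n * bin_entropy \<alpha>)"
        using binomial_le_exp[OF \<alpha>, of s n] s2 by simp
    qed (auto simp: E_def)
    also have "\<dots> = (real \<Delta> * real s + 1)^2 * (exp (n * bin_entropy \<alpha>) * E) * pm_count (\<Delta> * n)" by simp
    also have "exp (n * bin_entropy \<alpha>) * E = exp (s * small_cut_rate (\<Delta> / 2) t \<alpha>)"
    proof -
      have "s * ((bin_entropy \<alpha> - \<Delta> / 2 * bin_entropy (t * \<alpha>)) / \<alpha>) = n * (bin_entropy \<alpha> - \<Delta> / 2 * bin_entropy (t * \<alpha>))"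
        using s1 unfolding \<alpha>_def by simp
      then show ?thesis unfolding E_def small_cut_rate_def exp_add[symmetric] by (simp add: algebra_simps)
    qed
    finally show "(\<Sum>S\<in>F s. real (card (Q S))) \<le> (real \<Delta> * real s + 1)^2 * exp (s * small_cut_rate (\<Delta> / 2) t (s / n)) * pm_count (\<Delta> * n)"
      unfolding \<alpha>_def .
  qed
  finally show ?thesis unfolding P_def I_def by (simp add: sum_distrib_right)
qed

text \<open>In the derivative all terms with ln x cancel, leaving (ln(1 - x) - d ln(1 - t x))/x^2.
  For d = 2 its sign is that of (2 t - 1) - t^2 x, and larger d only helps. With x at most 1/2 the
  condition t >= 3/4 suffices. Negativity thus has to be checked only at the largest
  density.\<close>

lemma small_cut_rate_mono:
  assumes d: "d \<ge> 2" and t: "3 / 4 \<le> t" "t < 1" and a: "0 < a" "a \<le> b" "b \<le> 1 / 2"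
  shows "small_cut_rate d t a \<le> small_cut_rate d t b"
proof (rule DERIV_nonneg_imp_nondecreasing[OF a(2)])
  fix x assume x: "a \<le> x" "x \<le> b"
  then have x: "0 < x" "x \<le> 1 / 2" using a by auto
  have "t * x \<le> 1 * (1 / 2)" using t x by (intro mult_mono) auto
  then have tx: "0 < t * x" "t * x < 1" using t x by auto
  have D: "(bin_entropy has_real_derivative (ln (1 - y) - ln y)) (at y)" if "0 < y" "y < 1" for y
    unfolding bin_entropy_def xlnx_def using that by (auto intro!: derivative_eq_intros)
  have D2: "((\<lambda>x. bin_entropy (t * x)) has_real_derivative ((ln (1 - t * x) - ln (t * x)) * t)) (at x)"
    by (rule DERIV_chain2[OF D]) (use tx in \<open>auto intro!: derivative_eq_intros\<close>)
  have "((\<lambda>x. bin_entropy x - d * bin_entropy (t * x)) has_real_derivative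
      ((ln (1 - x) - ln x) - d * ((ln (1 - t * x) - ln (t * x)) * t))) (at x)"
    using x by (intro DERIV_diff DERIV_cmult D D2) auto
  from DERIV_divide[OF this DERIV_ident]
  have "((\<lambda>x. (bin_entropy x - d * bin_entropy (t * x)) / x) has_real_derivative
      (((ln (1 - x) - ln x) - d * ((ln (1 - t * x) - ln (t * x)) * t)) * x - (bin_entropy x - d * bin_entropy (t * x)) * 1) / (x * x)) (at x)"
    using x by simp
  moreover have "((ln (1 - x) - ln x) - d * ((ln (1 - t * x) - ln (t * x)) * t)) * x - (bin_entropy x - d * bin_entropy (t * x)) * 1
      = ln (1 - x) - d * ln (1 - t * x)"
    unfolding bin_entropy_def xlnx_def by (simp add: algebra_simps)
  ultimately have "((\<lambda>x. (bin_entropy x - d * bin_entropy (t * x)) / x) has_real_derivative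
      (ln (1 - x) - d * ln (1 - t * x)) / (x * x)) (at x)" by simp
  from DERIV_add[OF this DERIV_const]
  have "(small_cut_rate d t has_real_derivative (ln (1 - x) - d * ln (1 - t * x)) / (x * x)) (at x)"
    unfolding small_cut_rate_def[abs_def] by simp
  moreover have "0 \<le> ln (1 - x) - d * ln (1 - t * x)"
  proof -
    have "d * ln (1 - t * x) \<le> 2 * ln (1 - t * x)"
      using d tx by (intro mult_right_mono_neg) auto
    also have "\<dots> = ln ((1 - t * x) ^ 2)" using tx by (simp add: ln_realpow)
    also have "\<dots> \<le> ln (1 - x)"
    proof -
      have "t * t * x \<le> 1 * (1 / 2)" using t x by (intro mult_mono mult_le_one) auto
      then have "x * (t * t * x) \<le> x * (2 * t - 1)" using t x by (intro mult_left_mono) auto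
      then have "(1 - t * x) ^ 2 \<le> 1 - x" by (simp add: power2_eq_square algebra_simps)
      then show ?thesis using tx x by (subst ln_le_cancel_iff) auto
    qed
    finally show ?thesis by simp
  qed
  ultimately show "\<exists>y. (small_cut_rate d t has_real_derivative y) (at x) \<and> 0 \<le> y"
    using x by (intro exI[of _ "(ln (1 - x) - d * ln (1 - t * x)) / (x * x)"]) auto
qed

text \<open>A negative rate alone bounds the contribution of a fixed size s by a constant. The
  logarithmic divergence at a = 0 shows that it is of order n^(- s (d t - 1)) and tends to
  0.\<close>

lemma small_cut_rate_le_ln:
  assumes d: "d \<ge> 2" and t: "3 / 4 \<le> t" "t < 1" and a: "0 < a" "a \<le> 1 / 2"
  shows "small_cut_rate d t a \<le> (d * t - 1) * ln a + (1 + d * t * ln t + 2 * d * bin_entropy t)"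
proof -
  have "t * a \<le> 1 * (1 / 2)" using t a by (intro mult_mono) auto
  then have ta: "0 < t * a" "t * a < 1" using t a by auto
  have "- ln (1 - a) = ln (1 / (1 - a))" using a by (simp add: ln_div)
  also have "\<dots> \<le> 1 / (1 - a) - 1" using a by (intro ln_le_minus_one) auto
  finally have "(1 - a) * (- ln (1 - a)) \<le> (1 - a) * (1 / (1 - a) - 1)" using a by (intro mult_left_mono) auto
  also have "\<dots> = a" using a by (simp add: field_simps)
  finally have 1: "- xlnx (1 - a) \<le> a" unfolding xlnx_def by simp
  have "d * xlnx (1 - t * a) \<le> 0" unfolding xlnx_def using d ta by (intro mult_nonneg_nonpos) auto
  with 1 have "bin_entropy a - d * bin_entropy (t * a) \<le> a + d * xlnx (t * a) - xlnx a"
    unfolding bin_entropy_def by (simp add: algebra_simps)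
  also have "\<dots> = a * ((d * t - 1) * ln a + 1 + d * t * ln t)"
    unfolding xlnx_def using t a by (simp add: ln_mult algebra_simps)
  finally have "(bin_entropy a - d * bin_entropy (t * a)) / a \<le> (d * t - 1) * ln a + 1 + d * t * ln t"
    using a by (simp add: divide_le_eq mult.commute)
  then show ?thesis unfolding small_cut_rate_def by simp
qed

text \<open>Dominated convergence for series: monotonicity of the rate gives a summable majorant
  decaying like exp(- \<delta> s), and \<open>small_cut_rate_le_ln\<close> gives convergence to 0
  for every fixed s.\<close>

lemma small_cut_sum_tendsto_0:
  fixes d t a :: real
  assumes d: "d \<ge> 2" and t: "3 / 4 \<le> t" "t < 1" and a: "0 < a" "a \<le> 1 / 2"
    and neg: "small_cut_rate d t a < 0"
  shows "(\<lambda>n. \<Sum>s::nat | s \<in> {1..n} \<and> real s \<le> a * n. (2 * d * s + 1)^2 * exp (s * small_cut_rate d t (s / n))) \<longlonglongrightarrow> 0"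
proof -
  define \<delta> where "\<delta> = - small_cut_rate d t a"
  have \<delta>: "\<delta> > 0" using neg unfolding \<delta>_def by simp
  define f where "f k n = (if k \<in> {1..n} \<and> real k \<le> a * n then (2 * d * k + 1)^2 * exp (k * small_cut_rate d t (k / n)) else 0)"
    for k n :: nat
  define g where "g k = (2 * d * real k + 1)^2 * exp (- \<delta> * k)" for k :: nat
  have bound: "norm (f k n) \<le> g k" for k n
  proof (cases "k \<in> {1..n} \<and> real k \<le> a * n")
    case True
    then have "0 < real k / n" "real k / n \<le> a" by (auto simp: field_simps)
    then have "small_cut_rate d t (k / n) \<le> - \<delta>"
      unfolding \<delta>_def using small_cut_rate_mono[OF d t, of "k / n" a] a by simp
    then have "real k * small_cut_rate d t (k / n) \<le> real k * - \<delta>"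
      by (rule mult_left_mono) simp
    then have "exp (k * small_cut_rate d t (k / n)) \<le> exp (- \<delta> * k)"
      by (simp add: mult.commute)
    then have "(2 * d * k + 1)^2 * exp (k * small_cut_rate d t (k / n)) \<le> g k"
      unfolding g_def by (rule mult_left_mono) simp
    then show ?thesis unfolding f_def using True by (simp add: abs_mult)
  qed (auto simp: f_def g_def)
  have summ: "summable g"
  proof -
    have "g \<in> O(\<lambda>k. exp (- \<delta> / 2) ^ k)"
    proof -
      have "(\<lambda>k::nat. (2 * d * real k + 1)^2 * exp (- \<delta> * real k)) \<in> O(\<lambda>k::nat. exp (- \<delta> / 2 * real k))"
        using \<delta> d by real_asymp
      then show ?thesis unfolding g_def by (simp add: exp_of_nat_mult[symmetric] mult.commute)
    qed
    moreover have "summable (\<lambda>k. norm (exp (- \<delta> / 2) ^ k))"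
      using summable_geometric[of "exp (- \<delta> / 2)"] \<delta> by (simp add: norm_power)
    ultimately show ?thesis by (rule summable_comparison_test_bigo[rotated])
  qed
  have lim: "(\<lambda>n. f k n) \<longlonglongrightarrow> 0" for k
  proof (cases "k = 0")
    case True
    then show ?thesis unfolding f_def by simp
  next
    case False
    define C where "C = 1 + d * t * ln t + 2 * d * bin_entropy t"
    define e where "e = d * t - 1"
    have "2 * (3 / 4) \<le> d * t" using d t by (intro mult_mono) auto
    then have e: "e > 0" unfolding e_def by simp
    have k: "real k > 0" using False by simp
    show ?thesis
    proof (rule Lim_null_comparison)
      show "\<forall>\<^sub>F n in sequentially. norm (f k n) \<le> (2 * d * k + 1)^2 * exp (k * (e * ln (k / n) + C))"
      proof (rule always_eventually, rule allI)
        fix n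
        show "norm (f k n) \<le> (2 * d * k + 1)^2 * exp (k * (e * ln (k / n) + C))"
        proof (cases "k \<in> {1..n} \<and> real k \<le> a * n")
          case True
          then have "0 < real k / n" "real k / n \<le> a" by (auto simp: field_simps)
          then have "small_cut_rate d t (k / n) \<le> e * ln (k / n) + C"
            unfolding e_def C_def using a by (intro small_cut_rate_le_ln[OF d t]) linarith+
          then have "exp (k * small_cut_rate d t (k / n)) \<le> exp (k * (e * ln (k / n) + C))"
            using k by simp
          then show ?thesis unfolding f_def using True by (simp add: abs_mult mult_left_mono)
        qed (auto simp: f_def)
      qed
      show "(\<lambda>n. (2 * d * k + 1)^2 * exp (k * (e * ln (k / real n) + C))) \<longlonglongrightarrow> 0"
        using e k by real_asymp
    qed
  qed
  have "(\<lambda>n. \<Sum>k. f k n) \<longlonglongrightarrow> (\<Sum>k. 0)"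
    using tannerys_theorem[of f "\<lambda>_. 0" sequentially g] lim bound summ by (auto simp: case_prod_unfold)
  moreover have "(\<Sum>k. f k n) = (\<Sum>s::nat | s \<in> {1..n} \<and> real s \<le> a * n. (2 * d * s + 1)^2 * exp (s * small_cut_rate d t (s / n)))" for n
  proof -
    have "(\<Sum>k. f k n) = sum (\<lambda>k. f k n) {s::nat. s \<in> {1..n} \<and> real s \<le> a * n}"
      by (rule suminf_finite) (auto simp: f_def)
    also have "\<dots> = (\<Sum>s::nat | s \<in> {1..n} \<and> real s \<le> a * n. (2 * d * s + 1)^2 * exp (s * small_cut_rate d t (s / n)))"
      by (rule sum.cong) (auto simp: f_def)
    finally show ?thesis .
  qed
  ultimately show ?thesis by simp
qed

section \<open>Counting tie-broken cuts\<close>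

definition half_poly :: "nat \<Rightarrow> real \<Rightarrow> real" where
  "half_poly \<Delta> x = (\<Sum>i\<le>\<Delta> div 2. half_binom \<Delta> i * x ^ i)"

lemma half_poly_pos: "x > 0 \<Longrightarrow> half_poly \<Delta> x > 0"
  unfolding half_poly_def half_binom_def by (intro sum_pos) (auto simp: zero_less_binomial_iff)

lemma half_poly_even:
  assumes "even \<Delta>"
  shows "2 * half_poly \<Delta> x = 2 * (\<Sum>i<\<Delta> div 2. real (\<Delta> choose i) * x ^ i) + real (\<Delta> choose (\<Delta> div 2)) * x ^ (\<Delta> div 2)"
proof -
  have "half_poly \<Delta> x = (\<Sum>i<\<Delta> div 2. half_binom \<Delta> i * x ^ i) + half_binom \<Delta> (\<Delta> div 2) * x ^ (\<Delta> div 2)"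
    unfolding half_poly_def by (simp add: lessThan_Suc_atMost[symmetric])
  also have "(\<Sum>i<\<Delta> div 2. half_binom \<Delta> i * x ^ i) = (\<Sum>i<\<Delta> div 2. real (\<Delta> choose i) * x ^ i)"
    by (rule sum.cong) (auto simp: half_binom_def)
  finally show ?thesis by (simp add: half_binom_def)
qed

lemma sum_power_card_subsets:
  assumes "finite D" "finite I"
  shows "(\<Sum>A | A \<subseteq> D \<and> card A \<in> I. x ^ card A) = (\<Sum>i\<in>I. real (card D choose i) * x ^ i)"
proof -
  have "{A. A \<subseteq> D \<and> card A \<in> I} = (\<Union>i\<in>I. {A. A \<subseteq> D \<and> card A = i})" by auto
  then have "(\<Sum>A | A \<subseteq> D \<and> card A \<in> I. x ^ card A) = (\<Sum>i\<in>I. \<Sum>A | A \<subseteq> D \<and> card A = i. x ^ card A)"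
    using assms by (simp only:) (rule sum.UNION_disjoint, auto)
  also have "\<dots> = (\<Sum>i\<in>I. real (card D choose i) * x ^ i)"
    using assms by (intro sum.cong refl) (simp add: n_subsets)
  finally show ?thesis .
qed

text \<open>A type of v consists of its side, with \<open>True\<close> for S, and of the indices of
  its crossing points. The set X contains the exceptional vertices, the image of the list g.\<close>

definition allowed_types :: "nat \<Rightarrow> nat \<Rightarrow> nat set \<Rightarrow> nat \<Rightarrow> (bool \<times> nat set) set" where
  "allowed_types \<Delta> \<theta> X v = {(b, A). A \<subseteq> {1..\<Delta>} \<and> 2 * card A \<le> \<Delta> \<and>
     (2 * card A = \<Delta> \<longrightarrow> (if b then v \<le> \<theta> else \<theta> < v \<or> v \<in> X))}"

lemma finite_allowed_types: "finite (allowed_types \<Delta> \<theta> X v)"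
  by (rule finite_subset[of _ "UNIV \<times> Pow {1..\<Delta>}"]) (auto simp: allowed_types_def)

text \<open>A vertex outside \<open>X\<close> can have exactly half of its edges crossing on one side only; this is
  where the factor \<open>1/2\<close> in \<open>half_binom\<close> comes from.\<close>

lemma sum_allowed_types_le:
  assumes ev: "even \<Delta>" and x: "x > 0"
  shows "(\<Sum>(b, A)\<in>allowed_types \<Delta> \<theta> X v. x ^ card A) \<le> (if v \<in> X then 2 else 1) * (2 * half_poly \<Delta> x)"
proof -
  define h where "h = \<Delta> div 2"
  have h: "\<Delta> = 2 * h" using ev unfolding h_def by simp
  define R where "R = {b. if b then v \<le> \<theta> else \<theta> < v \<or> v \<in> X}"
  define L0 L1 where "L0 = {A. A \<subseteq> {1..\<Delta>} \<and> card A \<in> {..<h}}" and "L1 = {A. A \<subseteq> {1..\<Delta>} \<and> card A \<in> {h}}"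
  have fin: "finite L0" "finite L1" unfolding L0_def L1_def by auto
  have split: "allowed_types \<Delta> \<theta> X v = ((UNIV :: bool set) \<times> L0) \<union> (R \<times> L1)"
    unfolding allowed_types_def R_def L0_def L1_def h by auto
  have "(\<Sum>(b, A)\<in>allowed_types \<Delta> \<theta> X v. x ^ card A) = (\<Sum>(b, A)\<in>(UNIV :: bool set) \<times> L0. x ^ card A) + (\<Sum>(b, A)\<in>R \<times> L1. x ^ card A)"
    unfolding split using fin by (intro sum.union_disjoint) (auto simp: L0_def L1_def)
  also have "\<dots> = 2 * (\<Sum>A\<in>L0. x ^ card A) + card R * (\<Sum>A\<in>L1. x ^ card A)"
    by (simp add: sum.cartesian_product[symmetric])
  also have "(\<Sum>A\<in>L0. x ^ card A) = (\<Sum>i<h. real (\<Delta> choose i) * x ^ i)"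
    unfolding L0_def by (subst sum_power_card_subsets) auto
  also have "(\<Sum>A\<in>L1. x ^ card A) = real (\<Delta> choose h) * x ^ h"
    unfolding L1_def by (subst sum_power_card_subsets) auto
  finally have eq: "(\<Sum>(b, A)\<in>allowed_types \<Delta> \<theta> X v. x ^ card A)
    = 2 * (\<Sum>i<h. real (\<Delta> choose i) * x ^ i) + card R * (real (\<Delta> choose h) * x ^ h)" .
  have R2: "card R \<le> (if v \<in> X then 2 else 1)"
  proof (cases "v \<in> X")
    case True
    then show ?thesis using card_mono[of "UNIV :: bool set" R] by simp
  next
    case False
    then have "R = {v \<le> \<theta>}" unfolding R_def by (auto split: if_splits)
    then show ?thesis by simp
  qed
  have nn: "0 \<le> real (\<Delta> choose h) * x ^ h" "0 \<le> (\<Sum>i<h. real (\<Delta> choose i) * x ^ i)"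
    using x by (auto intro!: sum_nonneg)
  have "real (card R) * (real (\<Delta> choose h) * x ^ h) \<le> (if v \<in> X then 2 else 1) * (real (\<Delta> choose h) * x ^ h)"
    using R2 nn by (intro mult_right_mono) (auto split: if_splits)
  then show ?thesis
    unfolding eq half_poly_even[OF ev] h_def[symmetric] using nn by (auto split: if_splits)
qed

text \<open>For fixed \<theta> and X the types at different vertices are chosen independently, so
  the sum factors. As the side belongs to the type, it runs over all S at once, and no separate
  entropy term for the choice of S occurs.\<close>

lemma sum_PiE_allowed_types_le:
  assumes ev: "even \<Delta>" and x: "x > 0" and X: "finite X"
  shows "(\<Sum>F\<in>PiE {1..n} (allowed_types \<Delta> \<theta> X). x ^ (\<Sum>v\<in>{1..n}. card (snd (F v)))) \<le> 2 ^ card X * (2 * half_poly \<Delta> x) ^ n"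
proof -
  have "(\<Sum>F\<in>PiE {1..n} (allowed_types \<Delta> \<theta> X). x ^ (\<Sum>v\<in>{1..n}. card (snd (F v))))
      = (\<Sum>F\<in>PiE {1..n} (allowed_types \<Delta> \<theta> X). \<Prod>v\<in>{1..n}. x ^ card (snd (F v)))"
    by (simp add: power_sum)
  also have "\<dots> = (\<Prod>v\<in>{1..n}. \<Sum>z\<in>allowed_types \<Delta> \<theta> X v. x ^ card (snd z))"
    by (rule prod_sum_PiE[symmetric]) (auto simp: finite_allowed_types)
  also have "\<dots> \<le> (\<Prod>v\<in>{1..n}. (if v \<in> X then 2 else 1) * (2 * half_poly \<Delta> x))"
  proof (rule prod_mono, safe)
    fix v
    show "0 \<le> (\<Sum>z\<in>allowed_types \<Delta> \<theta> X v. x ^ card (snd z))" using x by (intro sum_nonneg) auto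
    show "(\<Sum>z\<in>allowed_types \<Delta> \<theta> X v. x ^ card (snd z)) \<le> (if v \<in> X then 2 else 1) * (2 * half_poly \<Delta> x)"
      using sum_allowed_types_le[OF ev x, of \<theta> X v] by (simp add: case_prod_unfold)
  qed
  also have "\<dots> = (\<Prod>v\<in>{1..n}. if v \<in> X then 2 else 1) * (2 * half_poly \<Delta> x) ^ n"
    by (simp add: prod.distrib)
  also have "(\<Prod>v\<in>{1..n}. if v \<in> X then 2 else (1::real)) = 2 ^ card ({1..n} \<inter> X)"
    by (simp add: prod.If_cases)
  also have "(2::real) ^ card ({1..n} \<inter> X) * (2 * half_poly \<Delta> x) ^ n \<le> 2 ^ card X * (2 * half_poly \<Delta> x) ^ n"
    using half_poly_pos[OF x, of \<Delta>] X by (intro mult_right_mono power_increasing card_mono) auto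
  finally show ?thesis .
qed

text \<open>Exponential rate, per vertex, of the probability that prescribed crossing points are
  exactly the crossing ones, for |S| = a n, cut c n and \<Delta> = 2 d. The three leading terms come
  from the bijection and the two induced matchings.\<close>

definition pairing_rate :: "real \<Rightarrow> real \<Rightarrow> real \<Rightarrow> real" where
  "pairing_rate d a c = xlnx c + xlnx (2 * d * a - c) / 2 + xlnx (2 * d * (1 - a) - c) / 2 - xlnx (2 * d) / 2"

lemma crossing_product_le:
  assumes n: "n > 0" and \<Delta>: "\<Delta> > 0" and ev: "even (\<Delta> * n)" and c: "c \<le> \<Delta> * s" "c \<le> \<Delta> * (n - s)" and sn: "s \<le> n"
  shows "real (fact c * pm_count (\<Delta> * s - c) * pm_count (\<Delta> * (n - s) - c))
    \<le> exp 1 * (real \<Delta> * n + 1) ^ 3 * exp (n * pairing_rate (\<Delta> / 2) (s / n) (c / n)) * pm_count (\<Delta> * n)"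
proof -
  define k l W where "k = \<Delta> * s - c" and "l = \<Delta> * (n - s) - c" and "W = \<Delta> * n"
  have rk: "real k = real \<Delta> * s - c" using c unfolding k_def by (simp add: of_nat_diff)
  have "l + c + \<Delta> * s = \<Delta> * n"
    using c(2) sn unfolding l_def by (simp add: add_mult_distrib2[symmetric])
  then have "real (l + c + \<Delta> * s) = real (\<Delta> * n)" by (rule arg_cong)
  then have rl: "real l = real \<Delta> * n - real \<Delta> * s - c" by simp
  have W: "real W = \<Delta> * n" unfolding W_def by simp
  obtain N where N: "W = 2 * N" using ev unfolding W_def by blast
  have sW: "\<Delta> * s \<le> W" "\<Delta> * (n - s) \<le> W" unfolding W_def using sn by auto
  have le: "real c \<le> W" "real k \<le> W" "real l \<le> W"
    using c sW unfolding k_def l_def by linarith+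
  have "real (fact c * pm_count k * pm_count l) = fact c * real (pm_count k) * real (pm_count l)" by simp
  also have "\<dots> \<le> (exp 1 * (real W + 1) * exp (xlnx c - c)) * ((real W + 1) * exp ((xlnx k - k) / 2)) * ((real W + 1) * exp ((xlnx l - l) / 2))"
  proof (intro mult_mono)
    have "fact c \<le> exp 1 * (real c + 1) * exp (xlnx c - c)" by (rule fact_le_exp_xlnx)
    also have "\<dots> \<le> exp 1 * (real W + 1) * exp (xlnx c - c)" using le by (intro mult_right_mono mult_left_mono) auto
    finally show "fact c \<le> exp 1 * (real W + 1) * exp (xlnx c - c)" .
    show "real (pm_count k) \<le> (real W + 1) * exp ((xlnx k - k) / 2)"
      using le by (intro order.trans[OF pm_count_le] mult_right_mono) auto
    show "real (pm_count l) \<le> (real W + 1) * exp ((xlnx l - l) / 2)"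
      using le by (intro order.trans[OF pm_count_le] mult_right_mono) auto
  qed auto
  also have "\<dots> = exp 1 * (real W + 1) ^ 3 * (exp (xlnx c - c) * exp ((xlnx k - k) / 2) * exp ((xlnx l - l) / 2))"
    by (simp add: power3_eq_cube algebra_simps)
  also have "exp (xlnx c - c) * exp ((xlnx k - k) / 2) * exp ((xlnx l - l) / 2)
      = exp (n * pairing_rate (\<Delta> / 2) (s / n) (c / n)) * exp ((xlnx W - W) / 2)"
  proof -
    have n': "real n > 0" using n by simp
    have sc: "xlnx z = n * xlnx (z / n) + z * ln n" if "z \<ge> 0" for z
    proof -
      have "xlnx z = xlnx (n * (z / n))" using n' by simp
      also have "\<dots> = n * xlnx (z / n) + z / n * xlnx n" using that by (intro xlnx_mult n') auto
      finally show ?thesis unfolding xlnx_def[of "real n"] using n' by simp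
    qed
    have e: "real k / n = 2 * (\<Delta> / 2) * (s / n) - c / n" "real l / n = 2 * (\<Delta> / 2) * (1 - s / n) - c / n" "real W / n = 2 * (\<Delta> / 2)"
      unfolding rk rl W using n' by (simp_all add: field_simps)
    have "n * pairing_rate (\<Delta> / 2) (s / n) (c / n)
        = n * xlnx (c / n) + n * xlnx (k / n) / 2 + n * xlnx (l / n) / 2 - n * xlnx (W / n) / 2"
      unfolding pairing_rate_def e by (simp add: algebra_simps)
    \<comment> \<open>This balance of points cancels both the linear terms of Stirling's formula and
      the terms with ln n that appear when all quantities are divided by n.\<close>
    moreover have tot: "2 * real c + real k + real l = real W" using rk rl W by simp
    moreover have "2 * (real c * ln n) + real k * ln n + real l * ln n = real W * ln n"
      unfolding tot[symmetric] by (simp add: algebra_simps)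
    ultimately have "xlnx c - c + (xlnx k - k) / 2 + (xlnx l - l) / 2
        = n * pairing_rate (\<Delta> / 2) (s / n) (c / n) + (xlnx W - W) / 2"
      using sc[of c] sc[of k] sc[of l] sc[of W] by (simp add: field_simps)
    then show ?thesis unfolding exp_add[symmetric] by simp
  qed
  also have "exp 1 * (real W + 1) ^ 3 * (exp (n * pairing_rate (\<Delta> / 2) (s / n) (c / n)) * exp ((xlnx W - W) / 2))
      \<le> exp 1 * (real W + 1) ^ 3 * (exp (n * pairing_rate (\<Delta> / 2) (s / n) (c / n)) * pm_count W)"
    using pm_count_ge[of N] unfolding N[symmetric] by (intro mult_left_mono) (auto simp: N)
  finally show ?thesis unfolding k_def l_def W_def by simp
qed

text \<open>An exponential tilt: the types fix all crossing points, and their number is twice the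
  cut size c. Writing the bound as a multiple of x^(2 c)/(2 P(x))^n prepares the sum over types,
  which is controlled by \<open>sum_PiE_allowed_types_le\<close>.\<close>

lemma card_typed_matchings_le:
  fixes F :: "nat \<Rightarrow> bool \<times> nat set" and x hi lo e :: real
  assumes n: "n > 0" and \<Delta>: "\<Delta> > 0" and ev: "even (\<Delta> * n)" and x: "x > 0"
    and F: "\<And>v. v \<in> {1..n} \<Longrightarrow> snd (F v) \<subseteq> {1..\<Delta>}"
    and S: "S = {v \<in> {1..n}. fst (F v)}"
    and rate: "\<And>c. real c \<le> hi * card S \<Longrightarrow> lo * card S \<le> real c \<Longrightarrow>
      pairing_rate (\<Delta> / 2) (card S / n) (c / n) + ln (2 * half_poly \<Delta> x) - 2 * (c / n) * ln x \<le> - e"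
  shows "real (card {M \<in> perfect_matchings ({1..n} \<times> {1..\<Delta>}).
      (\<forall>v\<in>{1..n}. snd (F v) = {k \<in> {1..\<Delta>}. (fst (partner M (v,k)) \<in> S) \<noteq> (v \<in> S)}) \<and>
      real (cut_size \<Delta> M S) \<le> hi * card S \<and> lo * card S \<le> real (cut_size \<Delta> M S)})
    \<le> exp 1 * (real \<Delta> * n + 1) ^ 3 * exp (- e * n) * pm_count (\<Delta> * n)
      * (x ^ (\<Sum>v\<in>{1..n}. card (snd (F v))) / (2 * half_poly \<Delta> x) ^ n)"
    (is "real (card ?Q) \<le> ?R")
proof (cases "?Q = {}")
  case True
  have "?R \<ge> 0" using x half_poly_pos[OF x, of \<Delta>] by simp
  then show ?thesis unfolding True by simp
next
  case False
  define U W where "U = {1..n} \<times> {1..\<Delta>}" and "W = S \<times> {1..\<Delta>}"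
  have SV: "S \<subseteq> {1..n}" unfolding S by auto
  have finS: "finite S" using SV finite_subset by blast
  have WU: "W \<subseteq> U" "finite U" using SV unfolding U_def W_def by auto
  define A B where "A = Sigma S (\<lambda>v. snd (F v))" and "B = Sigma ({1..n} - S) (\<lambda>v. snd (F v))"
  have crossing: "{p\<in>W. partner M p \<notin> W} = A" "{p\<in>U - W. partner M p \<in> W} = B" if "M \<in> ?Q" for M
  proof -
    have M: "M \<in> perfect_matchings ({1..n} \<times> {1..\<Delta>})"
      and FM: "\<And>v. v \<in> {1..n} \<Longrightarrow> snd (F v) = {k \<in> {1..\<Delta>}. (fst (partner M (v,k)) \<in> S) \<noteq> (v \<in> S)}"
      using that by auto
    note iff = partner_pts_iff[OF M, of _ _ S]
    have sub: "k \<in> {1..\<Delta>}" if "v \<in> {1..n}" "k \<in> snd (F v)" for v k using F that by blast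
    have mem: "k \<in> snd (F v) \<longleftrightarrow> (fst (partner M (v,k)) \<in> S) \<noteq> (v \<in> S)"
      if "v \<in> {1..n}" "k \<in> {1..\<Delta>}" for v k using FM[OF that(1)] that(2) by simp
    show "{p\<in>W. partner M p \<notin> W} = A"
    proof (rule set_eqI)
      fix p :: "nat \<times> nat"
      obtain v k where p: "p = (v, k)" by (cases p)
      show "p \<in> {p\<in>W. partner M p \<notin> W} \<longleftrightarrow> p \<in> A"
      proof (cases "v \<in> S \<and> k \<in> {1..\<Delta>}")
        case True
        then have "v \<in> {1..n}" "k \<in> {1..\<Delta>}" using SV by auto
        from mem[OF this] iff[OF this] True show ?thesis unfolding p W_def A_def by simp
      next
        case False
        then show ?thesis using sub SV unfolding p W_def A_def by auto
      qed
    qed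
    show "{p\<in>U - W. partner M p \<in> W} = B"
    proof (rule set_eqI)
      fix p :: "nat \<times> nat"
      obtain v k where p: "p = (v, k)" by (cases p)
      show "p \<in> {p\<in>U - W. partner M p \<in> W} \<longleftrightarrow> p \<in> B"
      proof (cases "v \<in> {1..n} - S \<and> k \<in> {1..\<Delta>}")
        case True
        then have "v \<in> {1..n}" "k \<in> {1..\<Delta>}" by auto
        from mem[OF this] iff[OF this] True show ?thesis unfolding p W_def U_def B_def by simp
      next
        case False
        then show ?thesis using sub unfolding p W_def U_def B_def by auto
      qed
    qed
  qed
  \<comment> \<open>All matchings in the set share A, B and the cut size, so one of them suffices to
    read off c and its bounds.\<close>
  obtain M where M: "M \<in> ?Q" using False by blast
  then have M': "M \<in> perfect_matchings U" unfolding U_def by simp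
  define c where "c = card A"
  have cut: "cut_size \<Delta> M' S = c" if "M' \<in> ?Q" for M'
    unfolding cut_size_def c_def crossing(1)[OF that, symmetric] W_def ..
  have c_bd: "real c \<le> hi * card S" "lo * card S \<le> real c" using M cut[OF M] by auto
  have "A = {p\<in>W. partner M p \<in> U - W}"
    unfolding crossing(1)[OF M, symmetric] using partner(3)[OF M'] WU by blast
  then have cB: "card B = c"
    unfolding crossing(2)[OF M, symmetric] c_def using card_crossing_swap[OF M' WU(1), of "U - W"] by simp
  have AW: "A \<subseteq> W" "B \<subseteq> U - W" using crossing[OF M] by auto
  have cW: "card W = \<Delta> * card S" unfolding W_def by (simp add: card_cartesian_product)
  have "U - W = ({1..n} - S) \<times> {1..\<Delta>}" unfolding U_def W_def by auto
  then have cU: "card (U - W) = \<Delta> * (n - card S)"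
    using SV finS by (simp add: card_cartesian_product card_Diff_subset)
  have finW: "finite W" using WU finite_subset by blast
  have cle: "c \<le> \<Delta> * card S" "c \<le> \<Delta> * (n - card S)"
    using card_mono[OF finW AW(1)] card_mono[OF _ AW(2)] WU unfolding c_def[symmetric] cB cW cU by auto
  have sn: "card S \<le> n" using card_mono[OF _ SV] by simp
  have "real (card ?Q) \<le> real (card {M \<in> perfect_matchings U. {p\<in>W. partner M p \<notin> W} = A \<and> {p\<in>U - W. partner M p \<in> W} = B})"
  proof (intro of_nat_mono card_mono)
    show "finite {M \<in> perfect_matchings U. {p\<in>W. partner M p \<notin> W} = A \<and> {p\<in>U - W. partner M p \<in> W} = B}"
      by (rule finite_subset[OF _ finite_perfect_matchings[OF WU(2)]]) blast
    show "?Q \<subseteq> {M \<in> perfect_matchings U. {p\<in>W. partner M p \<notin> W} = A \<and> {p\<in>U - W. partner M p \<in> W} = B}"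
    proof
      fix M' assume M': "M' \<in> ?Q"
      then have "M' \<in> perfect_matchings U" unfolding U_def by simp
      then show "M' \<in> {M \<in> perfect_matchings U. {p\<in>W. partner M p \<notin> W} = A \<and> {p\<in>U - W. partner M p \<in> W} = B}"
        using crossing[OF M'] by simp
    qed
  qed
  also have "\<dots> \<le> real (fact c * pm_count (\<Delta> * card S - c) * pm_count (\<Delta> * (n - card S) - c))"
    using card_matchings_crossing_le[OF WU(2,1) AW] cB cW cU unfolding c_def[symmetric] by (intro of_nat_mono) simp
  also have "\<dots> \<le> exp 1 * (real \<Delta> * n + 1) ^ 3 * exp (n * pairing_rate (\<Delta> / 2) (card S / n) (c / n)) * pm_count (\<Delta> * n)"
    using crossing_product_le[OF n \<Delta> ev cle sn] by simp
  also have "\<dots> \<le> exp 1 * (real \<Delta> * n + 1) ^ 3 * (exp (- e * n) * (x ^ (2 * c) / (2 * half_poly \<Delta> x) ^ n)) * pm_count (\<Delta> * n)"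
  proof (intro mult_right_mono mult_left_mono)
    have p: "2 * half_poly \<Delta> x > 0" using half_poly_pos[OF x] by simp
    have "n * pairing_rate (\<Delta> / 2) (card S / n) (c / n) \<le> n * (- e - ln (2 * half_poly \<Delta> x) + 2 * (c / n) * ln x)"
      using rate[OF c_bd] by (intro mult_left_mono) auto
    also have "\<dots> = - e * n + (real (2 * c) * ln x - n * ln (2 * half_poly \<Delta> x))"
      using n by (simp add: field_simps)
    finally have "exp (n * pairing_rate (\<Delta> / 2) (card S / n) (c / n))
        \<le> exp (- e * n + (real (2 * c) * ln x - n * ln (2 * half_poly \<Delta> x)))" by simp
    also have "\<dots> = exp (- e * n) * (x ^ (2 * c) / (2 * half_poly \<Delta> x) ^ n)"
      unfolding exp_add exp_diff exp_of_nat_mult exp_ln[OF x] exp_ln[OF p] ..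
    finally show "exp (n * pairing_rate (\<Delta> / 2) (card S / n) (c / n)) \<le> exp (- e * n) * (x ^ (2 * c) / (2 * half_poly \<Delta> x) ^ n)" .
  qed auto
  also have "2 * c = (\<Sum>v\<in>{1..n}. card (snd (F v)))"
  proof -
    have finF: "finite (snd (F v))" if "v \<in> {1..n}" for v using F[OF that] finite_subset by blast
    have "card A = (\<Sum>v\<in>S. card (snd (F v)))" unfolding A_def using finS finF SV by (intro card_SigmaI) auto
    moreover have "card B = (\<Sum>v\<in>{1..n} - S. card (snd (F v)))" unfolding B_def using finF by (intro card_SigmaI) auto
    moreover have "(\<Sum>v\<in>{1..n}. card (snd (F v))) = (\<Sum>v\<in>{1..n} - S. card (snd (F v))) + (\<Sum>v\<in>S. card (snd (F v)))"
      by (rule sum.subset_diff[OF SV]) simp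
    ultimately show ?thesis using cB c_def by simp
  qed
  finally show ?thesis by (simp add: mult_ac)
qed

text \<open>Union bound over \<theta> and g, which gives the factors n + 1 and n^\<Delta>, and over
  the assignments of types, whose weights sum to at most 2^\<Delta> after normalisation.\<close>

lemma card_tie_broken_le:
  fixes x lo hi e a :: real
  assumes n: "n > 0" and \<Delta>: "even \<Delta>" "\<Delta> > 0" and x: "x > 0"
    and rate: "\<And>(s::nat) (c::nat). a * n \<le> s \<Longrightarrow> 2 * s \<le> n \<Longrightarrow> real c \<le> hi * s \<Longrightarrow> lo * s \<le> real c \<Longrightarrow>
      pairing_rate (\<Delta> / 2) (s / n) (c / n) + ln (2 * half_poly \<Delta> x) - 2 * (c / n) * ln x \<le> - e"
  shows "real (card {M \<in> perfect_matchings ({1..n} \<times> {1..\<Delta>}).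
     \<exists>S \<theta> g. S \<subseteq> {1..n} \<and> 2 * card S \<le> n \<and> a * n \<le> card S \<and>
      real (cut_size \<Delta> M S) \<le> hi * card S \<and> lo * card S \<le> real (cut_size \<Delta> M S) \<and>
    \<theta> \<le> n \<and> g \<in> {1..\<Delta>} \<rightarrow>\<^sub>E {1..n} \<and>
    (\<forall>v\<in>{1..n}. 2 * cross_deg \<Delta> M S v \<le> \<Delta> \<and>
      (2 * cross_deg \<Delta> M S v = \<Delta> \<longrightarrow> (if v \<in> S then v \<le> \<theta> else \<theta> < v \<or> v \<in> g ` {1..\<Delta>})))})
    \<le> (real n + 1) * real n ^ \<Delta> * 2 ^ \<Delta> * (exp 1 * (real \<Delta> * n + 1) ^ 3 * exp (- e * n)) * pm_count (\<Delta> * n)"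
    (is "real (card ?Bad) \<le> _")
proof -
  define P where "P = perfect_matchings ({1..n} \<times> {1..\<Delta>})"
  have finP: "finite P" unfolding P_def by (simp add: finite_perfect_matchings)
  define Gs where "Gs = {1..\<Delta>} \<rightarrow>\<^sub>E {1..n}"
  have finG: "finite Gs" unfolding Gs_def by (intro finite_PiE) auto
  have cG: "card Gs = n ^ \<Delta>" unfolding Gs_def by (simp add: card_funcsetE)
  define T where "T \<theta> g = PiE {1..n} (allowed_types \<Delta> \<theta> (g ` {1..\<Delta>}))" for \<theta> and g :: "nat \<Rightarrow> nat"
  have finT: "finite (T \<theta> g)" for \<theta> g unfolding T_def by (intro finite_PiE finite_allowed_types) auto
  define SF where "SF F = {v \<in> {1..n}. fst (F v)}" for F :: "nat \<Rightarrow> bool \<times> nat set"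
  define Q where "Q F = {M \<in> P. (2 * card (SF F) \<le> n \<and> a * n \<le> card (SF F)) \<and>
      (\<forall>v\<in>{1..n}. snd (F v) = {k \<in> {1..\<Delta>}. (fst (partner M (v,k)) \<in> SF F) \<noteq> (v \<in> SF F)}) \<and>
      real (cut_size \<Delta> M (SF F)) \<le> hi * card (SF F) \<and> lo * card (SF F) \<le> real (cut_size \<Delta> M (SF F))}" for F
  define C where "C = exp 1 * (real \<Delta> * n + 1) ^ 3 * exp (- e * n) * pm_count (\<Delta> * n)"
  have C: "C \<ge> 0" unfolding C_def by simp
  define I where "I = {..n} \<times> Gs"
  have finI: "finite I" unfolding I_def using finG by simp
  have "?Bad \<subseteq> (\<Union>(\<theta>,g)\<in>I. \<Union>F\<in>T \<theta> g. Q F)"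
  proof
    fix M assume "M \<in> ?Bad"
    then obtain S \<theta> g where M: "M \<in> P" and S: "S \<subseteq> {1..n}" "2 * card S \<le> n" "a * n \<le> card S"
      "real (cut_size \<Delta> M S) \<le> hi * card S" "lo * card S \<le> real (cut_size \<Delta> M S)"
      and \<theta>: "\<theta> \<le> n" and g: "g \<in> Gs"
      and tb: "\<And>v. v \<in> {1..n} \<Longrightarrow> 2 * cross_deg \<Delta> M S v \<le> \<Delta> \<and>
        (2 * cross_deg \<Delta> M S v = \<Delta> \<longrightarrow> (if v \<in> S then v \<le> \<theta> else \<theta> < v \<or> v \<in> g ` {1..\<Delta>}))"
      unfolding P_def Gs_def by blast
    define F where "F = restrict (\<lambda>v. (v \<in> S, {k \<in> {1..\<Delta>}. (fst (partner M (v,k)) \<in> S) \<noteq> (v \<in> S)})) {1..n}"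
    have SFS: "SF F = S" unfolding SF_def F_def using S(1) by auto
    have "F \<in> T \<theta> g"
      unfolding T_def
    proof (rule PiE_I)
      fix v assume v: "v \<in> {1..n}"
      show "F v \<in> allowed_types \<Delta> \<theta> (g ` {1..\<Delta>}) v"
      proof -
        define A where "A = {k \<in> {1..\<Delta>}. (fst (partner M (v,k)) \<in> S) \<noteq> (v \<in> S)}"
        have "F v = (v \<in> S, A)" unfolding F_def A_def using v by simp
        moreover have "A \<subseteq> {1..\<Delta>}" unfolding A_def by blast
        ultimately show ?thesis
          using tb[OF v] unfolding allowed_types_def cross_deg_def A_def[symmetric]
          by (cases "v \<in> S") simp_all
      qed
    qed (simp only: F_def restrict_apply if_False)
    moreover have "M \<in> Q F" unfolding Q_def SFS using M S by (simp add: F_def)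
    moreover have "(\<theta>, g) \<in> I" unfolding I_def using \<theta> g by simp
    ultimately show "M \<in> (\<Union>(\<theta>,g)\<in>I. \<Union>F\<in>T \<theta> g. Q F)" by blast
  qed
  then have "card ?Bad \<le> card (\<Union>(\<theta>,g)\<in>I. \<Union>F\<in>T \<theta> g. Q F)"
    by (rule card_mono[rotated]) (use finI finT finP in \<open>auto simp: Q_def\<close>)
  also have "\<dots> \<le> (\<Sum>i\<in>I. card (case i of (\<theta>,g) \<Rightarrow> \<Union>F\<in>T \<theta> g. Q F))" by (rule card_UN_le[OF finI])
  also have "\<dots> \<le> (\<Sum>i\<in>I. case i of (\<theta>,g) \<Rightarrow> \<Sum>F\<in>T \<theta> g. card (Q F))"
    by (rule sum_mono) (auto intro!: card_UN_le finT split: prod.splits)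
  finally have "real (card ?Bad) \<le> real (\<Sum>i\<in>I. case i of (\<theta>,g) \<Rightarrow> \<Sum>F\<in>T \<theta> g. card (Q F))"
    by (simp only: of_nat_le_iff)
  also have "\<dots> = (\<Sum>i\<in>I. case i of (\<theta>,g) \<Rightarrow> \<Sum>F\<in>T \<theta> g. real (card (Q F)))"
    by (simp add: case_prod_unfold)
  also have "\<dots> \<le> (\<Sum>i\<in>I. C * 2 ^ \<Delta>)"
  proof (rule sum_mono, clarify)
    fix \<theta> :: nat and g :: "nat \<Rightarrow> nat"
    define X where "X = g ` {1..\<Delta>}"
    have cX: "card X \<le> \<Delta>" "finite X" using card_image_le[of "{1..\<Delta>}" g] unfolding X_def by auto
    have hp: "2 * half_poly \<Delta> x > 0" using half_poly_pos[OF x] by simp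
    have "(\<Sum>F\<in>T \<theta> g. real (card (Q F)))
        \<le> (\<Sum>F\<in>T \<theta> g. C * (x ^ (\<Sum>v\<in>{1..n}. card (snd (F v))) / (2 * half_poly \<Delta> x) ^ n))"
    proof (rule sum_mono)
      fix F assume F: "F \<in> T \<theta> g"
      show "real (card (Q F)) \<le> C * (x ^ (\<Sum>v\<in>{1..n}. card (snd (F v))) / (2 * half_poly \<Delta> x) ^ n)"
      proof (cases "2 * card (SF F) \<le> n \<and> a * n \<le> card (SF F)")
        case True
        have sub: "snd (F v) \<subseteq> {1..\<Delta>}" if "v \<in> {1..n}" for v
          using PiE_mem[OF F[unfolded T_def] that] unfolding allowed_types_def by auto
        have r: "pairing_rate (\<Delta> / 2) (card (SF F) / n) (c / n) + ln (2 * half_poly \<Delta> x) - 2 * (c / n) * ln x \<le> - e"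
          if "real c \<le> hi * card (SF F)" "lo * card (SF F) \<le> real c" for c
          using rate[of "card (SF F)" c] True that by simp
        have ev: "even (\<Delta> * n)" using \<Delta>(1) by simp
        have "card (Q F) = card {M \<in> perfect_matchings ({1..n} \<times> {1..\<Delta>}).
            (\<forall>v\<in>{1..n}. snd (F v) = {k \<in> {1..\<Delta>}. (fst (partner M (v,k)) \<in> SF F) \<noteq> (v \<in> SF F)}) \<and>
            real (cut_size \<Delta> M (SF F)) \<le> hi * card (SF F) \<and> lo * card (SF F) \<le> real (cut_size \<Delta> M (SF F))}"
          unfolding Q_def P_def using True by simp
        then show ?thesis
          using card_typed_matchings_le[OF n \<Delta>(2) ev x sub SF_def r] unfolding C_def by simp
      next
        case False
        then show ?thesis unfolding Q_def using C x hp by auto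
      qed
    qed
    also have "\<dots> = C * ((\<Sum>F\<in>T \<theta> g. x ^ (\<Sum>v\<in>{1..n}. card (snd (F v)))) / (2 * half_poly \<Delta> x) ^ n)"
      by (simp add: sum_distrib_left sum_divide_distrib)
    also have "\<dots> \<le> C * 2 ^ \<Delta>"
    proof (rule mult_left_mono[OF _ C])
      have "(\<Sum>F\<in>T \<theta> g. x ^ (\<Sum>v\<in>{1..n}. card (snd (F v)))) \<le> 2 ^ card X * (2 * half_poly \<Delta> x) ^ n"
        unfolding T_def X_def[symmetric] by (rule sum_PiE_allowed_types_le[OF \<Delta>(1) x cX(2)])
      also have "\<dots> \<le> 2 ^ \<Delta> * (2 * half_poly \<Delta> x) ^ n"
        using cX(1) hp by (intro mult_right_mono power_increasing) auto
      finally show "(\<Sum>F\<in>T \<theta> g. x ^ (\<Sum>v\<in>{1..n}. card (snd (F v)))) / (2 * half_poly \<Delta> x) ^ n \<le> 2 ^ \<Delta>"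
        using hp by (simp add: divide_le_eq)
    qed
    finally show "(\<Sum>F\<in>T \<theta> g. real (card (Q F))) \<le> C * 2 ^ \<Delta>" .
  qed
  also have "\<dots> = (real n + 1) * real n ^ \<Delta> * 2 ^ \<Delta> * (exp 1 * (real \<Delta> * n + 1) ^ 3 * exp (- e * n)) * pm_count (\<Delta> * n)"
    unfolding I_def C_def by (simp add: card_cartesian_product cG algebra_simps)
  finally show ?thesis .
qed

section \<open>The rate function and its root\<close>

text \<open>Gibbs' inequality for a single summand. In the sum the corrections w - y cancel when
  both vectors have the same total.\<close>

lemma weighted_log_le:
  fixes y b w :: real
  assumes "y \<ge> 0" "b > 0" "w > 0"
  shows "y * ln (b / y) \<le> y * ln (b / w) + w - y"
proof (cases "y = 0")
  case False
  then have y: "y > 0" using assms by simp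
  have "ln (w / y) \<le> w / y - 1" using ln_le_minus_one[of "w / y"] assms y by simp
  then have "y * ln (w / y) \<le> y * (w / y - 1)" using y by (intro mult_left_mono) auto
  then have "y * (ln w - ln y) \<le> w - y" using y assms by (simp add: ln_div right_diff_distrib)
  then show ?thesis using y assms by (simp add: ln_div algebra_simps)
qed (use assms in simp)

text \<open>Lagrange duality: the maximum is attained at the geometric tilt \<open>y i = a b i x^i / p\<close> of the
  weights, where \<open>x\<close> is chosen such that the mean constraint holds.\<close>

lemma Phi_star_eq:
  fixes a c x :: real and b :: "nat \<Rightarrow> real"
  assumes b: "\<And>i. i \<le> T \<Longrightarrow> b i > 0" and x: "x > 0" and a: "a > 0"
    and p: "p = (\<Sum>i\<le>T. b i * x ^ i)" and mean: "(\<Sum>i\<le>T. real i * (b i * x ^ i)) * a = c * p"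
  shows "Phi_star T a c b = a * ln (p / a) - c * ln x"
proof -
  define w where "w i = a * (b i * x ^ i) / p" for i
  have pp: "p > 0" unfolding p by (intro sum_pos) (use b x in auto)
  have w: "w i > 0" if "i \<le> T" for i unfolding w_def using b[OF that] x a pp by simp
  have sw: "(\<Sum>i\<le>T. w i) = a"
    unfolding w_def using pp by (simp add: sum_divide_distrib[symmetric] sum_distrib_left[symmetric] p[symmetric])
  have "(\<Sum>i\<le>T. real i * w i) = (\<Sum>i\<le>T. real i * (b i * x ^ i)) * a / p"
    unfolding w_def sum_distrib_right sum_divide_distrib by (rule sum.cong) (auto simp: mult_ac)
  then have mw: "(\<Sum>i\<le>T. real i * w i) = c" unfolding mean using pp by simp
  have lnw: "ln (b i / w i) = ln (p / a) - real i * ln x" if "i \<le> T" for i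
  proof -
    have "b i / w i = (p / a) / x ^ i" unfolding w_def using b[OF that] x a pp by (simp add: field_simps)
    then show ?thesis using x a pp by (simp add: ln_div ln_mult ln_realpow)
  qed
  have tot: "(\<Sum>i\<le>T. y i * (ln (p / a) - real i * ln x)) = a * ln (p / a) - c * ln x"
    if "(\<Sum>i\<le>T. y i) = a" "(\<Sum>i\<le>T. real i * y i) = c" for y
  proof -
    have "(\<Sum>i\<le>T. y i * (ln (p / a) - real i * ln x)) = (\<Sum>i\<le>T. y i) * ln (p / a) - (\<Sum>i\<le>T. real i * y i) * ln x"
      unfolding sum_distrib_right sum_subtractf[symmetric] by (rule sum.cong) (auto simp: algebra_simps)
    then show ?thesis unfolding that .
  qed
  define Z where "Z = {(\<Sum>i\<le>T. y i * ln (b i / y i)) | y. (\<forall>i\<le>T. y i \<ge> 0) \<and> (\<Sum>i\<le>T. y i) = a \<and> (\<Sum>i\<le>T. real i * y i) = c}"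
  have "Phi_star T a c b = (GREATEST z. z \<in> Z)" unfolding Phi_star_def Z_def ..
  also have "\<dots> = a * ln (p / a) - c * ln x"
  proof (rule Greatest_equality)
    have "(\<Sum>i\<le>T. w i * ln (b i / w i)) = (\<Sum>i\<le>T. w i * (ln (p / a) - real i * ln x))"
      by (rule sum.cong) (auto simp: lnw)
    also have "\<dots> = a * ln (p / a) - c * ln x" by (rule tot[OF sw mw])
    finally show "a * ln (p / a) - c * ln x \<in> Z"
      unfolding Z_def by (intro CollectI exI[of _ w] conjI allI impI) (simp_all add: sw mw less_imp_le w)
  next
    fix z assume "z \<in> Z"
    then obtain y where y: "z = (\<Sum>i\<le>T. y i * ln (b i / y i))" "\<And>i. i \<le> T \<Longrightarrow> y i \<ge> 0"
      "(\<Sum>i\<le>T. y i) = a" "(\<Sum>i\<le>T. real i * y i) = c" unfolding Z_def by blast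
    have "z \<le> (\<Sum>i\<le>T. y i * ln (b i / w i) + w i - y i)"
      unfolding y(1) by (intro sum_mono weighted_log_le) (use y b w in auto)
    also have "\<dots> = (\<Sum>i\<le>T. y i * ln (b i / w i)) + (\<Sum>i\<le>T. w i) - (\<Sum>i\<le>T. y i)"
      by (simp add: sum.distrib sum_subtractf)
    also have "\<dots> = (\<Sum>i\<le>T. y i * (ln (p / a) - real i * ln x))"
      unfolding sw y(3) by (simp add: lnw cong: sum.cong_simp)
    also have "\<dots> = a * ln (p / a) - c * ln x" by (rule tot[OF y(3,4)])
    finally show "z \<le> a * ln (p / a) - c * ln x" .
  qed
  finally show ?thesis .
qed

text \<open>The bounds on c say that the arguments of \<open>xlnx\<close> are nonnegative; they are
  affine in the pair (a, c), so joint convexity is inherited from \<open>xlnx\<close>.\<close>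

lemma pairing_rate_convex:
  assumes u: "0 \<le> u" "u \<le> 1" and d: "d \<ge> 0"
    and 1: "0 \<le> c" "c \<le> 2 * d * a" "c \<le> 2 * d * (1 - a)"
    and 2: "0 \<le> c'" "c' \<le> 2 * d * a'" "c' \<le> 2 * d * (1 - a')"
  shows "pairing_rate d ((1 - u) * a + u * a') ((1 - u) * c + u * c')
    \<le> (1 - u) * pairing_rate d a c + u * pairing_rate d a' c'"
proof -
  have cv: "xlnx ((1 - u) * s + u * t) \<le> (1 - u) * xlnx s + u * xlnx t" if "s \<ge> 0" "t \<ge> 0" for s t
    using convex_onD[OF convex_on_xlnx u, of s t] that by simp
  have e: "2 * d * ((1 - u) * a + u * a') - ((1 - u) * c + u * c') = (1 - u) * (2 * d * a - c) + u * (2 * d * a' - c')"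
    "2 * d * (1 - ((1 - u) * a + u * a')) - ((1 - u) * c + u * c') = (1 - u) * (2 * d * (1 - a) - c) + u * (2 * d * (1 - a') - c')"
    by (simp_all add: algebra_simps)
  have "pairing_rate d ((1 - u) * a + u * a') ((1 - u) * c + u * c')
      \<le> ((1 - u) * xlnx c + u * xlnx c') + ((1 - u) * xlnx (2 * d * a - c) + u * xlnx (2 * d * a' - c')) / 2
        + ((1 - u) * xlnx (2 * d * (1 - a) - c) + u * xlnx (2 * d * (1 - a') - c')) / 2 - xlnx (2 * d) / 2"
    unfolding pairing_rate_def e using 1 2
    by (intro diff_right_mono add_mono divide_right_mono cv) auto
  also have "\<dots> = (1 - u) * pairing_rate d a c + u * pairing_rate d a' c'"
    unfolding pairing_rate_def by (simp add: field_simps)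
  finally show ?thesis .
qed

text \<open>\<open>P1\<close> and \<open>P2\<close> are the first two derivatives of the weight
  polynomial. \<open>variance\<close> makes the mean crossing degree increasing in the tilt, X is a
  tilt where this mean has passed \<Delta>/4, and x1, x2 are to enclose the root.
  \<open>below_quarter\<close> is, after clearing denominators, the sign condition for the
  derivative of \<open>K\<close>.\<close>

locale half_profile =
  fixes \<Delta> :: nat and P1 P2 :: "real \<Rightarrow> real" and X x1 x2 :: real
  assumes \<Delta>: "even \<Delta>" "\<Delta> \<ge> 4"
    and P1: "\<And>x. (half_poly \<Delta> has_real_derivative P1 x) (at x)"
    and P2: "\<And>x. (P1 has_real_derivative P2 x) (at x)"
    and P1_pos: "\<And>x. x \<ge> 0 \<Longrightarrow> P1 x > 0"
    and mean: "\<And>x. (\<Sum>i\<le>\<Delta> div 2. real i * (half_binom \<Delta> i * x ^ i)) = x * P1 x"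
    and variance: "\<And>x. x > 0 \<Longrightarrow> x * P1 x * P1 x < (P1 x + x * P2 x) * half_poly \<Delta> x"
    and X: "0 < x1" "x1 < x2" "x2 < X" "X \<le> 1" "X * P1 X * 4 \<ge> \<Delta> * half_poly \<Delta> X"
    and x2_quarter: "x2 * P1 x2 * 4 < \<Delta> * half_poly \<Delta> x2"
    and below_quarter: "\<And>x::real. 0 < x \<Longrightarrow> x < X \<Longrightarrow> x * P1 x * 4 < \<Delta> * half_poly \<Delta> x \<Longrightarrow>
        \<Delta> * x * half_poly \<Delta> x < P1 x * (1 + x\<^sup>2)"
begin

abbreviation P :: "real \<Rightarrow> real" where "P \<equiv> half_poly \<Delta>"

text \<open>The mean of i under weights proportional to b_i x^i. Crossing degrees sum to twice the
  cut, so for |S| = n/2 this mean equals the expansion of S.\<close>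

definition \<mu> :: "real \<Rightarrow> real" where "\<mu> x = x * P1 x / P x"

definition K :: "real \<Rightarrow> real" where
  "K x = pairing_rate (\<Delta> / 2) (1 / 2) (\<mu> x / 2) + ln (2 * P x) - \<mu> x * ln x"

lemma P_pos: "x \<ge> 0 \<Longrightarrow> P x > 0"
  unfolding half_poly_def half_binom_def
proof -
  assume x: "x \<ge> 0"
  have "0 < (\<Sum>i\<in>{0}. (if i = \<Delta> div 2 then real (\<Delta> choose i) / 2 else real (\<Delta> choose i)) * x ^ i)" by simp
  also have "\<dots> \<le> (\<Sum>i\<le>\<Delta> div 2. (if i = \<Delta> div 2 then real (\<Delta> choose i) / 2 else real (\<Delta> choose i)) * x ^ i)"
    using x by (intro sum_mono2) auto
  finally show "0 < (\<Sum>i\<le>\<Delta> div 2. (if i = \<Delta> div 2 then real (\<Delta> choose i) / 2 else real (\<Delta> choose i)) * x ^ i)" .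
qed

lemma \<mu>_deriv:
  assumes "x \<ge> 0"
  shows "(\<mu> has_real_derivative ((P1 x + x * P2 x) * P x - x * P1 x * P1 x) / (P x * P x)) (at x)"
proof -
  have "((\<lambda>x. x * P1 x) has_real_derivative (P1 x + x * P2 x)) (at x)"
    by (rule derivative_eq_intros P2 refl | simp)+
  from DERIV_divide[OF this P1] show ?thesis
    unfolding \<mu>_def[abs_def] using P_pos[OF assms] by simp
qed

text \<open>Up to the factor x the derivative is the variance of the tilted distribution.\<close>

lemma \<mu>_strict_mono:
  assumes "0 \<le> x" "x < y"
  shows "\<mu> x < \<mu> y"
proof (rule DERIV_pos_imp_increasing_open[OF assms(2)])
  fix z assume z: "x < z" "z < y"
  then have z0: "z > 0" using assms by simp
  show "\<exists>D. (\<mu> has_real_derivative D) (at z) \<and> D > 0"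
    using \<mu>_deriv[of z] z0 variance[OF z0] P_pos[of z]
    by (intro exI[of _ "((P1 z + z * P2 z) * P z - z * P1 z * P1 z) / (P z * P z)"]) simp
next
  show "continuous_on {x..y} \<mu>"
    using \<mu>_deriv assms by (intro continuous_at_imp_continuous_on ballI) (meson DERIV_isCont atLeastAtMost_iff order.trans)
qed

lemma \<mu>_0: "\<mu> 0 = 0" by (simp add: \<mu>_def)

lemma \<mu>_pos: "x > 0 \<Longrightarrow> \<mu> x > 0" using \<mu>_strict_mono[of 0 x] \<mu>_0 by simp

lemma \<mu>_X: "\<mu> X \<ge> \<Delta> / 4" and \<mu>_x2: "\<mu> x2 < \<Delta> / 4"
  using X x2_quarter P_pos[of X] P_pos[of x2] unfolding \<mu>_def by (simp_all add: field_simps)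

text \<open>The derivative of ln P cancels against that of ln x, because \<mu>/x = P'/P: the tilt is
  a stationary point of the dual problem. Only the derivative with respect to the mean
  remains.\<close>

lemma K_deriv:
  assumes x: "x > 0" and q: "\<mu> x < \<Delta> / 4"
  defines "D \<equiv> ((P1 x + x * P2 x) * P x - x * P1 x * P1 x) / (P x * P x)"
  shows "(K has_real_derivative (D / 2 * (ln (\<mu> x / 2) - ln (\<Delta> / 2 - \<mu> x / 2) - 2 * ln x))) (at x)"
proof -
  have \<mu>0: "\<mu> x > 0" by (rule \<mu>_pos[OF x])
  have m: "(\<mu> has_real_derivative D) (at x)" unfolding D_def using \<mu>_deriv[of x] x by simp
  have xl: "((\<lambda>x. xlnx (f x)) has_real_derivative (ln (f x) + 1) * f') (at x)"
    if "(f has_real_derivative f') (at x)" "f x > 0" for f f'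
  proof -
    have "(xlnx has_real_derivative (ln (f x) + 1)) (at (f x))"
      unfolding xlnx_def[abs_def] using that(2) by (auto intro!: derivative_eq_intros)
    from DERIV_chain2[OF this that(1)] show ?thesis .
  qed
  have d1: "((\<lambda>x. \<mu> x / 2) has_real_derivative D / 2) (at x)" by (rule DERIV_cdivide[OF m])
  have d2: "((\<lambda>x. \<Delta> / 2 - \<mu> x / 2) has_real_derivative - (D / 2)) (at x)"
    using DERIV_diff[OF DERIV_const d1, of "\<Delta> / 2"] by simp
  have a: "((\<lambda>x. xlnx (\<mu> x / 2)) has_real_derivative (ln (\<mu> x / 2) + 1) * (D / 2)) (at x)"
    by (rule xl[OF d1]) (use \<mu>0 in simp)
  have b: "((\<lambda>x. xlnx (\<Delta> / 2 - \<mu> x / 2)) has_real_derivative (ln (\<Delta> / 2 - \<mu> x / 2) + 1) * - (D / 2)) (at x)"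
    by (rule xl[OF d2]) (use q \<mu>0 in simp)
  have c: "((\<lambda>x. ln (2 * P x)) has_real_derivative P1 x / P x) (at x)"
    using P_pos[of x] x by (auto intro!: derivative_eq_intros P1)
  have e: "((\<lambda>x. \<mu> x * ln x) has_real_derivative D * ln x + \<mu> x * (1 / x)) (at x)"
    using DERIV_mult[OF m DERIV_ln_divide[OF x]] by (simp add: algebra_simps)
  have Ke: "K = (\<lambda>x. xlnx (\<mu> x / 2) + xlnx (\<Delta> / 2 - \<mu> x / 2) - xlnx \<Delta> / 2 + ln (2 * P x) - \<mu> x * ln x)"
    unfolding K_def[abs_def] pairing_rate_def by (simp add: fun_eq_iff)
  have "(K has_real_derivative (ln (\<mu> x / 2) + 1) * (D / 2) + (ln (\<Delta> / 2 - \<mu> x / 2) + 1) * - (D / 2) - 0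
      + P1 x / P x - (D * ln x + \<mu> x * (1 / x))) (at x)"
    unfolding Ke by (intro DERIV_diff DERIV_add a b c e DERIV_const)
  moreover have "\<mu> x * (1 / x) = P1 x / P x" unfolding \<mu>_def using x by simp
  ultimately show ?thesis by (simp add: algebra_simps)
qed

text \<open>\<open>below_quarter\<close> amounts to (\<Delta>/2 - \<mu>/2) x^2 < \<mu>/2, which says
  that the logarithmic factor in the derivative is positive. The bound on \<mu> keeps the argument
  below X.\<close>

lemma K_strict_mono:
  assumes "0 < x" "x < y" "\<mu> y < \<Delta> / 4"
  shows "K x < K y"
proof (rule DERIV_pos_imp_increasing[OF assms(2)])
  fix z assume z: "x \<le> z" "z \<le> y"
  then have z0: "z > 0" using assms by simp
  have "\<mu> z \<le> \<mu> y" using \<mu>_strict_mono[of z y] z z0 by (cases "z = y") auto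
  then have q: "\<mu> z < \<Delta> / 4" using assms by simp
  have "z < X"
  proof (rule ccontr)
    assume "\<not> z < X"
    then have "\<mu> X \<le> \<mu> z" using \<mu>_strict_mono[of X z] X by (cases "X = z") auto
    then show False using q \<mu>_X by simp
  qed
  have Pz: "P z > 0" using P_pos z0 by simp
  have "z * P1 z * 4 < \<Delta> * P z" using q Pz unfolding \<mu>_def by (simp add: field_simps)
  from below_quarter[OF z0 \<open>z < X\<close> this] have "z * (\<Delta> * z * P z) < z * (P1 z * (1 + z\<^sup>2))"
    using z0 by (intro mult_strict_left_mono)
  then have "\<Delta> * z\<^sup>2 < \<mu> z * (1 + z\<^sup>2)" using Pz unfolding \<mu>_def by (simp add: field_simps power2_eq_square)
  then have "(\<Delta> / 2 - \<mu> z / 2) * z\<^sup>2 < \<mu> z / 2" by (simp add: field_simps)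
  then have "ln ((\<Delta> / 2 - \<mu> z / 2) * z\<^sup>2) < ln (\<mu> z / 2)"
    using z0 q \<mu>_pos[OF z0] by (subst ln_less_cancel_iff) auto
  then have "0 < ln (\<mu> z / 2) - ln (\<Delta> / 2 - \<mu> z / 2) - 2 * ln z"
    using z0 q \<mu>_pos[OF z0] by (simp add: ln_mult ln_realpow)
  moreover have "0 < ((P1 z + z * P2 z) * P z - z * P1 z * P1 z) / (P z * P z)"
    using variance[OF z0] Pz by simp
  ultimately have "0 < ((P1 z + z * P2 z) * P z - z * P1 z * P1 z) / (P z * P z) / 2
      * (ln (\<mu> z / 2) - ln (\<Delta> / 2 - \<mu> z / 2) - 2 * ln z)"
    by (intro mult_pos_pos half_gt_zero)
  then show "\<exists>D. (K has_real_derivative D) (at z) \<and> D > 0"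
    using K_deriv[OF z0 q] by blast
qed

text \<open>At the mean \<mu> x the optimal tilt is x itself, and twice the maximum equals ln(2
  P(x)) - \<mu>(x) ln x, the last two terms of \<open>K\<close>.\<close>

lemma H_\<mu>:
  assumes x: "x > 0"
  shows "H \<Delta> (\<mu> x / 2) = K x"
proof -
  have "Phi_star (\<Delta> div 2) (1 / 2) (\<mu> x / 2) (half_binom \<Delta>) = 1 / 2 * ln (P x / (1 / 2)) - \<mu> x / 2 * ln x"
  proof (rule Phi_star_eq)
    show "P x = (\<Sum>i\<le>\<Delta> div 2. half_binom \<Delta> i * x ^ i)" by (simp add: half_poly_def)
    show "(\<Sum>i\<le>\<Delta> div 2. real i * (half_binom \<Delta> i * x ^ i)) * (1 / 2) = \<mu> x / 2 * P x"
      unfolding mean \<mu>_def using P_pos[of x] x by simp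
  qed (use x in \<open>auto simp: half_binom_def\<close>)
  then show ?thesis unfolding H_def K_def pairing_rate_def by (simp add: xlnx_def algebra_simps)
qed

lemma \<mu>_surj:
  assumes "0 < v" "v < \<Delta> / 4"
  obtains x where "0 < x" "\<mu> x = v"
proof -
  have "\<exists>x\<ge>0. x \<le> X \<and> \<mu> x = v"
  proof (rule IVT)
    show "\<forall>x. 0 \<le> x \<and> x \<le> X \<longrightarrow> isCont \<mu> x" using \<mu>_deriv DERIV_isCont by blast
  qed (use assms \<mu>_X \<mu>_0 X in auto)
  then obtain x where x: "0 \<le> x" "\<mu> x = v" by blast
  then have "0 < x" using assms \<mu>_0 by (cases "x = 0") auto
  then show ?thesis using that x(2) by simp
qed

end

locale half_profile_root = half_profile +
  assumes K_x1: "K x1 < 0" and K_x2: "K x2 > 0"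
begin

lemma root_exists: "\<exists>x. x1 < x \<and> x < x2 \<and> K x = 0"
proof -
  have "\<exists>x\<ge>x1. x \<le> x2 \<and> K x = 0"
  proof (rule IVT)
    show "\<forall>x. x1 \<le> x \<and> x \<le> x2 \<longrightarrow> isCont K x"
    proof (intro allI impI)
      fix x assume x: "x1 \<le> x \<and> x \<le> x2"
      then have "\<mu> x \<le> \<mu> x2" using \<mu>_strict_mono[of x x2] X by (cases "x = x2") auto
      then show "isCont K x" using K_deriv[of x] x X \<mu>_x2 DERIV_isCont by force
    qed
  qed (use K_x1 K_x2 X in auto)
  then obtain x where "x1 \<le> x" "x \<le> x2" "K x = 0" by blast
  then show ?thesis using K_x1 K_x2 by (intro exI[of _ x]) (auto simp: order_less_le)
qed

definition root :: real where "root = (SOME x. x1 < x \<and> x < x2 \<and> K x = 0)"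

lemma root: "x1 < root" "root < x2" "K root = 0"
  using someI_ex[OF root_exists] unfolding root_def by auto

lemma \<mu>_root: "\<mu> x1 < \<mu> root" "\<mu> root < \<mu> x2" "0 < \<mu> root" "\<mu> root < \<Delta> / 4"
  using \<mu>_strict_mono[of x1 root] \<mu>_strict_mono[of root x2] \<mu>_pos[of root] \<mu>_x2 root X by auto

lemma unique_root:
  assumes "0 < v" "v < \<Delta> / 4" "H \<Delta> (v / 2) = 0"
  shows "v = \<mu> root"
proof -
  obtain x where x: "0 < x" "\<mu> x = v" using \<mu>_surj[OF assms(1,2)] .
  have "K x = 0" using H_\<mu>[OF x(1)] x(2) assms(3) by simp
  then have "\<not> x < root" "\<not> root < x"
    using K_strict_mono[of x root] K_strict_mono[of root x] x assms(2) root \<mu>_root X by auto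
  then show ?thesis using x by auto
qed

lemma H_root: "H \<Delta> (\<mu> root / 2) = 0"
  using H_\<mu>[of root] root X by simp

lemma ex1_root: "\<exists>!v::real. 0 < v \<and> v < real \<Delta> / 4 \<and> H \<Delta> (v / 2) = 0"
proof (rule ex1I)
  show "0 < \<mu> root \<and> \<mu> root < real \<Delta> / 4 \<and> H \<Delta> (\<mu> root / 2) = 0"
    by (intro conjI \<mu>_root(3,4) H_root)
  fix v assume "0 < v \<and> v < real \<Delta> / 4 \<and> H \<Delta> (v / 2) = 0"
  then show "v = \<mu> root" by (elim conjE) (rule unique_root)
qed

lemma nu_star_eq: "nu_star \<Delta> = \<mu> root"
  unfolding nu_star_def
proof (rule the_equality)
  show "0 < \<mu> root \<and> \<mu> root < real \<Delta> / 4 \<and> H \<Delta> (\<mu> root / 2) = 0"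
    by (intro conjI \<mu>_root(3,4) H_root)
  fix v assume "0 < v \<and> v < real \<Delta> / 4 \<and> H \<Delta> (v / 2) = 0"
  then show "v = \<mu> root" by (elim conjE) (rule unique_root)
qed

end

text \<open>\<open>rate1\<close> excludes cuts up to (1 - t1) \<Delta>|S| for all sizes up to n/2;
  \<open>rate2\<close> excludes cuts up to (1 - t2) \<Delta>|S|, a bound above \<nu>*, for sizes up
  to 2n/5. The corners are the remaining density range 2/5 to 1/2 combined with these two slopes,
  except for the one at density 1/2 and the larger slope: there the root itself supplies the value
  0.\<close>

locale half_profile_bounds = half_profile_root +
  fixes t1 t2 :: real
  assumes t: "3 / 4 \<le> t2" "t2 \<le> t1" "t1 < 1"
    and rate1: "small_cut_rate (\<Delta> / 2) t1 (1 / 2) < 0"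
    and rate2: "small_cut_rate (\<Delta> / 2) t2 (2 / 5) < 0"
    and \<mu>_bounds: "(1 - t1) * \<Delta> < \<mu> x1" "\<mu> x2 \<le> (1 - t2) * \<Delta>" "(1 - t2) * \<Delta> < 2"
    and corner1: "pairing_rate (\<Delta> / 2) (2 / 5) ((1 - t1) * \<Delta> * (2 / 5)) + ln (2 * P x2) - 2 * ((1 - t1) * \<Delta> * (2 / 5)) * ln x1 < 0"
    and corner2: "pairing_rate (\<Delta> / 2) (1 / 2) ((1 - t1) * \<Delta> * (1 / 2)) + ln (2 * P x2) - 2 * ((1 - t1) * \<Delta> * (1 / 2)) * ln x1 < 0"
    and corner3: "pairing_rate (\<Delta> / 2) (2 / 5) ((1 - t2) * \<Delta> * (2 / 5)) + ln (2 * P x2) - 2 * ((1 - t2) * \<Delta> * (2 / 5)) * ln x1 \<le> 0"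
begin

definition lo :: real where "lo = (1 - t1) * \<Delta>"
definition hi :: real where "hi = (1 - t2) * \<Delta>"
definition B :: "real \<Rightarrow> real \<Rightarrow> real" where
  "B a c = pairing_rate (\<Delta> / 2) a c + ln (2 * P root) - 2 * c * ln root"

lemma lo_hi: "0 < lo" "lo < \<mu> root" "\<mu> root < hi" "hi < 2"
  using t \<Delta> \<mu>_bounds \<mu>_root unfolding lo_def hi_def by auto

text \<open>The root is known only to lie between x1 and x2. Replacing it by the unfavourable end in
  each term leaves explicit numbers to check.\<close>

lemma B_le:
  assumes "c \<ge> 0"
  shows "B a c \<le> pairing_rate (\<Delta> / 2) a c + ln (2 * P x2) - 2 * c * ln x1"
proof -
  have "P root \<le> P x2"
  proof (rule DERIV_nonneg_imp_nondecreasing[of root x2 P])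
    fix x assume "root \<le> x" "x \<le> x2"
    then show "\<exists>y. (P has_real_derivative y) (at x) \<and> 0 \<le> y"
      using P1 P1_pos[of x] root X by (intro exI[of _ "P1 x"]) auto
  qed (use root in simp)
  then have "ln (2 * P root) \<le> ln (2 * P x2)"
    using P_pos[of root] root X by (subst ln_le_cancel_iff) auto
  moreover have "ln x1 \<le> ln root" using root X by simp
  then have "2 * c * ln x1 \<le> 2 * c * ln root" using assms by (intro mult_left_mono) auto
  ultimately show ?thesis unfolding B_def by linarith
qed

lemma B_convex:
  assumes u: "0 \<le> u" "u \<le> 1"
    and 1: "0 \<le> a" "a \<le> 1 / 2" "0 \<le> c" "c \<le> 2 * a"
    and 2: "0 \<le> a'" "a' \<le> 1 / 2" "0 \<le> c'" "c' \<le> 2 * a'"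
  shows "B ((1 - u) * a + u * a') ((1 - u) * c + u * c') \<le> (1 - u) * B a c + u * B a' c'"
proof -
  have dom: "c \<le> 2 * (\<Delta> / 2) * a" "c \<le> 2 * (\<Delta> / 2) * (1 - a)" if "0 \<le> a" "a \<le> 1 / 2" "c \<le> 2 * a" for a c :: real
  proof -
    have "4 * a \<le> \<Delta> * a" using that \<Delta> by (intro mult_right_mono) auto
    then show "c \<le> 2 * (\<Delta> / 2) * a" using that by simp
    have "4 * (1 - a) \<le> \<Delta> * (1 - a)" using that \<Delta> by (intro mult_right_mono) auto
    then show "c \<le> 2 * (\<Delta> / 2) * (1 - a)" using that by simp
  qed
  have "pairing_rate (\<Delta> / 2) ((1 - u) * a + u * a') ((1 - u) * c + u * c')
      \<le> (1 - u) * pairing_rate (\<Delta> / 2) a c + u * pairing_rate (\<Delta> / 2) a' c'"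
    by (rule pairing_rate_convex) (use u 1 2 dom[of a c] dom[of a' c'] in auto)
  then show ?thesis unfolding B_def by (simp add: algebra_simps)
qed

text \<open>Along a ray c = l a the pair (a, c) is affine in a, so the two ends of the density range
  decide.\<close>

lemma B_convex_a:
  assumes a: "2 / 5 \<le> a" "a \<le> 1 / 2" and l: "0 \<le> l" "l \<le> 2"
    and 1: "B (2 / 5) (l * (2 / 5)) \<le> z" and 2: "B (1 / 2) (l * (1 / 2)) \<le> z"
  shows "B a (l * a) \<le> z"
proof -
  define u where "u = 10 * a - 4"
  have u: "0 \<le> u" "u \<le> 1" using a unfolding u_def by auto
  have e: "a = (1 - u) * (2 / 5) + u * (1 / 2)" unfolding u_def by (simp add: field_simps)
  have "B ((1 - u) * (2 / 5) + u * (1 / 2)) ((1 - u) * (l * (2 / 5)) + u * (l * (1 / 2)))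
      \<le> (1 - u) * B (2 / 5) (l * (2 / 5)) + u * B (1 / 2) (l * (1 / 2))"
    by (rule B_convex[OF u]) (use l in auto)
  also have "\<dots> \<le> (1 - u) * z + u * z" using u 1 2 by (intro add_mono mult_left_mono) auto
  also have "\<dots> = z" by (simp add: algebra_simps)
  also have "(1 - u) * (l * (2 / 5)) + u * (l * (1 / 2)) = l * a" unfolding e by (simp add: algebra_simps)
  finally show ?thesis unfolding e[symmetric] .
qed

lemma B_convex_c:
  assumes a: "2 / 5 \<le> a" "a \<le> 1 / 2" and l: "0 \<le> l" "l < l'" "l' \<le> 2" and c: "l * a \<le> c" "c \<le> l' * a"
  defines "u \<equiv> (c / a - l) / (l' - l)"
  shows "0 \<le> u" "u \<le> 1" "B a c \<le> (1 - u) * B a (l * a) + u * B a (l' * a)"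
proof -
  have a0: "a > 0" using a by simp
  have ca: "l \<le> c / a" "c / a \<le> l'" using c a0 by (simp_all add: pos_le_divide_eq pos_divide_le_eq)
  show u: "0 \<le> u" "u \<le> 1" using ca l unfolding u_def by (auto simp: divide_le_eq)
  have "u * (l' - l) = c / a - l" using l unfolding u_def by simp
  then have "c / a = (1 - u) * l + u * l'" by (simp add: algebra_simps)
  then have "c = ((1 - u) * l + u * l') * a" using a0 by (simp add: field_simps)
  then have e: "c = (1 - u) * (l * a) + u * (l' * a)" by (simp add: algebra_simps)
  have "l * a \<le> 2 * a" "l' * a \<le> 2 * a" using l a0 by auto
  then have "B ((1 - u) * a + u * a) ((1 - u) * (l * a) + u * (l' * a)) \<le> (1 - u) * B a (l * a) + u * B a (l' * a)"
    by (intro B_convex[OF u]) (use l a in auto)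
  moreover have "(1 - u) * a + u * a = a" by (simp add: algebra_simps)
  ultimately show "B a c \<le> (1 - u) * B a (l * a) + u * B a (l' * a)" unfolding e[symmetric] by simp
qed

text \<open>The slice \<open>c = \<mu> root * a\<close> is only nonpositive, with value \<open>0\<close> at \<open>a = 1/2\<close>; convexity towards
  the strictly negative slice \<open>c = lo * a\<close> gives a uniform bound below it.\<close>

lemma B_negative:
  assumes v: "lo \<le> v" "v < \<mu> root"
  shows "\<exists>e>0. \<forall>a c. 2 / 5 \<le> a \<longrightarrow> a \<le> 1 / 2 \<longrightarrow> lo * a \<le> c \<longrightarrow> c \<le> v * a \<longrightarrow> B a c \<le> - e"
proof -
  define e0 where "e0 = - max (B (2 / 5) (lo * (2 / 5))) (B (1 / 2) (lo * (1 / 2)))"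
  have e0: "e0 > 0"
    using B_le[of "lo * (2 / 5)" "2 / 5"] B_le[of "lo * (1 / 2)" "1 / 2"] corner1 corner2 lo_hi(1)
    unfolding e0_def lo_def by auto
  have low: "B a (lo * a) \<le> - e0" if "2 / 5 \<le> a" "a \<le> 1 / 2" for a
    by (rule B_convex_a[OF that]) (use lo_hi in \<open>auto simp: e0_def\<close>)
  have "B (1 / 2) (\<mu> root * (1 / 2)) = 0"
    using root(3) unfolding B_def K_def by simp
  \<comment> \<open>This point lies on the edge a = 2/5 between the corners with slopes
    \<open>lo\<close> and \<open>hi\<close>, both of which have nonpositive values.\<close>
  moreover have "B (2 / 5) (\<mu> root * (2 / 5)) \<le> 0"
  proof -
    define u where "u = (\<mu> root * (2 / 5) / (2 / 5) - lo) / (hi - lo)"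
    have u: "0 \<le> u" "u \<le> 1" and "B (2 / 5) (\<mu> root * (2 / 5)) \<le> (1 - u) * B (2 / 5) (lo * (2 / 5)) + u * B (2 / 5) (hi * (2 / 5))"
      using B_convex_c[of "2 / 5" lo hi "\<mu> root * (2 / 5)"] lo_hi unfolding u_def by auto
    note this(3)
    also have "\<dots> \<le> (1 - u) * 0 + u * 0"
    proof (intro add_mono mult_left_mono)
      show "B (2 / 5) (lo * (2 / 5)) \<le> 0" using low[of "2 / 5"] e0 by simp
      show "B (2 / 5) (hi * (2 / 5)) \<le> 0"
        using B_le[of "hi * (2 / 5)" "2 / 5"] corner3 lo_hi unfolding hi_def by auto
    qed (use u in auto)
    finally show ?thesis by simp
  qed
  ultimately have high: "B a (\<mu> root * a) \<le> 0" if "2 / 5 \<le> a" "a \<le> 1 / 2" for a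
    by (intro B_convex_a[OF that]) (use lo_hi in auto)
  define u0 where "u0 = (v - lo) / (\<mu> root - lo)"
  have u0: "u0 < 1" using v lo_hi unfolding u0_def by (simp add: divide_less_eq)
  have "B a c \<le> - ((1 - u0) * e0)" if a: "2 / 5 \<le> a" "a \<le> 1 / 2" and c: "lo * a \<le> c" "c \<le> v * a" for a c
  proof -
    have "v * a \<le> \<mu> root * a" using v a by (intro mult_right_mono) auto
    then have c': "c \<le> \<mu> root * a" using c by simp
    define u where "u = (c / a - lo) / (\<mu> root - lo)"
    note cc = B_convex_c[OF a, of lo "\<mu> root" c, folded u_def]
    have u: "0 \<le> u" "u \<le> 1" and le: "B a c \<le> (1 - u) * B a (lo * a) + u * B a (\<mu> root * a)"
      using cc c(1) c' lo_hi by auto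
    have "c / a \<le> v" using c a by (simp add: pos_divide_le_eq)
    then have "u \<le> u0" unfolding u_def u0_def using lo_hi by (intro divide_right_mono) auto
    have "B a c \<le> (1 - u) * B a (lo * a) + u * B a (\<mu> root * a)" by (rule le)
    also have "\<dots> \<le> (1 - u) * (- e0) + u * 0"
      using u low[OF a] high[OF a] by (intro add_mono mult_left_mono) auto
    also have "\<dots> \<le> (1 - u0) * (- e0)" using \<open>u \<le> u0\<close> e0 by (simp add: mult_right_mono)
    finally show ?thesis by simp
  qed
  then show ?thesis using u0 e0 by (intro exI[of _ "(1 - u0) * e0"]) auto
qed

lemma expansion_limit:
  assumes \<nu>: "\<nu> < nu_star \<Delta>"
  shows "(\<lambda>m. measure_pmf.prob (pairing_model (2 * m) \<Delta>) {G. expansion G > \<nu>}) \<longlonglongrightarrow> 1"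
proof -
  \<comment> \<open>Raising \<nu> only enlarges the event to be excluded, and slopes below
    \<open>lo\<close> are covered by the crude count anyway.\<close>
  define v where "v = max \<nu> lo"
  have v: "lo \<le> v" "\<nu> \<le> v" "v < \<mu> root" "v < 2" "v \<le> hi"
    using \<nu> lo_hi unfolding v_def nu_star_eq by auto
  obtain e where e: "e > 0" "\<And>a c. 2 / 5 \<le> a \<Longrightarrow> a \<le> 1 / 2 \<Longrightarrow> lo * a \<le> c \<Longrightarrow> c \<le> v * a \<Longrightarrow> B a c \<le> - e"
    using B_negative[OF v(1,3)] by blast
  define f where "f t a n = (\<Sum>s::nat | s \<in> {1..n} \<and> real s \<le> a * n. (real \<Delta> * real s + 1)^2 * exp (s * small_cut_rate (\<Delta> / 2) t (s / n)))"
    for t a :: real and n :: nat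
  define f3 where "f3 n = (real n + 1) * real n ^ \<Delta> * 2 ^ \<Delta> * (exp 1 * (real \<Delta> * n + 1) ^ 3 * exp (- e * n))" for n
  have d2: "real \<Delta> / 2 \<ge> 2" using \<Delta> by simp
  have f1: "f t1 (1 / 2) \<longlonglongrightarrow> 0"
    using small_cut_sum_tendsto_0[OF d2 _ _ _ _ rate1] t unfolding f_def[abs_def] by simp
  have f2: "f t2 (2 / 5) \<longlonglongrightarrow> 0"
    using small_cut_sum_tendsto_0[OF d2 _ _ _ _ rate2] t unfolding f_def[abs_def] by simp
  have f3: "f3 \<longlonglongrightarrow> 0"
  proof (rule Lim_transform_eventually)
    \<comment> \<open>The powers with exponent \<Delta> are written as real powers of a positive
      constant D; for n >= 1 both forms agree.\<close>
    define D where "D = real \<Delta>"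
    have D: "D > 0" using \<Delta> unfolding D_def by simp
    show "(\<lambda>n. (real n + 1) * real n powr D * 2 powr D * (exp 1 * (D * real n + 1) ^ 3 * exp (- e * real n))) \<longlonglongrightarrow> 0"
      using e(1) D by real_asymp
    show "\<forall>\<^sub>F n in sequentially.
        (real n + 1) * real n powr D * 2 powr D * (exp 1 * (D * real n + 1) ^ 3 * exp (- e * real n)) = f3 n"
      by (rule eventually_sequentiallyI[of 1]) (simp add: f3_def D_def powr_realpow)
  qed
  have lower: "1 - (f t1 (1 / 2) n + f t2 (2 / 5) n + f3 n) \<le> measure_pmf.prob (pairing_model n \<Delta>) {G. expansion G > \<nu>}"
    if n: "even n" "n \<ge> 4" for n
  proof -
    define PM where "PM = perfect_matchings ({1..n} \<times> {1..\<Delta>})"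
    have finP: "finite PM" unfolding PM_def by (simp add: finite_perfect_matchings)
    have ev: "even (\<Delta> * n)" using n by simp
    have cP: "card PM = pm_count (\<Delta> * n)"
      unfolding PM_def by (simp add: card_perfect_matchings card_cartesian_product mult.commute)
    have pm: "pm_count (\<Delta> * n) > 0" using ev pm_count_pos by (elim evenE) simp
    then have neP: "PM \<noteq> {}" using cP by auto
    define bad where "bad = {M \<in> PM. \<not> expansion (merge_matching n M) > \<nu>}"
    define A where "A t a = {M \<in> PM. \<exists>S. S \<subseteq> {1..n} \<and> S \<noteq> {} \<and> card S \<le> a * n \<and>
        real (cut_size \<Delta> M S) \<le> (1 - t) * \<Delta> * card S}" for t a :: real
    define A3 where "A3 = {M \<in> PM. \<exists>S \<theta> g. S \<subseteq> {1..n} \<and> 2 * card S \<le> n \<and> 2 / 5 * n \<le> card S \<and>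
      real (cut_size \<Delta> M S) \<le> v * card S \<and> lo * card S \<le> real (cut_size \<Delta> M S) \<and>
      \<theta> \<le> n \<and> g \<in> {1..\<Delta>} \<rightarrow>\<^sub>E {1..n} \<and>
      (\<forall>v\<in>{1..n}. 2 * cross_deg \<Delta> M S v \<le> \<Delta> \<and>
        (2 * cross_deg \<Delta> M S v = \<Delta> \<longrightarrow> (if v \<in> S then v \<le> \<theta> else \<theta> < v \<or> v \<in> g ` {1..\<Delta>})))}"
    have sub: "bad \<subseteq> A t1 (1 / 2) \<union> A t2 (2 / 5) \<union> A3"
    proof
      fix M assume "M \<in> bad"
      then have M: "M \<in> PM" and "\<not> expansion (merge_matching n M) > v" using v unfolding bad_def by auto
      then obtain S \<theta> g where S: "S \<subseteq> {1..n}" "S \<noteq> {}" "2 * card S \<le> n" "real (cut_size \<Delta> M S) \<le> v * card S"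
        and str: "\<theta> \<le> n" "g \<in> {1..\<Delta>} \<rightarrow>\<^sub>E {1..n}"
        "\<forall>v\<in>{1..n}. 2 * cross_deg \<Delta> M S v \<le> \<Delta> \<and>
        (2 * cross_deg \<Delta> M S v = \<Delta> \<longrightarrow> (if v \<in> S then v \<le> \<theta> else \<theta> < v \<or> v \<in> g ` {1..\<Delta>}))"
        using low_expansion_imp_tie_broken_cut[OF M[unfolded PM_def] n \<Delta>(1) _ v(4)] \<Delta>(2) by auto
      \<comment> \<open>The first two cases belong to the crude count with t1 and t2. Only large
        sets with cuts near \<nu>*|S| need the tie-breaking data.\<close>
      consider "real (cut_size \<Delta> M S) \<le> lo * card S" | "real (card S) \<le> 2 / 5 * n"
        | "lo * card S \<le> real (cut_size \<Delta> M S)" "2 / 5 * n \<le> card S" by linarith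
      then show "M \<in> A t1 (1 / 2) \<union> A t2 (2 / 5) \<union> A3"
      proof cases
        case 1
        then have "M \<in> A t1 (1 / 2)" unfolding A_def lo_def using M S
          by (intro CollectI conjI exI[of _ S]) auto
        then show ?thesis by blast
      next
        case 2
        have "v * card S \<le> hi * card S" using v by (intro mult_right_mono) auto
        then have "real (cut_size \<Delta> M S) \<le> (1 - t2) * \<Delta> * card S" using S(4) unfolding hi_def by simp
        then have "M \<in> A t2 (2 / 5)" unfolding A_def using M S 2 by (intro CollectI conjI exI[of _ S]) auto
        then show ?thesis by blast
      next
        case 3
        have "M \<in> A3" unfolding A3_def
          by (intro CollectI conjI exI[of _ S] exI[of _ \<theta>] exI[of _ g] M S(1,3,4) 3 str)
        then show ?thesis by blast
      qed
    qed
    have cA: "real (card (A t a)) \<le> f t a n * pm_count (\<Delta> * n)" if "a \<le> 1 / 2" "1 / 2 \<le> t" "t < 1" for t a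
      using card_exists_small_cut_le[OF that ev _ _] n \<Delta>(2) unfolding A_def PM_def f_def by simp
    have rate: "pairing_rate (\<Delta> / 2) (s / n) (c / n) + ln (2 * half_poly \<Delta> root) - 2 * (c / n) * ln root \<le> - e"
      if s: "2 / 5 * real n \<le> real s" "2 * s \<le> n" "real c \<le> v * real s" "lo * real s \<le> real c" for s c :: nat
    proof -
      have n0: "real n > 0" using n by simp
      have "2 / 5 \<le> real s / n" "real s / n \<le> 1 / 2" using s(1,2) n0 by (simp_all add: field_simps)
      moreover have "lo * (real s / n) \<le> real c / n" "real c / n \<le> v * (real s / n)"
        using s(3,4) n0 by (simp_all add: divide_right_mono)
      ultimately show ?thesis using e(2)[of "s / n" "c / n"] unfolding B_def by simp
    qed
    have cA3: "real (card A3) \<le> f3 n * pm_count (\<Delta> * n)"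
      unfolding A3_def PM_def f3_def
      by (rule card_tie_broken_le[where x = root])
        (use n \<Delta> root X rate in simp_all)
    have "card bad \<le> card (A t1 (1 / 2) \<union> A t2 (2 / 5) \<union> A3)"
      by (rule card_mono[OF _ sub]) (use finP in \<open>auto simp: A_def A3_def\<close>)
    also have "\<dots> \<le> card (A t1 (1 / 2)) + card (A t2 (2 / 5)) + card A3"
      by (intro order.trans[OF card_Un_le] add_mono card_Un_le order.refl)
    finally have "real (card bad) \<le> real (card (A t1 (1 / 2))) + real (card (A t2 (2 / 5))) + real (card A3)"
      by linarith
    also have "\<dots> \<le> f t1 (1 / 2) n * pm_count (\<Delta> * n) + f t2 (2 / 5) n * pm_count (\<Delta> * n) + f3 n * pm_count (\<Delta> * n)"
      using cA[of "1 / 2" t1] cA[of "2 / 5" t2] cA3 t by (intro add_mono) auto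
    finally have bad_le: "real (card bad) \<le> (f t1 (1 / 2) n + f t2 (2 / 5) n + f3 n) * pm_count (\<Delta> * n)"
      by (simp add: algebra_simps)
    have "measure_pmf.prob (pairing_model n \<Delta>) {G. expansion G > \<nu>}
        = real (card (PM \<inter> merge_matching n -` {G. expansion G > \<nu>})) / real (card PM)"
      unfolding pairing_model_def PM_def[symmetric] using finP neP by (simp add: measure_pmf_of_set)
    also have "PM \<inter> merge_matching n -` {G. expansion G > \<nu>} = PM - bad" unfolding bad_def by auto
    also have "real (card (PM - bad)) = real (card PM) - real (card bad)"
    proof -
      have "bad \<subseteq> PM" unfolding bad_def by auto
      then show ?thesis using finP by (simp add: card_Diff_subset finite_subset card_mono of_nat_diff)
    qed
    finally have "measure_pmf.prob (pairing_model n \<Delta>) {G. expansion G > \<nu>} = (real (card PM) - real (card bad)) / real (card PM)" .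
    moreover have "(f t1 (1 / 2) n + f t2 (2 / 5) n + f3 n) \<ge> real (card bad) / real (card PM)"
      using bad_le pm unfolding cP by (simp add: divide_le_eq)
    ultimately show ?thesis using pm unfolding cP by (simp add: diff_divide_distrib)
  qed
  define F where "F n = 1 - (f t1 (1 / 2) n + f t2 (2 / 5) n + f3 n)" for n
  have "F \<longlonglongrightarrow> 1 - (0 + 0 + 0)" unfolding F_def[abs_def] by (intro tendsto_intros f1 f2 f3)
  then have "(F \<circ> (\<lambda>m. 2 * m)) \<longlonglongrightarrow> 1"
    by (intro LIMSEQ_subseq_LIMSEQ) (simp_all add: strict_mono_def)
  then have lim: "(\<lambda>m. F (2 * m)) \<longlonglongrightarrow> 1" by (simp add: o_def)
  show ?thesis
  proof (rule tendsto_sandwich[OF _ _ lim tendsto_const])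
    show "\<forall>\<^sub>F m in sequentially. F (2 * m) \<le> measure_pmf.prob (pairing_model (2 * m) \<Delta>) {G. expansion G > \<nu>}"
      using lower unfolding F_def by (intro eventually_sequentiallyI[of 2]) auto
    show "\<forall>\<^sub>F m in sequentially. measure_pmf.prob (pairing_model (2 * m) \<Delta>) {G. expansion G > \<nu>} \<le> 1"
      by (intro always_eventually allI measure_pmf.prob_le_1)
  qed
qed

end

section \<open>Numerical verification\<close>

text \<open>The arguments after 2 are ratios near 1, where the artanh series converges fast. Each
  ratio reaches one further prime up to 17 from smaller ones.\<close>

lemma ln_ratio_bounds:
  shows "ln (2 :: real) \<in> {69314718054 / 100000000000..69314718057 / 100000000000}"
    and "ln (3 / 2 :: real) \<in> {40546510809 / 100000000000..40546510812 / 100000000000}"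
    and "ln (5 / 4 :: real) \<in> {22314355130 / 100000000000..22314355133 / 100000000000}"
    and "ln (8 / 7 :: real) \<in> {13353139261 / 100000000000..13353139264 / 100000000000}"
    and "ln (11 / 10 :: real) \<in> {9531017979 / 100000000000..9531017982 / 100000000000}"
    and "ln (13 / 12 :: real) \<in> {8004270766 / 100000000000..8004270769 / 100000000000}"
    and "ln (17 / 16 :: real) \<in> {6062462180 / 100000000000..6062462183 / 100000000000}"
  subgoal using ln_approx_bounds[of "2" 12] by (simp add: eval_nat_numeral)
  subgoal using ln_approx_bounds[of "3 / 2" 8] by (simp add: eval_nat_numeral)
  subgoal using ln_approx_bounds[of "5 / 4" 6] by (simp add: eval_nat_numeral)
  subgoal using ln_approx_bounds[of "8 / 7" 5] by (simp add: eval_nat_numeral)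
  subgoal using ln_approx_bounds[of "11 / 10" 5] by (simp add: eval_nat_numeral)
  subgoal using ln_approx_bounds[of "13 / 12" 5] by (simp add: eval_nat_numeral)
  subgoal using ln_approx_bounds[of "17 / 16" 4] by (simp add: eval_nat_numeral)
  done

lemma ln_prime_eq:
  "ln (3 :: real) = ln 2 + ln (3 / 2)" "ln (5 :: real) = 2 * ln 2 + ln (5 / 4)"
  "ln (7 :: real) = 3 * ln 2 - ln (8 / 7)" "ln (11 :: real) = 3 * ln 2 + ln (5 / 4) + ln (11 / 10)"
  "ln (13 :: real) = 3 * ln 2 + ln (3 / 2) + ln (13 / 12)" "ln (17 :: real) = 4 * ln 2 + ln (17 / 16)"
  using ln_mult[of 2 "3 / 2"] ln_mult[of "2 ^ 2" "5 / 4"] ln_div[of "2 ^ 3" "8 / 7"]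
    ln_mult[of "2 ^ 3" "5 / 4"] ln_mult[of 10 "11 / 10"] ln_mult[of "2 ^ 3" "3 / 2"] ln_mult[of 12 "13 / 12"]
    ln_mult[of "2 ^ 4" "17 / 16"] ln_realpow[of 2 2] ln_realpow[of 2 3] ln_realpow[of 2 4]
  by simp_all

lemma ln_prime_bounds:
  "693147180 / 1000000000 \<le> ln (2 :: real)" "ln (2 :: real) \<le> 693147181 / 1000000000"
  "1098612288 / 1000000000 \<le> ln (3 :: real)" "ln (3 :: real) \<le> 1098612289 / 1000000000"
  "1609437912 / 1000000000 \<le> ln (5 :: real)" "ln (5 :: real) \<le> 1609437913 / 1000000000"
  "1945910148 / 1000000000 \<le> ln (7 :: real)" "ln (7 :: real) \<le> 1945910150 / 1000000000"
  "2397895272 / 1000000000 \<le> ln (11 :: real)" "ln (11 :: real) \<le> 2397895273 / 1000000000"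
  "2564949357 / 1000000000 \<le> ln (13 :: real)" "ln (13 :: real) \<le> 2564949358 / 1000000000"
  "2833213343 / 1000000000 \<le> ln (17 :: real)" "ln (17 :: real) \<le> 2833213345 / 1000000000"
  using ln_ratio_bounds unfolding ln_prime_eq atLeastAtMost_iff by linarith+

lemma exp_numeral_mult_ln: "x > 0 \<Longrightarrow> exp (numeral k * ln x) = x ^ numeral k" for x :: real
  by (metis exp_ln exp_of_nat_mult of_nat_numeral)

text \<open>The rationals in the numerical checks are chosen with all prime factors at most 17, so
  every check becomes linear in the logarithms of seven primes.\<close>

lemma ln_composite:
  "ln (4 :: real) = 2 * ln 2"
  "ln (6 :: real) = ln 2 + ln 3"
  "ln (8 :: real) = 3 * ln 2"
  "ln (9 :: real) = 2 * ln 3"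
  "ln (10 :: real) = ln 2 + ln 5"
  "ln (12 :: real) = 2 * ln 2 + ln 3"
  "ln (14 :: real) = ln 2 + ln 7"
  "ln (15 :: real) = ln 3 + ln 5"
  "ln (16 :: real) = 4 * ln 2"
  "ln (20 :: real) = 2 * ln 2 + ln 5"
  "ln (21 :: real) = ln 3 + ln 7"
  "ln (22 :: real) = ln 2 + ln 11"
  "ln (24 :: real) = 3 * ln 2 + ln 3"
  "ln (25 :: real) = 2 * ln 5"
  "ln (27 :: real) = 3 * ln 3"
  "ln (32 :: real) = 5 * ln 2"
  "ln (33 :: real) = ln 3 + ln 11"
  "ln (34 :: real) = ln 2 + ln 17"
  "ln (35 :: real) = ln 5 + ln 7"
  "ln (39 :: real) = ln 3 + ln 13"
  "ln (40 :: real) = 3 * ln 2 + ln 5"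
  "ln (48 :: real) = 4 * ln 2 + ln 3"
  "ln (52 :: real) = 2 * ln 2 + ln 13"
  "ln (56 :: real) = 3 * ln 2 + ln 7"
  "ln (63 :: real) = 2 * ln 3 + ln 7"
  "ln (65 :: real) = ln 5 + ln 13"
  "ln (70 :: real) = ln 2 + ln 5 + ln 7"
  "ln (100 :: real) = 2 * ln 2 + 2 * ln 5"
  "ln (128 :: real) = 7 * ln 2"
  "ln (130 :: real) = ln 2 + ln 5 + ln 13"
  "ln (135 :: real) = 3 * ln 3 + ln 5"
  "ln (189 :: real) = 3 * ln 3 + ln 7"
  "ln (196 :: real) = 2 * ln 2 + 2 * ln 7"
  "ln (245 :: real) = ln 5 + 2 * ln 7"
  "ln (264 :: real) = 3 * ln 2 + ln 3 + ln 11"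
  "ln (343 :: real) = 3 * ln 7"
  "ln (441 :: real) = 2 * ln 3 + 2 * ln 7"
  "ln (500 :: real) = 2 * ln 2 + 3 * ln 5"
  "ln (625 :: real) = 4 * ln 5"
  "ln (672 :: real) = 5 * ln 2 + ln 3 + ln 7"
  "ln (1125 :: real) = 2 * ln 3 + 3 * ln 5"
  "ln (2048 :: real) = 11 * ln 2"
  "ln (3125 :: real) = 5 * ln 5"
  "ln (3584 :: real) = 9 * ln 2 + ln 7"
  "ln (151875 :: real) = 5 * ln 3 + 4 * ln 5"
  "ln (401408 :: real) = 13 * ln 2 + 2 * ln 7"
  by (rule ln_unique, simp add: exp_add exp_numeral_mult_ln)+

lemmas small_powers = power2_eq_square power3_eq_cube power4_eq_xxxx

lemma sum_atMost_numeral: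
  fixes f :: "nat \<Rightarrow> real"
  shows "(\<Sum>i\<le>2. f i) = f 0 + f 1 + f 2" "(\<Sum>i\<le>3. f i) = f 0 + f 1 + f 2 + f 3"
    "(\<Sum>i\<le>4. f i) = f 0 + f 1 + f 2 + f 3 + f 4"
  by (simp_all add: eval_nat_numeral)

lemma small_binomials:
  "4 choose 2 = (6 :: nat)" "6 choose 2 = (15 :: nat)" "6 choose 3 = (20 :: nat)"
  "8 choose 2 = (28 :: nat)" "8 choose 3 = (56 :: nat)" "8 choose 4 = (70 :: nat)"
  by (simp_all add: eval_nat_numeral)

section \<open>Sign of \<open>K\<close> at rational points\<close>

context half_profile
begin

text \<open>Collecting the terms with coefficient \<mu>/2 leaves two logarithms whose arguments are
  rational at a rational x.\<close>

lemma K_altdef: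
  assumes x: "x > 0" and q: "x * P1 x < \<Delta> * P x"
  shows "K x = \<mu> x / 2 * ln (P1 x / ((\<Delta> * P x - x * P1 x) * x)) + ln (((\<Delta> - \<mu> x) / (2 * \<Delta>)) ^ (\<Delta> div 2) * (2 * P x))"
proof -
  define g where "g = \<mu> x / 2"
  have Px: "P x > 0" using P_pos x by simp
  have g: "0 < g" "g < \<Delta> / 2" using \<mu>_pos[OF x] q Px unfolding g_def \<mu>_def by (simp_all add: field_simps)
  have D: "real \<Delta> > 0" using \<Delta> by simp
  have "P1 x / ((\<Delta> * P x - x * P1 x) * x) = g / ((\<Delta> / 2 - g) * x\<^sup>2)"
  proof -
    have "P1 x = 2 * g * P x / x" unfolding g_def \<mu>_def using x Px by simp
    moreover have "\<Delta> * P x - x * P1 x = 2 * (\<Delta> / 2 - g) * P x"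
      unfolding g_def \<mu>_def using Px by (simp add: field_simps)
    ultimately have "P1 x / ((\<Delta> * P x - x * P1 x) * x) = (2 * g * P x / x) / (2 * (\<Delta> / 2 - g) * P x * x)"
      by (simp only:)
    also have "\<dots> = g / ((\<Delta> / 2 - g) * x\<^sup>2)"
    proof -
      define h where "h = \<Delta> / 2 - g"
      have "h > 0" using g unfolding h_def by simp
      then show ?thesis unfolding h_def[symmetric] using x Px by (simp add: field_simps power2_eq_square)
    qed
    finally show ?thesis .
  qed
  then have A: "ln (P1 x / ((\<Delta> * P x - x * P1 x) * x)) = ln g - ln (\<Delta> / 2 - g) - 2 * ln x"
    using g x by (simp add: ln_div ln_mult ln_realpow)
  have "(\<Delta> - \<mu> x) / (2 * \<Delta>) = (\<Delta> / 2 - g) / \<Delta>" unfolding g_def using D by (simp add: field_simps)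
  moreover have "real (\<Delta> div 2) = \<Delta> / 2" using \<Delta>(1) by (simp add: real_of_nat_div)
  ultimately have C: "ln (((\<Delta> - \<mu> x) / (2 * \<Delta>)) ^ (\<Delta> div 2) * (2 * P x)) = \<Delta> / 2 * (ln (\<Delta> / 2 - g) - ln \<Delta>) + ln (2 * P x)"
    using g D Px by (simp add: ln_mult ln_div ln_realpow)
  have mu: "\<mu> x = 2 * g" unfolding g_def by simp
  show ?thesis
    unfolding A C unfolding K_def pairing_rate_def mu by (simp add: xlnx_def field_simps)
qed

text \<open>The logarithms are compared with those of nearby rationals having small prime factors; by
  \<open>ln z \<le> z - 1\<close> the error is quadratic in the relative distance.\<close>

lemma K_less_0I:
  fixes x p q a c M A\<^sub>0 A\<^sub>1 C\<^sub>0 C\<^sub>1 :: real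
  assumes x: "x > 0" and p: "P x = p" and q: "P1 x = q" and pq: "x * q < \<Delta> * p"
    and A: "q / ((\<Delta> * p - x * q) * x) \<le> A\<^sub>1" and C: "((\<Delta> - x * q / p) / (2 * \<Delta>)) ^ (\<Delta> div 2) * (2 * p) \<le> C\<^sub>1"
    and M: "x * q / p \<le> M" and 0: "0 < A\<^sub>0" "0 < C\<^sub>0" and a: "ln A\<^sub>0 \<le> a" and c: "ln C\<^sub>0 \<le> c"
    and nn: "0 \<le> a + A\<^sub>1 / A\<^sub>0 - 1" and tot: "M / 2 * (a + A\<^sub>1 / A\<^sub>0 - 1) + (c + C\<^sub>1 / C\<^sub>0 - 1) < 0"
  shows "K x < 0"
proof -
  have up: "ln z \<le> l + z\<^sub>1 / z\<^sub>0 - 1" if "0 < z" "0 < z\<^sub>0" "z \<le> z\<^sub>1" "ln z\<^sub>0 \<le> l" for z z\<^sub>0 z\<^sub>1 l :: real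
  proof -
    have "ln (z / z\<^sub>0) \<le> z / z\<^sub>0 - 1" using that by (intro ln_le_minus_one) simp
    moreover have "z / z\<^sub>0 \<le> z\<^sub>1 / z\<^sub>0" using that by (intro divide_right_mono) auto
    ultimately show ?thesis using that by (simp add: ln_div)
  qed
  have pp: "p > 0" "q > 0" using P_pos[of x] P1_pos[of x] x p q by auto
  have D: "real \<Delta> > 0" using \<Delta> by simp
  have lt: "x * q / p < \<Delta>" using pq pp by (simp add: divide_less_eq)
  have "K x = x * q / p / 2 * ln (q / ((\<Delta> * p - x * q) * x)) + ln (((\<Delta> - x * q / p) / (2 * \<Delta>)) ^ (\<Delta> div 2) * (2 * p))"
    using K_altdef[OF x] pq unfolding \<mu>_def p q by simp
  also have "\<dots> \<le> x * q / p / 2 * (a + A\<^sub>1 / A\<^sub>0 - 1) + (c + C\<^sub>1 / C\<^sub>0 - 1)"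
    using x pp pq lt D by (intro add_mono mult_left_mono up 0 A C a c) (auto intro!: mult_pos_pos divide_pos_pos zero_less_power)
  also have "\<dots> \<le> M / 2 * (a + A\<^sub>1 / A\<^sub>0 - 1) + (c + C\<^sub>1 / C\<^sub>0 - 1)"
    using M nn by (intro add_right_mono mult_right_mono) auto
  finally show ?thesis using tot by simp
qed

lemma K_greater_0I:
  fixes x p q a c M A\<^sub>0 A\<^sub>1 C\<^sub>0 C\<^sub>1 :: real
  assumes x: "x > 0" and p: "P x = p" and q: "P1 x = q" and pq: "x * q < \<Delta> * p"
    and A: "A\<^sub>1 \<le> q / ((\<Delta> * p - x * q) * x)" and C: "C\<^sub>1 \<le> ((\<Delta> - x * q / p) / (2 * \<Delta>)) ^ (\<Delta> div 2) * (2 * p)"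
    and M: "M \<le> x * q / p" and 0: "0 < A\<^sub>0" "0 < C\<^sub>0" and 1: "0 < A\<^sub>1" "0 < C\<^sub>1"
    and a: "a \<le> ln A\<^sub>0" and c: "c \<le> ln C\<^sub>0"
    and nn: "0 \<le> a + 1 - A\<^sub>0 / A\<^sub>1" and tot: "0 < M / 2 * (a + 1 - A\<^sub>0 / A\<^sub>1) + (c + 1 - C\<^sub>0 / C\<^sub>1)"
  shows "K x > 0"
proof -
  \<comment> \<open>For a lower bound the inequality ln y <= y - 1 is applied to the reciprocal
    quotient \<open>z\<^sub>0 / z\<close>.\<close>
  have lb: "l + 1 - z\<^sub>0 / z\<^sub>1 \<le> ln z" if "0 < z\<^sub>1" "0 < z\<^sub>0" "z\<^sub>1 \<le> z" "l \<le> ln z\<^sub>0" for z z\<^sub>0 z\<^sub>1 l :: real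
  proof -
    have "ln (z\<^sub>0 / z) \<le> z\<^sub>0 / z - 1" using that by (intro ln_le_minus_one) simp
    moreover have "z\<^sub>0 / z \<le> z\<^sub>0 / z\<^sub>1" using that by (intro divide_left_mono) auto
    ultimately show ?thesis using that by (simp add: ln_div)
  qed
  have pp: "p > 0" "q > 0" using P_pos[of x] P1_pos[of x] x p q by auto
  have "0 < M / 2 * (a + 1 - A\<^sub>0 / A\<^sub>1) + (c + 1 - C\<^sub>0 / C\<^sub>1)" by (rule tot)
  also have "\<dots> \<le> x * q / p / 2 * (a + 1 - A\<^sub>0 / A\<^sub>1) + (c + 1 - C\<^sub>0 / C\<^sub>1)"
    using M nn by (intro add_right_mono mult_right_mono) auto
  also have "\<dots> \<le> x * q / p / 2 * ln (q / ((\<Delta> * p - x * q) * x)) + ln (((\<Delta> - x * q / p) / (2 * \<Delta>)) ^ (\<Delta> div 2) * (2 * p))"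
    using x pp by (intro add_mono mult_left_mono lb 0 1 A C a c) auto
  also have "\<dots> = K x"
    using K_altdef[OF x] pq unfolding \<mu>_def p q by simp
  finally show ?thesis .
qed

end

section \<open>The profiles for degrees 4, 6 and 8\<close>

lemma half_poly_4: "half_poly 4 x = 1 + 4 * x + 3 * x ^ 2"
  by (simp add: half_poly_def half_binom_def sum_atMost_numeral small_binomials)

text \<open>The last two fractions enclose the root tightly enough to fix four decimals of \<nu>*.
  Here X = 1 is taken, since at 1/2, the value used for degrees 6 and 8, the mean is 14/15 and has
  not yet reached 1.\<close>

interpretation hp4: half_profile 4 "\<lambda>x. 4 + 6 * x" "\<lambda>x. 6" "1" "49 / 283" "40 / 231"
proof
  show "even (4 :: nat)" "(4 :: nat) \<ge> 4" by simp_all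
  show "(half_poly 4 has_real_derivative 4 + 6 * x) (at x)" for x
    unfolding half_poly_4[abs_def] by (auto intro!: derivative_eq_intros simp: algebra_simps power2_eq_square power3_eq_cube)
  show "((\<lambda>x. 4 + 6 * x) has_real_derivative 6) (at x)" for x :: real
    by (auto intro!: derivative_eq_intros simp: algebra_simps power2_eq_square)
  show "0 < 4 + 6 * x" if "x \<ge> 0" for x :: real using that by (simp add: add_pos_nonneg)
  show "(\<Sum>i\<le>4 div 2. real i * (half_binom 4 i * x ^ i)) = x * (4 + 6 * x)" for x
    by (simp add: half_binom_def sum_atMost_numeral small_binomials algebra_simps small_powers)
  show "x * (4 + 6 * x) * (4 + 6 * x) < (4 + 6 * x + x * (6)) * half_poly 4 x" if "x > 0" for x
  proof -
    have "(4 + 6 * x + x * (6)) * half_poly 4 x - x * (4 + 6 * x) * (4 + 6 * x) = 4 + 12 * x ^ 1 + 12 * x ^ 2"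
      unfolding half_poly_4 by (simp add: eval_nat_numeral algebra_simps)
    moreover have "0 < 4 + 12 * x ^ 1 + 12 * x ^ 2" using that by (simp add: add_pos_nonneg)
    ultimately show ?thesis by simp
  qed
  show "0 < (49 / 283 :: real)" "(49 / 283 :: real) < 40 / 231" "(40 / 231 :: real) < 1" "(1 :: real) \<le> 1" by simp_all
  show "real 4 * half_poly 4 (1) \<le> 1 * (4 + 6 * (1)) * 4"
    unfolding half_poly_4 by (simp add: small_powers)
  show "40 / 231 * (4 + 6 * (40 / 231)) * 4 < real 4 * half_poly 4 (40 / 231)"
    unfolding half_poly_4 by (simp add: small_powers)
  show "real 4 * x * half_poly 4 x < (4 + 6 * x) * (1 + x\<^sup>2)"
    if "0 < x" "x < 1" "x * (4 + 6 * x) * 4 < real 4 * half_poly 4 x" for x :: real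
  proof -
    note that(3)
    \<comment> \<open>For degree 4 the condition that the mean is below 1 is exactly this
      inequality, and the difference of the two sides of the goal has 1 - 3 x^2 as a factor.\<close>
    then have "3 * x ^ 2 < 1" using that by (simp add: half_poly_4 algebra_simps power2_eq_square)
    then have "0 < 2 * (2 + x) * (1 - 3 * x ^ 2)" using that by (intro mult_pos_pos) auto
    then show ?thesis by (simp add: half_poly_4 algebra_simps power2_eq_square)
  qed
qed

text \<open>p and q are the exact values of P and its derivative. \<open>A\<^sub>0\<close> and
  \<open>C\<^sub>0\<close> have prime factors at most 7 and lie near the arguments of the two
  logarithms in \<open>K_altdef\<close>; \<open>A\<^sub>1\<close>, \<open>C\<^sub>1\<close> and M
  are those arguments and the mean, rounded in the safe direction. The evaluations for the other
  points follow the same pattern.\<close>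

lemma K_x1_4: "hp4.K (49 / 283) < 0"
proof (rule hp4.K_less_0I[where A\<^sub>0 = "2048 / 441" and C\<^sub>0 = "24 / 35"
      and A\<^sub>1 = "46506613517 / 10000000000" and C\<^sub>1 = "1372978723 / 2000000000" and M = "2447254133 / 5000000000"
      and a = "1535574141 / 1000000000" and c = "-377294201 / 1000000000" and p = "142760 / 80089" and q = "1426 / 283"])
  show "half_poly 4 (49 / 283) = 142760 / 80089" unfolding half_poly_4 by (simp add: small_powers)
  show "ln (2048 / 441 :: real) \<le> 1535574141 / 1000000000"
    using ln_prime_bounds by (simp add: ln_div ln_composite)
  show "ln (24 / 35 :: real) \<le> -377294201 / 1000000000"
    using ln_prime_bounds by (simp add: ln_div ln_composite)
qed (simp_all add: small_powers)

lemma K_x2_4: "hp4.K (40 / 231) > 0"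
proof (rule hp4.K_greater_0I[where A\<^sub>0 = "3125 / 672" and C\<^sub>0 = "343 / 500"
      and A\<^sub>1 = "9300350379 / 2000000000" and C\<^sub>1 = "6865069253 / 10000000000" and M = "2447409089 / 5000000000"
      and a = "1536931191 / 1000000000" and c = "-188438841 / 500000000" and p = "10569 / 5929" and q = "388 / 77"])
  show "half_poly 4 (40 / 231) = 10569 / 5929" unfolding half_poly_4 by (simp add: small_powers)
  show "ln (3125 / 672 :: real) \<ge> 1536931191 / 1000000000"
    using ln_prime_bounds by (simp add: ln_div ln_composite)
  show "ln (343 / 500 :: real) \<ge> -188438841 / 500000000"
    using ln_prime_bounds by (simp add: ln_div ln_composite)
qed (simp_all add: small_powers)

lemma half_poly_6: "half_poly 6 x = 1 + 6 * x + 15 * x ^ 2 + 10 * x ^ 3"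
  by (simp add: half_poly_def half_binom_def sum_atMost_numeral small_binomials)

interpretation hp6: half_profile 6 "\<lambda>x. 6 + 30 * x + 30 * x ^ 2" "\<lambda>x. 30 + 60 * x" "1 / 2" "287 / 1069" "69 / 257"
proof
  show "even (6 :: nat)" "(6 :: nat) \<ge> 4" by simp_all
  show "(half_poly 6 has_real_derivative 6 + 30 * x + 30 * x ^ 2) (at x)" for x
    unfolding half_poly_6[abs_def] by (auto intro!: derivative_eq_intros simp: algebra_simps power2_eq_square power3_eq_cube)
  show "((\<lambda>x. 6 + 30 * x + 30 * x ^ 2) has_real_derivative 30 + 60 * x) (at x)" for x :: real
    by (auto intro!: derivative_eq_intros simp: algebra_simps power2_eq_square)
  show "0 < 6 + 30 * x + 30 * x ^ 2" if "x \<ge> 0" for x :: real using that by (simp add: add_pos_nonneg)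
  show "(\<Sum>i\<le>6 div 2. real i * (half_binom 6 i * x ^ i)) = x * (6 + 30 * x + 30 * x ^ 2)" for x
    by (simp add: half_binom_def sum_atMost_numeral small_binomials algebra_simps small_powers)
  show "x * (6 + 30 * x + 30 * x ^ 2) * (6 + 30 * x + 30 * x ^ 2) < (6 + 30 * x + 30 * x ^ 2 + x * (30 + 60 * x)) * half_poly 6 x" if "x > 0" for x
  proof -
    have "(6 + 30 * x + 30 * x ^ 2 + x * (30 + 60 * x)) * half_poly 6 x - x * (6 + 30 * x + 30 * x ^ 2) * (6 + 30 * x + 30 * x ^ 2) = 6 + 60 * x ^ 1 + 180 * x ^ 2 + 240 * x ^ 3 + 150 * x ^ 4"
      unfolding half_poly_6 by (simp add: eval_nat_numeral algebra_simps)
    moreover have "0 < 6 + 60 * x ^ 1 + 180 * x ^ 2 + 240 * x ^ 3 + 150 * x ^ 4" using that by (simp add: add_pos_nonneg)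
    ultimately show ?thesis by simp
  qed
  show "0 < (287 / 1069 :: real)" "(287 / 1069 :: real) < 69 / 257" "(69 / 257 :: real) < 1 / 2" "(1 / 2 :: real) \<le> 1" by simp_all
  show "real 6 * half_poly 6 (1 / 2) \<le> 1 / 2 * (6 + 30 * (1 / 2) + 30 * (1 / 2) ^ 2) * 4"
    unfolding half_poly_6 by (simp add: small_powers)
  show "69 / 257 * (6 + 30 * (69 / 257) + 30 * (69 / 257) ^ 2) * 4 < real 6 * half_poly 6 (69 / 257)"
    unfolding half_poly_6 by (simp add: small_powers)
  show "real 6 * x * half_poly 6 x < (6 + 30 * x + 30 * x ^ 2) * (1 + x\<^sup>2)"
    if "0 < x" "x < 1 / 2" "x * (6 + 30 * x + 30 * x ^ 2) * 4 < real 6 * half_poly 6 x" for x :: real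
  proof -
    note that(3)
    have "x * x \<le> 1 / 2 * (1 / 2)" using that by (intro mult_mono) auto
    \<comment> \<open>The difference of the two sides of the goal is 6 (1 + 4 x - 10 x^3 - 5 x^4).
      For x below 1/2 the negative terms are at most multiples of x that 4 x dominates.\<close>
    then have a: "x * (x * x) \<le> x * (1 / 4)" using that by (intro mult_left_mono) auto
    have b: "x * (x * (x * x)) \<le> 1 / 2 * (x * (1 / 4))" using that by (intro mult_mono a) auto
    have "0 < 6 * (1 + 4 * x - 10 * u - 5 * w)" if "u \<le> x * (1 / 4)" "w \<le> 1 / 2 * (x * (1 / 4))" "0 < x" for u w :: real
      using that by (simp add: field_simps)
    from this[OF a b that(1)] have "0 < 6 * (1 + 4 * x - 10 * (x * (x * x)) - 5 * (x * (x * (x * x))))" .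
    then show ?thesis by (simp add: half_poly_6 algebra_simps power2_eq_square power3_eq_cube)
  qed
qed

lemma K_x1_6: "hp6.K (287 / 1069) < 0"
proof (rule hp6.K_less_0I[where A\<^sub>0 = "3584 / 1125" and C\<^sub>0 = "128 / 245"
      and A\<^sub>1 = "637174791 / 200000000" and C\<^sub>1 = "5224736819 / 10000000000" and M = "11205009107 / 10000000000"
      and a = "115869649 / 100000000" and c = "-162306979 / 250000000" and p = "4746631896 / 1221611509" and q = "18531726 / 1142761"])
  show "half_poly 6 (287 / 1069) = 4746631896 / 1221611509" unfolding half_poly_6 by (simp add: small_powers)
  show "ln (3584 / 1125 :: real) \<le> 115869649 / 100000000"
    using ln_prime_bounds by (simp add: ln_div ln_composite)
  show "ln (128 / 245 :: real) \<le> -162306979 / 250000000"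
    using ln_prime_bounds by (simp add: ln_div ln_composite)
qed (simp_all add: small_powers)

lemma K_x2_6: "hp6.K (69 / 257) > 0"
proof (rule hp6.K_greater_0I[where A\<^sub>0 = "625 / 196" and C\<^sub>0 = "128 / 245"
      and A\<^sub>1 = "15928847357 / 5000000000" and C\<^sub>1 = "261241641 / 500000000" and M = "560260221 / 500000000"
      and a = "7247731 / 6250000" and c = "-649227977 / 1000000000" and p = "65957624 / 16974593" and q = "1071114 / 66049"])
  show "half_poly 6 (69 / 257) = 65957624 / 16974593" unfolding half_poly_6 by (simp add: small_powers)
  show "ln (625 / 196 :: real) \<ge> 7247731 / 6250000"
    using ln_prime_bounds by (simp add: ln_div ln_composite)
  show "ln (128 / 245 :: real) \<ge> -649227977 / 1000000000"
    using ln_prime_bounds by (simp add: ln_div ln_composite)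
qed (simp_all add: small_powers)

lemma half_poly_8: "half_poly 8 x = 1 + 8 * x + 28 * x ^ 2 + 56 * x ^ 3 + 35 * x ^ 4"
  by (simp add: half_poly_def half_binom_def sum_atMost_numeral small_binomials)

interpretation hp8: half_profile 8 "\<lambda>x. 8 + 56 * x + 168 * x ^ 2 + 140 * x ^ 3" "\<lambda>x. 56 + 336 * x + 420 * x ^ 2" "1 / 2" "441 / 1324" "485 / 1456"
proof
  show "even (8 :: nat)" "(8 :: nat) \<ge> 4" by simp_all
  show "(half_poly 8 has_real_derivative 8 + 56 * x + 168 * x ^ 2 + 140 * x ^ 3) (at x)" for x
    unfolding half_poly_8[abs_def] by (auto intro!: derivative_eq_intros simp: algebra_simps power2_eq_square power3_eq_cube)
  show "((\<lambda>x. 8 + 56 * x + 168 * x ^ 2 + 140 * x ^ 3) has_real_derivative 56 + 336 * x + 420 * x ^ 2) (at x)" for x :: real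
    by (auto intro!: derivative_eq_intros simp: algebra_simps power2_eq_square)
  show "0 < 8 + 56 * x + 168 * x ^ 2 + 140 * x ^ 3" if "x \<ge> 0" for x :: real using that by (simp add: add_pos_nonneg)
  show "(\<Sum>i\<le>8 div 2. real i * (half_binom 8 i * x ^ i)) = x * (8 + 56 * x + 168 * x ^ 2 + 140 * x ^ 3)" for x
    by (simp add: half_binom_def sum_atMost_numeral small_binomials algebra_simps small_powers)
  show "x * (8 + 56 * x + 168 * x ^ 2 + 140 * x ^ 3) * (8 + 56 * x + 168 * x ^ 2 + 140 * x ^ 3) < (8 + 56 * x + 168 * x ^ 2 + 140 * x ^ 3 + x * (56 + 336 * x + 420 * x ^ 2)) * half_poly 8 x" if "x > 0" for x
  proof -
    have "(8 + 56 * x + 168 * x ^ 2 + 140 * x ^ 3 + x * (56 + 336 * x + 420 * x ^ 2)) * half_poly 8 x - x * (8 + 56 * x + 168 * x ^ 2 + 140 * x ^ 3) * (8 + 56 * x + 168 * x ^ 2 + 140 * x ^ 3) = 8 + 112 * x ^ 1 + 728 * x ^ 2 + 2352 * x ^ 3 + 4088 * x ^ 4 + 3920 * x ^ 5 + 1960 * x ^ 6"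
      unfolding half_poly_8 by (simp add: eval_nat_numeral algebra_simps)
    moreover have "0 < 8 + 112 * x ^ 1 + 728 * x ^ 2 + 2352 * x ^ 3 + 4088 * x ^ 4 + 3920 * x ^ 5 + 1960 * x ^ 6" using that by (simp add: add_pos_nonneg)
    ultimately show ?thesis by simp
  qed
  show "0 < (441 / 1324 :: real)" "(441 / 1324 :: real) < 485 / 1456" "(485 / 1456 :: real) < 1 / 2" "(1 / 2 :: real) \<le> 1" by simp_all
  show "real 8 * half_poly 8 (1 / 2) \<le> 1 / 2 * (8 + 56 * (1 / 2) + 168 * (1 / 2) ^ 2 + 140 * (1 / 2) ^ 3) * 4"
    unfolding half_poly_8 by (simp add: small_powers)
  show "485 / 1456 * (8 + 56 * (485 / 1456) + 168 * (485 / 1456) ^ 2 + 140 * (485 / 1456) ^ 3) * 4 < real 8 * half_poly 8 (485 / 1456)"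
    unfolding half_poly_8 by (simp add: small_powers)
  show "real 8 * x * half_poly 8 x < (8 + 56 * x + 168 * x ^ 2 + 140 * x ^ 3) * (1 + x\<^sup>2)"
    if "0 < x" "x < 1 / 2" "x * (8 + 56 * x + 168 * x ^ 2 + 140 * x ^ 3) * 4 < real 8 * half_poly 8 x" for x :: real
  proof -
    note that(3)
    have x2: "0 \<le> x * x" by simp
    \<comment> \<open>The powers 3 to 5 are reduced to multiples of x^2. Together they cost 14 + 70
      + 17.5 such units, fewer than the 112 available.\<close>
    have a: "x * (x * x) \<le> 1 / 2 * (x * x)" using that by (intro mult_right_mono) auto
    have b: "x * (x * (x * x)) \<le> 1 / 2 * (1 / 2 * (x * x))" using that a by (intro mult_mono) auto
    have c: "x * (x * (x * (x * x))) \<le> 1 / 2 * (1 / 2 * (1 / 2 * (x * x)))" using that b by (intro mult_mono) auto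
    have "0 < 8 + 48 * x + 112 * (x * x) - 28 * (x * (x * x)) - 280 * (x * (x * (x * x))) - 140 * (x * (x * (x * (x * x))))"
      using a b c x2 that(1) by linarith
    then show ?thesis by (simp add: half_poly_8 algebra_simps small_powers)
  qed
qed

lemma K_x1_8: "hp8.K (441 / 1324) < 0"
proof (rule hp8.K_less_0I[where A\<^sub>0 = "500 / 189" and C\<^sub>0 = "56 / 135"
      and A\<^sub>1 = "26412998541 / 10000000000" and C\<^sub>1 = "4145788871 / 10000000000" and M = "18130039647 / 10000000000"
      and a = "486430557 / 500000000" and c = "-879923057 / 1000000000" and p = "28489820032675 / 3072924856576" and q = "29281267955 / 580235056"])
  show "half_poly 8 (441 / 1324) = 28489820032675 / 3072924856576" unfolding half_poly_8 by (simp add: small_powers)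
  show "ln (500 / 189 :: real) \<le> 486430557 / 500000000"
    using ln_prime_bounds by (simp add: ln_div ln_composite)
  show "ln (56 / 135 :: real) \<le> -879923057 / 1000000000"
    using ln_prime_bounds by (simp add: ln_div ln_composite)
qed (simp_all add: small_powers)

lemma K_x2_8: "hp8.K (485 / 1456) > 0"
proof (rule hp8.K_greater_0I[where A\<^sub>0 = "401408 / 151875" and C\<^sub>0 = "56 / 135"
      and A\<^sub>1 = "5282157923 / 2000000000" and C\<^sub>1 = "2073051599 / 5000000000" and M = "9065394287 / 5000000000"
      and a = "485960261 / 500000000" and c = "-439961559 / 500000000" and p = "5953045200693 / 642018377728" and q = "5563577521 / 110236672"])
  show "half_poly 8 (485 / 1456) = 5953045200693 / 642018377728" unfolding half_poly_8 by (simp add: small_powers)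
  show "ln (401408 / 151875 :: real) \<ge> 485960261 / 500000000"
    using ln_prime_bounds by (simp add: ln_div ln_composite)
  show "ln (56 / 135 :: real) \<ge> -439961559 / 500000000"
    using ln_prime_bounds by (simp add: ln_div ln_composite)
qed (simp_all add: small_powers)

text \<open>Replaces x1 and 2 P(x2) by slightly worse rationals L and U with small prime factors, so
  that their logarithms reduce to those of the listed primes.\<close>

lemma corner_less:
  fixes d a c x p L U :: real
  assumes "pairing_rate d a c + ln U - 2 * c * ln L < 0" "0 \<le> c" "0 < L" "L \<le> x" "0 < p" "2 * p \<le> U"
  shows "pairing_rate d a c + ln (2 * p) - 2 * c * ln x < 0"
proof -
  have "ln (2 * p) \<le> ln U" using assms by (subst ln_le_cancel_iff) auto
  moreover have "2 * c * ln L \<le> 2 * c * ln x" using assms by (intro mult_left_mono) auto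
  ultimately show ?thesis using assms(1) by linarith
qed

text \<open>The slopes are \<open>lo\<close> = 1/3 and \<open>hi\<close> = 1/2, the latter just
  above \<nu>* = 0.4894...\<close>

interpretation hp4: half_profile_bounds 4 "\<lambda>x. 4 + 6 * x" "\<lambda>x. 6" "1" "49 / 283" "40 / 231" "11 / 12" "7 / 8"
proof
  show "hp4.K (49 / 283) < 0" by (rule K_x1_4)
  show "hp4.K (40 / 231) > 0" by (rule K_x2_4)
  show "3 / 4 \<le> (7 / 8 :: real)" "(7 / 8 :: real) \<le> 11 / 12" "(11 / 12 :: real) < 1" by simp_all
  show "small_cut_rate (real 4 / 2) (11 / 12) (1 / 2) < 0"
    unfolding small_cut_rate_def bin_entropy_def xlnx_def
    by (simp add: ln_div ln_composite) (use ln_prime_bounds in \<open>simp add: field_simps\<close>)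
  show "small_cut_rate (real 4 / 2) (7 / 8) (2 / 5) < 0"
    unfolding small_cut_rate_def bin_entropy_def xlnx_def
    by (simp add: ln_div ln_composite) (use ln_prime_bounds in \<open>simp add: field_simps\<close>)
  show "(1 - 11 / 12) * real 4 < hp4.\<mu> (49 / 283)" "hp4.\<mu> (40 / 231) \<le> (1 - 7 / 8) * real 4" "(1 - 7 / 8) * real 4 < 2"
    unfolding hp4.\<mu>_def half_poly_4 by (simp_all add: small_powers)
  have p: "2 * half_poly 4 (40 / 231) \<le> 25 / 7" "0 < half_poly 4 (40 / 231)"
    unfolding half_poly_4 by (simp_all add: small_powers)

  show "pairing_rate (real 4 / 2) (2 / 5) ((1 - 11 / 12) * real 4 * (2 / 5)) + ln (2 * half_poly 4 (40 / 231)) - 2 * ((1 - 11 / 12) * real 4 * (2 / 5)) * ln (49 / 283) < 0"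
    by (rule corner_less[OF _ _ _ _ p(2,1), where L = "9 / 52"])
      (simp_all add: pairing_rate_def xlnx_def ln_div ln_composite, use ln_prime_bounds in \<open>simp add: field_simps\<close>)

  show "pairing_rate (real 4 / 2) (1 / 2) ((1 - 11 / 12) * real 4 * (1 / 2)) + ln (2 * half_poly 4 (40 / 231)) - 2 * ((1 - 11 / 12) * real 4 * (1 / 2)) * ln (49 / 283) < 0"
    by (rule corner_less[OF _ _ _ _ p(2,1), where L = "9 / 52"])
      (simp_all add: pairing_rate_def xlnx_def ln_div ln_composite, use ln_prime_bounds in \<open>simp add: field_simps\<close>)

  have "pairing_rate (real 4 / 2) (2 / 5) ((1 - 7 / 8) * real 4 * (2 / 5)) + ln (2 * half_poly 4 (40 / 231)) - 2 * ((1 - 7 / 8) * real 4 * (2 / 5)) * ln (49 / 283) < 0"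
    by (rule corner_less[OF _ _ _ _ p(2,1), where L = "9 / 52"])
      (simp_all add: pairing_rate_def xlnx_def ln_div ln_composite, use ln_prime_bounds in \<open>simp add: field_simps\<close>)
  then show "pairing_rate (real 4 / 2) (2 / 5) ((1 - 7 / 8) * real 4 * (2 / 5)) + ln (2 * half_poly 4 (40 / 231)) - 2 * ((1 - 7 / 8) * real 4 * (2 / 5)) * ln (49 / 283) \<le> 0" by (rule less_imp_le)
qed

lemma nu_star_4_bounds: "0.4894 \<le> nu_star 4" "nu_star 4 < 0.4895"
proof -
  have "0.4894 \<le> hp4.\<mu> (49 / 283)" "hp4.\<mu> (40 / 231) \<le> 0.4895"
    unfolding hp4.\<mu>_def half_poly_4 by (simp_all add: small_powers)
  then show "0.4894 \<le> nu_star 4" "nu_star 4 < 0.4895"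
    using hp4.\<mu>_root(1,2) unfolding hp4.nu_star_eq by simp_all
qed

text \<open>The slopes are \<open>lo\<close> = 3/4 and \<open>hi\<close> = 9/8, the latter just
  above \<nu>* = 1.1205...\<close>

interpretation hp6: half_profile_bounds 6 "\<lambda>x. 6 + 30 * x + 30 * x ^ 2" "\<lambda>x. 30 + 60 * x" "1 / 2" "287 / 1069" "69 / 257" "7 / 8" "13 / 16"
proof
  show "hp6.K (287 / 1069) < 0" by (rule K_x1_6)
  show "hp6.K (69 / 257) > 0" by (rule K_x2_6)
  show "3 / 4 \<le> (13 / 16 :: real)" "(13 / 16 :: real) \<le> 7 / 8" "(7 / 8 :: real) < 1" by simp_all
  show "small_cut_rate (real 6 / 2) (7 / 8) (1 / 2) < 0"
    unfolding small_cut_rate_def bin_entropy_def xlnx_def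
    by (simp add: ln_div ln_composite) (use ln_prime_bounds in \<open>simp add: field_simps\<close>)
  show "small_cut_rate (real 6 / 2) (13 / 16) (2 / 5) < 0"
    unfolding small_cut_rate_def bin_entropy_def xlnx_def
    by (simp add: ln_div ln_composite) (use ln_prime_bounds in \<open>simp add: field_simps\<close>)
  show "(1 - 7 / 8) * real 6 < hp6.\<mu> (287 / 1069)" "hp6.\<mu> (69 / 257) \<le> (1 - 13 / 16) * real 6" "(1 - 13 / 16) * real 6 < 2"
    unfolding hp6.\<mu>_def half_poly_6 by (simp_all add: small_powers)
  have p: "2 * half_poly 6 (69 / 257) \<le> 70 / 9" "0 < half_poly 6 (69 / 257)"
    unfolding half_poly_6 by (simp_all add: small_powers)

  show "pairing_rate (real 6 / 2) (2 / 5) ((1 - 7 / 8) * real 6 * (2 / 5)) + ln (2 * half_poly 6 (69 / 257)) - 2 * ((1 - 7 / 8) * real 6 * (2 / 5)) * ln (287 / 1069) < 0"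
    by (rule corner_less[OF _ _ _ _ p(2,1), where L = "4 / 15"])
      (simp_all add: pairing_rate_def xlnx_def ln_div ln_composite, use ln_prime_bounds in \<open>simp add: field_simps\<close>)

  show "pairing_rate (real 6 / 2) (1 / 2) ((1 - 7 / 8) * real 6 * (1 / 2)) + ln (2 * half_poly 6 (69 / 257)) - 2 * ((1 - 7 / 8) * real 6 * (1 / 2)) * ln (287 / 1069) < 0"
    by (rule corner_less[OF _ _ _ _ p(2,1), where L = "4 / 15"])
      (simp_all add: pairing_rate_def xlnx_def ln_div ln_composite, use ln_prime_bounds in \<open>simp add: field_simps\<close>)

  have "pairing_rate (real 6 / 2) (2 / 5) ((1 - 13 / 16) * real 6 * (2 / 5)) + ln (2 * half_poly 6 (69 / 257)) - 2 * ((1 - 13 / 16) * real 6 * (2 / 5)) * ln (287 / 1069) < 0"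
    by (rule corner_less[OF _ _ _ _ p(2,1), where L = "4 / 15"])
      (simp_all add: pairing_rate_def xlnx_def ln_div ln_composite, use ln_prime_bounds in \<open>simp add: field_simps\<close>)
  then show "pairing_rate (real 6 / 2) (2 / 5) ((1 - 13 / 16) * real 6 * (2 / 5)) + ln (2 * half_poly 6 (69 / 257)) - 2 * ((1 - 13 / 16) * real 6 * (2 / 5)) * ln (287 / 1069) \<le> 0" by (rule less_imp_le)
qed

lemma nu_star_6_bounds: "1.1205 \<le> nu_star 6" "nu_star 6 < 1.1206"
proof -
  have "1.1205 \<le> hp6.\<mu> (287 / 1069)" "hp6.\<mu> (69 / 257) \<le> 1.1206"
    unfolding hp6.\<mu>_def half_poly_6 by (simp_all add: small_powers)
  then show "1.1205 \<le> nu_star 6" "nu_star 6 < 1.1206"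
    using hp6.\<mu>_root(1,2) unfolding hp6.nu_star_eq by simp_all
qed

text \<open>The slopes are \<open>lo\<close> = 1 and \<open>hi\<close> = 24/13. The upper one has to
  lie between \<nu>* = 1.8130... and 2, which forces t2 to be only slightly above 3/4.\<close>

interpretation hp8: half_profile_bounds 8 "\<lambda>x. 8 + 56 * x + 168 * x ^ 2 + 140 * x ^ 3" "\<lambda>x. 56 + 336 * x + 420 * x ^ 2" "1 / 2" "441 / 1324" "485 / 1456" "7 / 8" "10 / 13"
proof
  show "hp8.K (441 / 1324) < 0" by (rule K_x1_8)
  show "hp8.K (485 / 1456) > 0" by (rule K_x2_8)
  show "3 / 4 \<le> (10 / 13 :: real)" "(10 / 13 :: real) \<le> 7 / 8" "(7 / 8 :: real) < 1" by simp_all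
  show "small_cut_rate (real 8 / 2) (7 / 8) (1 / 2) < 0"
    unfolding small_cut_rate_def bin_entropy_def xlnx_def
    by (simp add: ln_div ln_composite) (use ln_prime_bounds in \<open>simp add: field_simps\<close>)
  show "small_cut_rate (real 8 / 2) (10 / 13) (2 / 5) < 0"
    unfolding small_cut_rate_def bin_entropy_def xlnx_def
    by (simp add: ln_div ln_composite) (use ln_prime_bounds in \<open>simp add: field_simps\<close>)
  show "(1 - 7 / 8) * real 8 < hp8.\<mu> (441 / 1324)" "hp8.\<mu> (485 / 1456) \<le> (1 - 10 / 13) * real 8" "(1 - 10 / 13) * real 8 < 2"
    unfolding hp8.\<mu>_def half_poly_8 by (simp_all add: small_powers)
  have p: "2 * half_poly 8 (485 / 1456) \<le> 130 / 7" "0 < half_poly 8 (485 / 1456)"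
    unfolding half_poly_8 by (simp_all add: small_powers)

  show "pairing_rate (real 8 / 2) (2 / 5) ((1 - 7 / 8) * real 8 * (2 / 5)) + ln (2 * half_poly 8 (485 / 1456)) - 2 * ((1 - 7 / 8) * real 8 * (2 / 5)) * ln (441 / 1324) < 0"
    by (rule corner_less[OF _ _ _ _ p(2,1), where L = "33 / 100"])
      (simp_all add: pairing_rate_def xlnx_def ln_div ln_composite, use ln_prime_bounds in \<open>simp add: field_simps\<close>)

  show "pairing_rate (real 8 / 2) (1 / 2) ((1 - 7 / 8) * real 8 * (1 / 2)) + ln (2 * half_poly 8 (485 / 1456)) - 2 * ((1 - 7 / 8) * real 8 * (1 / 2)) * ln (441 / 1324) < 0"
    by (rule corner_less[OF _ _ _ _ p(2,1), where L = "33 / 100"])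
      (simp_all add: pairing_rate_def xlnx_def ln_div ln_composite, use ln_prime_bounds in \<open>simp add: field_simps\<close>)

  have "pairing_rate (real 8 / 2) (2 / 5) ((1 - 10 / 13) * real 8 * (2 / 5)) + ln (2 * half_poly 8 (485 / 1456)) - 2 * ((1 - 10 / 13) * real 8 * (2 / 5)) * ln (441 / 1324) < 0"
    by (rule corner_less[OF _ _ _ _ p(2,1), where L = "33 / 100"])
      (simp_all add: pairing_rate_def xlnx_def ln_div ln_composite, use ln_prime_bounds in \<open>simp add: field_simps\<close>)
  then show "pairing_rate (real 8 / 2) (2 / 5) ((1 - 10 / 13) * real 8 * (2 / 5)) + ln (2 * half_poly 8 (485 / 1456)) - 2 * ((1 - 10 / 13) * real 8 * (2 / 5)) * ln (441 / 1324) \<le> 0" by (rule less_imp_le)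
qed

lemma nu_star_8_bounds: "1.8130 \<le> nu_star 8" "nu_star 8 < 1.8131"
proof -
  have "1.8130 \<le> hp8.\<mu> (441 / 1324)" "hp8.\<mu> (485 / 1456) \<le> 1.8131"
    unfolding hp8.\<mu>_def half_poly_8 by (simp_all add: small_powers)
  then show "1.8130 \<le> nu_star 8" "nu_star 8 < 1.8131"
    using hp8.\<mu>_root(1,2) unfolding hp8.nu_star_eq by simp_all
qed

theorem theorem1:
  fixes \<Delta> :: nat
  assumes "\<Delta> \<in> {4, 6, 8}"
  shows "(\<exists>!\<nu>::real. 0 < \<nu> \<and> \<nu> < real \<Delta> / 4 \<and> H \<Delta> (\<nu> / 2) = 0)
    \<and> (\<Delta> = 4 \<longrightarrow> 0.4894 \<le> nu_star \<Delta> \<and> nu_star \<Delta> < 0.4895)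
    \<and> (\<Delta> = 6 \<longrightarrow> 1.1205 \<le> nu_star \<Delta> \<and> nu_star \<Delta> < 1.1206)
    \<and> (\<Delta> = 8 \<longrightarrow> 1.8130 \<le> nu_star \<Delta> \<and> nu_star \<Delta> < 1.8131)
    \<and> (\<forall>\<nu>::real. \<nu> < nu_star \<Delta> \<longrightarrow>
          (\<lambda>m. measure_pmf.prob (pairing_model (2 * m) \<Delta>) {G. expansion G > \<nu>})
            \<longlonglongrightarrow> 1)"
proof -
  consider (1) "\<Delta> = 4" | (2) "\<Delta> = 6" | (3) "\<Delta> = 8" using assms by blast
  note \<Delta> = this
  have root: "\<exists>!\<nu>::real. 0 < \<nu> \<and> \<nu> < real \<Delta> / 4 \<and> H \<Delta> (\<nu> / 2) = 0"
    using \<Delta>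
  proof cases
    case 1
    then show ?thesis using hp4.ex1_root by (simp only:)
  next
    case 2
    then show ?thesis using hp6.ex1_root by (simp only:)
  next
    case 3
    then show ?thesis using hp8.ex1_root by (simp only:)
  qed
  have limit: "(\<lambda>m. measure_pmf.prob (pairing_model (2 * m) \<Delta>) {G. expansion G > \<nu>}) \<longlonglongrightarrow> 1"
    if "\<nu> < nu_star \<Delta>" for \<nu>
    using \<Delta>
  proof cases
    case 1
    then show ?thesis using that hp4.expansion_limit[of \<nu>] by (simp only:)
  next
    case 2
    then show ?thesis using that hp6.expansion_limit[of \<nu>] by (simp only:)
  next
    case 3
    then show ?thesis using that hp8.expansion_limit[of \<nu>] by (simp only:)
  qed
  show ?thesis
    using root limit nu_star_4_bounds nu_star_6_bounds nu_star_8_bounds by simp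
qed

end
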